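(* On $\mathbb{R}^{2n}$ with coordinates $(x_1,y_1,\dots,x_n,y_n)$ and $\omega=\sum_{i=1}^n\mathrm{d}x_i\wedge\mathrm{d}y_i$, let $h_i=x_i^2+y_i^2$ for all $i=1,\dots,n$ (all vector fields of elliptic type), with Hamiltonian vector fields $X_i=2(-y_i\partial_{x_i}+x_i\partial_{y_i})$. Then for $k=1,\dots,n$, $$\ker\big(\mathrm{d}_{\mathcal{F}}:\Omega^k_{\mathcal{F}}(\mathbb{R}^{2n})\to\Omega^{k+1}_{\mathcal{F}}(\mathbb{R}^{2n})\big)=W^k_{\mathcal{F}}(\mathbb{R}^{2n})\oplus\mathrm{d}_{\mathcal{F}}\big(\Omega^{k-1}_{\mathcal{F}}(\mathbb{R}^{2n})\big),$$ where $W^k_{\mathcal{F}}(\mathbb{R}^{2n})$ is the set of $\beta\in\Omega^k_{\mathcal{F}}(\mathbb{R}^{2n})$ with $\pounds_{X_i}\beta=0$ for all $i$. Consequently $$H^k_{\mathcal{F}}(\mathbb{R}^{2n})\cong\bigoplus_{1\le j_1<\cdots<j_k\le n}\Big\{f_{j_1\cdots j_k}\in C^\infty(\mathbb{R}^{2n}) : \exists f \text{ with } f_{j_1\cdots j_k}(p)=f(h_1(p),\dots,h_n(p))\ \forall p, \text{ and } f_{j_1\cdots j_k}|_{\Sigma_{j_1}\cup\cdots\cup\Sigma_{j_k}}=0\Big\},$$ a direct sum of $\binom{n}{k}$ summands.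
   Context: $\mathcal{F}$ is the $C^\infty(\mathbb{R}^{2n})$-module generated by the commuting vector fields $X_1,\dots,X_n$; $\Omega^k_{\mathcal{F}}(\mathbb{R}^{2n})=\mathrm{Hom}_{C^\infty}(\wedge^k_{C^\infty}\mathcal{F};C^\infty(\mathbb{R}^{2n}))$ (with $\Omega^0_{\mathcal{F}}=C^\infty(\mathbb{R}^{2n})$, $\Omega^{n+1}_{\mathcal{F}}=0$), with differential $\mathrm{d}_{\mathcal{F}}\alpha(Y_1,\dots,Y_{k+1})=\sum_i(-1)^{i+1}Y_i(\alpha(\dots,\hat Y_i,\dots))+\sum_{i<j}(-1)^{i+j}\alpha([Y_i,Y_j],\dots,\hat Y_i,\dots,\hat Y_j,\dots)$; $H^k_{\mathcal{F}}$ is the cohomology of this complex. $(\pounds_{X_i}\beta)(X_{j_1},\dots,X_{j_k})=X_i(\beta(X_{j_1},\dots,X_{j_k}))$. $\Sigma_i=\{x_i=y_i=0\}$. *)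

theory Defs
  imports "HOL-Analysis.Analysis"
begin

fun Ck :: "nat \<Rightarrow> ('a::euclidean_space \<Rightarrow> real) \<Rightarrow> bool" where
  "Ck 0 f = continuous_on UNIV f"
| "Ck (Suc m) f = ((\<forall>p. f differentiable (at p)) \<and>
                    (\<forall>v. Ck m (\<lambda>p. frechet_derivative f (at p) v)))"

definition smooth :: "('a::euclidean_space \<Rightarrow> real) \<Rightarrow> bool" where
  "smooth f \<longleftrightarrow> (\<forall>m. Ck m f)"

text \<open>A point of R^(2n) is a pair (x, y) with x, y :: real^'n; x_i = fst p $ i, y_i = snd p $ i.\<close>
type_synonym 'n pt = "(real^'n) \<times> (real^'n)"

definition vf_apply :: "('n::finite pt \<Rightarrow> 'n pt) \<Rightarrow> ('n pt \<Rightarrow> real) \<Rightarrow> 'n pt \<Rightarrow> real" where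
  "vf_apply V g = (\<lambda>p. frechet_derivative g (at p) (V p))"

text \<open>Lie bracket of vector fields: [V,W] g = V(W g) - W(V g), i.e. [V,W](p) = DW(p)(V p) - DV(p)(W p).\<close>
definition lie_bracket :: "('n::finite pt \<Rightarrow> 'n pt) \<Rightarrow> ('n pt \<Rightarrow> 'n pt) \<Rightarrow> 'n pt \<Rightarrow> 'n pt" where
  "lie_bracket V W = (\<lambda>p. frechet_derivative W (at p) (V p) - frechet_derivative V (at p) (W p))"

definition hfun :: "'n::finite \<Rightarrow> 'n pt \<Rightarrow> real" where
  "hfun i p = (fst p $ i)^2 + (snd p $ i)^2"

definition hvec :: "'n::finite pt \<Rightarrow> real^'n" where
  "hvec p = (\<chi> i. hfun i p)"

definition Xvf :: "'n::finite \<Rightarrow> 'n pt \<Rightarrow> 'n pt" where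
  "Xvf i = (\<lambda>p. ((2 * - (snd p $ i)) *\<^sub>R axis i 1, (2 * (fst p $ i)) *\<^sub>R axis i 1))"

definition Sigma_set :: "'n::finite \<Rightarrow> 'n pt set" where
  "Sigma_set i = {p. fst p $ i = 0 \<and> snd p $ i = 0}"

definition Fmod :: "('n::finite pt \<Rightarrow> 'n pt) set" where
  "Fmod = {V. \<exists>c::'n \<Rightarrow> 'n pt \<Rightarrow> real. (\<forall>i. smooth (c i)) \<and>
                 V = (\<lambda>p. \<Sum>i\<in>UNIV. c i p *\<^sub>R Xvf i p)}"

text \<open>A k-form is represented as a map from tuples (Y_0,...,Y_{k-1}) of vector fields
  (given as nat => vector field, only indices < k matter) to functions on R^(2n).
  Canonical representative: values depend only on the first k entries, and are 0 when
  some argument is not in F.\<close>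
type_synonym 'n form = "(nat \<Rightarrow> ('n pt \<Rightarrow> 'n pt)) \<Rightarrow> 'n pt \<Rightarrow> real"

definition trunc :: "nat \<Rightarrow> (nat \<Rightarrow> ('n::finite pt \<Rightarrow> 'n pt)) \<Rightarrow> nat \<Rightarrow> ('n pt \<Rightarrow> 'n pt)" where
  "trunc k Y = (\<lambda>i. if i < k then Y i else (\<lambda>p. 0))"

definition args_in_F :: "nat \<Rightarrow> (nat \<Rightarrow> ('n::finite pt \<Rightarrow> 'n pt)) \<Rightarrow> bool" where
  "args_in_F k Y \<longleftrightarrow> (\<forall>i<k. Y i \<in> Fmod)"

definition Omega :: "nat \<Rightarrow> ('n::finite) form set" where
  "Omega k = {\<alpha>.
     (\<forall>Y. \<alpha> Y = \<alpha> (trunc k Y)) \<and>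
     (\<forall>Y. \<not> args_in_F k Y \<longrightarrow> \<alpha> Y = (\<lambda>p. 0)) \<and>
     (\<forall>Y. args_in_F k Y \<longrightarrow> smooth (\<alpha> Y)) \<and>
     \<comment> \<open>C^oo-multilinearity in each slot\<close>
     (\<forall>Y i f g V W. args_in_F k Y \<and> i < k \<and> smooth f \<and> smooth g \<and> V \<in> Fmod \<and> W \<in> Fmod \<longrightarrow>
        \<alpha> (Y(i := (\<lambda>p. f p *\<^sub>R V p + g p *\<^sub>R W p))) =
        (\<lambda>p. f p * \<alpha> (Y(i := V)) p + g p * \<alpha> (Y(i := W)) p)) \<and>
     \<comment> \<open>alternating\<close>
     (\<forall>Y i j. args_in_F k Y \<and> i < k \<and> j < k \<and> i \<noteq> j \<and> Y i = Y j \<longrightarrow> \<alpha> Y = (\<lambda>p. 0))}"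

definition zero_form :: "('n::finite) form" where
  "zero_form = (\<lambda>Y p. 0)"

definition omit :: "nat \<Rightarrow> (nat \<Rightarrow> 'a) \<Rightarrow> nat \<Rightarrow> 'a" where
  "omit i Y = (\<lambda>j. if j < i then Y j else Y (Suc j))"

definition prepend :: "'a \<Rightarrow> (nat \<Rightarrow> 'a) \<Rightarrow> nat \<Rightarrow> 'a" where
  "prepend a Y = (\<lambda>j. case j of 0 \<Rightarrow> a | Suc m \<Rightarrow> Y m)"

text \<open>The foliated differential d_F : Omega^k -> Omega^(k+1) (0-based indices; the signs
  (-1)^(i+1), (-1)^(i+j) for 1-based indices become (-1)^i, (-1)^(i+j) for 0-based ones).
  By convention Omega^(n+1) = 0, so d_F = 0 on k-forms for k >= n.\<close>
definition dF :: "nat \<Rightarrow> ('n::finite) form \<Rightarrow> 'n form" where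
  "dF k \<alpha> = (\<lambda>Y. if k < CARD('n) \<and> args_in_F (Suc k) Y then
      (\<lambda>p. (\<Sum>i\<le>k. (-1)^i * vf_apply (Y i) (\<alpha> (omit i Y)) p)
         + (\<Sum>i\<le>k. \<Sum>j\<in>{i<..k}. (-1)^(i+j) *
              \<alpha> (prepend (lie_bracket (Y i) (Y j)) (omit i (omit j Y))) p))
    else (\<lambda>p. 0))"

definition form_add :: "('n::finite) form \<Rightarrow> 'n form \<Rightarrow> 'n form" where
  "form_add \<alpha> \<beta> = (\<lambda>Y p. \<alpha> Y p + \<beta> Y p)"

definition form_scale :: "real \<Rightarrow> ('n::finite) form \<Rightarrow> 'n form" where
  "form_scale c \<alpha> = (\<lambda>Y p. c * \<alpha> Y p)"

definition closed_forms :: "nat \<Rightarrow> ('n::finite) form set" where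
  "closed_forms k = {\<alpha> \<in> Omega k. dF k \<alpha> = zero_form}"

definition exact_forms :: "nat \<Rightarrow> ('n::finite) form set" where
  "exact_forms k = dF (k - 1) ` Omega (k - 1)"

text \<open>W^k: forms beta with Lie_{X_i} beta = 0 for all i, where
  (Lie_{X_i} beta)(X_{j_1},...,X_{j_k}) = X_i(beta(X_{j_1},...,X_{j_k})).\<close>
definition Wforms :: "nat \<Rightarrow> ('n::finite) form set" where
  "Wforms k = {\<beta> \<in> Omega k. \<forall>i (js::nat \<Rightarrow> 'n).
      vf_apply (Xvf i) (\<beta> (\<lambda>m. Xvf (js m))) = (\<lambda>p. 0)}"

definition summand :: "'n::finite set \<Rightarrow> ('n pt \<Rightarrow> real) set" where
  "summand J = {g. smooth g \<and> (\<exists>f :: real^'n \<Rightarrow> real. \<forall>p. g p = f (hvec p)) \<and>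
                   (\<forall>p \<in> (\<Union>j\<in>J. Sigma_set j). g p = 0)}"

definition direct_sum :: "nat \<Rightarrow> ('n::finite set \<Rightarrow> 'n pt \<Rightarrow> real) set" where
  "direct_sum k = {\<phi>. (\<forall>J. card J = k \<longrightarrow> \<phi> J \<in> summand J) \<and>
                       (\<forall>J. card J \<noteq> k \<longrightarrow> \<phi> J = (\<lambda>p. 0))}"

end

(*
  The module F is free on X_1, ..., X_n, because X_i vanishes only on the nowhere dense set
  Sigma_i.  By the tensoriality of the Cartan formula, forms are alternating families of smooth
  functions a(j_1, ..., j_k), and d_F becomes the differential delta of the commuting derivations
  X_1, ..., X_n of C^oo(R^(2n)).  The X_i generate circle actions.  Averaging A_i over the i-th
  circle satisfies id - A_i = K_i X_i, where K_i f(p) is the integral of t/(4 pi) f(R_t p) over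
  0 <= t <= 2 pi, and A_i and K_i commute with every X_j.  Cartan's identity
  delta iota_i + iota_i delta = X_i makes K_i iota_i a homotopy between id and A_i, so every closed
  family differs from its torus average by an exact one, while the average of an exact family is 0.
  Finally, multiplication by the product of the h_j, j in J, maps the invariant smooth functions
  bijectively onto those vanishing on all Sigma_j, j in J; surjectivity is a division argument.
*)
theory Submission
  imports Defs
begin

subsection \<open>Smooth functions\<close>

text \<open>By the Hom definition a form may take arbitrary smooth values on the frame: nothing
  forces its value on (X_j), j in J, to vanish on Sigma_j. The frame coefficients of W^k thus range
  over all invariant smooth functions, while the stated summands contain only those vanishing on the
  Sigma_j. Evaluation on the frame is therefore not the required isomorphism, and the factor given
  by the product of the h_j links the two spaces. The f in f(h_1, ..., h_n) carries no regularity,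
  so invariance is exploited through X_j g = 0 and not through f. X_i rotates its plane at speed 2.
  With R_t the rotation by the angle t, d/dt f(R_t p) is half of X_i f at R_t p; integrating t/(2
  pi) times this derivative by parts gives the weight t/(4 pi) of K_i. Smoothness means that f and
  all its iterated directional derivatives are differentiable. The operators A_i and K_i and the
  Hadamard quotients are all integrals of f along linear maps with t-dependent scalar coefficients,
  a class stable under differentiation in p, so one induction proves them all smooth.\<close>

definition dir_deriv :: "'a::euclidean_space \<Rightarrow> ('a \<Rightarrow> real) \<Rightarrow> 'a \<Rightarrow> real" where
  "dir_deriv v f = (\<lambda>p. frechet_derivative f (at p) v)"

lemma Ck_Suc_iff: "Ck (Suc m) f \<longleftrightarrow> (\<forall>p. f differentiable (at p)) \<and> (\<forall>v. Ck m (dir_deriv v f))"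
  by (simp add: dir_deriv_def)

lemma has_derivative_dir_deriv:
  assumes "f differentiable (at p)"
  shows "(f has_derivative (\<lambda>v. dir_deriv v f p)) (at p)"
  using assms frechet_derivative_works[of f "at p"] by (simp add: dir_deriv_def)

lemma dir_deriv_eqI: "(f has_derivative f') (at p) \<Longrightarrow> dir_deriv v f p = f' v"
  unfolding dir_deriv_def by (metis frechet_derivative_at)

lemma Ck_SucI:
  assumes "\<And>p. (f has_derivative (\<lambda>v. f' v p)) (at p)" and "\<And>v. Ck m (f' v)"
  shows "Ck (Suc m) f"
proof -
  have "dir_deriv v f = f' v" for v by (rule ext) (rule dir_deriv_eqI[OF assms(1)])
  then show ?thesis unfolding Ck_Suc_iff using assms by (auto simp: differentiable_def)
qed

lemma Ck_continuous: "Ck m f \<Longrightarrow> continuous_on UNIV f"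
proof (cases m)
  case (Suc l)
  assume "Ck m f"
  then have "\<forall>p. f differentiable (at p)" using Suc by simp
  then show ?thesis
    by (meson continuous_at_imp_continuous_on differentiable_imp_continuous_within)
qed simp

lemma Ck_SucD: "Ck (Suc m) f \<Longrightarrow> Ck m f"
proof (induction m arbitrary: f)
  case 0
  show ?case using Ck_continuous[OF 0] by simp
next
  case (Suc m)
  then show ?case unfolding Ck_Suc_iff[of "Suc m"] Ck_Suc_iff[of m] by blast
qed

lemma Ck_const: "Ck m (\<lambda>p. c)"
proof (induction m arbitrary: c)
  case (Suc m)
  show ?case by (rule Ck_SucI[where f' = "\<lambda>v p. 0"]) (auto intro: Suc)
qed simp

lemma Ck_bounded_linear:
  assumes "bounded_linear f"
  shows "Ck m f"
proof (cases m)
  case 0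
  then show ?thesis using assms by (simp add: linear_continuous_on)
next
  case (Suc l)
  show ?thesis unfolding Suc
    by (rule Ck_SucI[where f' = "\<lambda>v p. f v"])
      (auto intro: Ck_const bounded_linear_imp_has_derivative[OF assms])
qed

lemma Ck_add: "Ck m f \<Longrightarrow> Ck m g \<Longrightarrow> Ck m (\<lambda>p. f p + g p)"
proof (induction m arbitrary: f g)
  case 0
  then show ?case by (simp add: continuous_on_add)
next
  case (Suc m)
  show ?case
    by (rule Ck_SucI[where f' = "\<lambda>v p. dir_deriv v f p + dir_deriv v g p"])
      (use Suc in \<open>auto simp: Ck_Suc_iff simp del: Ck.simps intro!: has_derivative_add has_derivative_dir_deriv\<close>)
qed

lemma Ck_mult: "Ck m f \<Longrightarrow> Ck m g \<Longrightarrow> Ck m (\<lambda>p. f p * g p)"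
proof (induction m arbitrary: f g)
  case 0
  then show ?case by (simp add: continuous_on_mult)
next
  case (Suc m)
  \<comment> \<open>The product rule leaves undifferentiated factors, so the induction needs the
    factors themselves at level \<open>m\<close>.\<close>
  have "Ck m f" "Ck m g" using Suc.prems Ck_SucD by auto
  then show ?case
    by (intro Ck_SucI[where f' = "\<lambda>v p. f p * dir_deriv v g p + dir_deriv v f p * g p"] Ck_add Suc.IH
        has_derivative_mult has_derivative_dir_deriv)
      (use Suc.prems in \<open>auto simp: Ck_Suc_iff simp del: Ck.simps\<close>)
qed

lemma Ck_sum: "(\<And>i. i \<in> I \<Longrightarrow> Ck m (f i)) \<Longrightarrow> Ck m (\<lambda>p. \<Sum>i\<in>I. f i p)"
  by (induction I rule: infinite_finite_induct) (auto intro: Ck_const Ck_add)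

lemma smooth_const [simp]: "smooth (\<lambda>p. c)"
  by (simp add: smooth_def Ck_const)

lemma smooth_bounded_linear: "bounded_linear f \<Longrightarrow> smooth f"
  by (simp add: smooth_def Ck_bounded_linear)

lemma smooth_add [intro]: "smooth f \<Longrightarrow> smooth g \<Longrightarrow> smooth (\<lambda>p. f p + g p)"
  by (simp add: smooth_def Ck_add)

lemma smooth_mult [intro]: "smooth f \<Longrightarrow> smooth g \<Longrightarrow> smooth (\<lambda>p. f p * g p)"
  by (simp add: smooth_def Ck_mult)

lemma smooth_cmult: "smooth f \<Longrightarrow> smooth (\<lambda>p. c * f p)"
  by (rule smooth_mult[OF smooth_const])

lemma smooth_minus: "smooth f \<Longrightarrow> smooth (\<lambda>p. - f p)"
  using smooth_cmult[of f "-1"] by simp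

lemma smooth_diff [intro]: "smooth f \<Longrightarrow> smooth g \<Longrightarrow> smooth (\<lambda>p. f p - g p)"
  using smooth_add[OF _ smooth_minus, of f g] by simp

lemma smooth_sum: "(\<And>i. i \<in> I \<Longrightarrow> smooth (f i)) \<Longrightarrow> smooth (\<lambda>p. \<Sum>i\<in>I. f i p)"
  by (simp add: smooth_def Ck_sum)

lemma smooth_prod: "(\<And>i. i \<in> I \<Longrightarrow> smooth (f i)) \<Longrightarrow> smooth (\<lambda>p. \<Prod>i\<in>I. f i p)"
  by (induction I rule: infinite_finite_induct) auto

lemma smooth_dir_deriv: "smooth f \<Longrightarrow> smooth (dir_deriv v f)"
  unfolding smooth_def using Ck_Suc_iff by blast

lemma smooth_continuous: "smooth f \<Longrightarrow> continuous_on UNIV f"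
  unfolding smooth_def using Ck_continuous by blast

lemma smooth_differentiable: "smooth f \<Longrightarrow> f differentiable (at p)"
  unfolding smooth_def using Ck_Suc_iff by blast

lemma smooth_has_derivative: "smooth f \<Longrightarrow> (f has_derivative (\<lambda>v. dir_deriv v f p)) (at p)"
  by (rule has_derivative_dir_deriv[OF smooth_differentiable])

lemma linear_dir_deriv: "smooth f \<Longrightarrow> linear (\<lambda>v. dir_deriv v f p)"
  by (rule has_derivative_linear[OF smooth_has_derivative])

lemma dir_deriv_scaleR: "smooth f \<Longrightarrow> dir_deriv (c *\<^sub>R v) f p = c * dir_deriv v f p"
  using linear_cmul[OF linear_dir_deriv] by force

lemma dir_deriv_vec_sum: "smooth f \<Longrightarrow> dir_deriv (\<Sum>i\<in>I. v i) f p = (\<Sum>i\<in>I. dir_deriv (v i) f p)"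
  using linear_sum[OF linear_dir_deriv[of f p], of v I] by simp

lemma dir_deriv_add: "smooth f \<Longrightarrow> smooth g \<Longrightarrow> dir_deriv v (\<lambda>p. f p + g p) p = dir_deriv v f p + dir_deriv v g p"
  by (rule dir_deriv_eqI) (intro has_derivative_add smooth_has_derivative)

lemma dir_deriv_mult:
  "smooth f \<Longrightarrow> smooth g \<Longrightarrow> dir_deriv v (\<lambda>p. f p * g p) p = f p * dir_deriv v g p + dir_deriv v f p * g p"
  by (rule dir_deriv_eqI[of _ "\<lambda>v. f p * dir_deriv v g p + dir_deriv v f p * g p"])
    (intro has_derivative_mult smooth_has_derivative)

lemma dir_deriv_const: "dir_deriv v (\<lambda>p. c) p = 0"
  by (rule dir_deriv_eqI) (rule has_derivative_const)

lemma dir_deriv_bounded_linear: "bounded_linear f \<Longrightarrow> dir_deriv v f p = f v"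
  by (rule dir_deriv_eqI) (rule bounded_linear_imp_has_derivative)

section \<open>Symmetry of second derivatives\<close>

lemma smooth_DERIV_line:
  assumes "smooth f"
  shows "((\<lambda>t. f (p + t *\<^sub>R v)) has_field_derivative dir_deriv v f (p + t *\<^sub>R v)) (at t)"
proof -
  have "((\<lambda>t. f (p + t *\<^sub>R v)) has_derivative (\<lambda>s. dir_deriv (s *\<^sub>R v) f (p + t *\<^sub>R v))) (at t)"
    by (rule has_derivative_compose[of "\<lambda>t. p + t *\<^sub>R v" _ _ UNIV, OF _ smooth_has_derivative[OF assms]])
      (auto intro!: derivative_eq_intros)
  then show ?thesis
    by (simp add: has_field_derivative_def dir_deriv_scaleR[OF assms] mult_commute_abs)
qed

text \<open>The mean value theorem is applied along \<open>v\<close> to the difference in the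
  direction \<open>w\<close>, then along \<open>w\<close>. The left-hand side is symmetric in
  \<open>v\<close> and \<open>w\<close>, which will yield the symmetry of mixed derivatives.\<close>

lemma second_difference_mvt:
  assumes f: "smooth f" and s: "s > 0"
  shows "\<exists>t u. 0 < t \<and> t < s \<and> 0 < u \<and> u < s \<and>
    f (p + s *\<^sub>R v + s *\<^sub>R w) - f (p + s *\<^sub>R v) - f (p + s *\<^sub>R w) + f p
      = s^2 * dir_deriv w (dir_deriv v f) (p + t *\<^sub>R v + u *\<^sub>R w)"
proof -
  define \<phi> where "\<phi> t = f ((p + s *\<^sub>R w) + t *\<^sub>R v) - f (p + t *\<^sub>R v)" for t
  have "DERIV \<phi> t :> dir_deriv v f ((p + s *\<^sub>R w) + t *\<^sub>R v) - dir_deriv v f (p + t *\<^sub>R v)" for t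
    unfolding \<phi>_def by (intro DERIV_diff smooth_DERIV_line f)
  from MVT2[OF s this] obtain t where t: "0 < t" "t < s"
    "\<phi> s - \<phi> 0 = s * (dir_deriv v f ((p + s *\<^sub>R w) + t *\<^sub>R v) - dir_deriv v f (p + t *\<^sub>R v))"
    by auto
  have "DERIV (\<lambda>u. dir_deriv v f ((p + t *\<^sub>R v) + u *\<^sub>R w)) u :> dir_deriv w (dir_deriv v f) ((p + t *\<^sub>R v) + u *\<^sub>R w)" for u
    by (rule smooth_DERIV_line[OF smooth_dir_deriv[OF f]])
  from MVT2[OF s this] obtain u where u: "0 < u" "u < s"
    "dir_deriv v f ((p + t *\<^sub>R v) + s *\<^sub>R w) - dir_deriv v f (p + t *\<^sub>R v)
      = s * dir_deriv w (dir_deriv v f) (p + t *\<^sub>R v + u *\<^sub>R w)"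
    by auto
  have e: "p + s *\<^sub>R w + s *\<^sub>R v = p + s *\<^sub>R v + s *\<^sub>R w" "p + s *\<^sub>R w + t *\<^sub>R v = p + t *\<^sub>R v + s *\<^sub>R w"
    by (simp_all add: add_ac)
  have "\<phi> s - \<phi> 0 = s^2 * dir_deriv w (dir_deriv v f) (p + t *\<^sub>R v + u *\<^sub>R w)"
    using t(3) u(3) unfolding e by (simp add: power2_eq_square)
  moreover have "\<phi> s - \<phi> 0 = f (p + s *\<^sub>R v + s *\<^sub>R w) - f (p + s *\<^sub>R v) - f (p + s *\<^sub>R w) + f p"
    unfolding \<phi>_def e by simp
  ultimately show ?thesis using t u by metis
qed

text \<open>Both mixed derivatives, taken at points tending to \<open>p\<close>, equal the same
  second difference divided by the squared step; continuity gives the limit.\<close>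

lemma dir_deriv_commute:
  assumes f: "smooth f"
  shows "dir_deriv v (dir_deriv w f) p = dir_deriv w (dir_deriv v f) p"
proof -
  define s :: "nat \<Rightarrow> real" where "s n = 1 / Suc n" for n
  have s: "s n > 0" for n by (simp add: s_def)
  have s0: "s \<longlonglongrightarrow> 0" unfolding s_def using LIMSEQ_inverse_real_of_nat by (simp add: inverse_eq_divide)
  have lim: "\<exists>q. q \<longlonglongrightarrow> p \<and> (\<forall>n. f (p + s n *\<^sub>R v + s n *\<^sub>R w) - f (p + s n *\<^sub>R v) - f (p + s n *\<^sub>R w) + f p
      = (s n)^2 * dir_deriv w (dir_deriv v f) (q n))" for v w
  proof -
    from second_difference_mvt[OF f s] have
      "\<forall>n. \<exists>t u. 0 < t \<and> t < s n \<and> 0 < u \<and> u < s n \<and>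
        f (p + s n *\<^sub>R v + s n *\<^sub>R w) - f (p + s n *\<^sub>R v) - f (p + s n *\<^sub>R w) + f p
        = (s n)^2 * dir_deriv w (dir_deriv v f) (p + t *\<^sub>R v + u *\<^sub>R w)" by blast
    then obtain t u where tu: "\<And>n. 0 < t n \<and> t n < s n \<and> 0 < u n \<and> u n < s n \<and>
        f (p + s n *\<^sub>R v + s n *\<^sub>R w) - f (p + s n *\<^sub>R v) - f (p + s n *\<^sub>R w) + f p
        = (s n)^2 * dir_deriv w (dir_deriv v f) (p + t n *\<^sub>R v + u n *\<^sub>R w)" by metis
    have "t \<longlonglongrightarrow> 0" "u \<longlonglongrightarrow> 0"
      by (rule tendsto_sandwich[OF _ _ tendsto_const s0]; use tu in \<open>auto intro!: always_eventually less_imp_le\<close>)+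
    then have "(\<lambda>n. p + t n *\<^sub>R v + u n *\<^sub>R w) \<longlonglongrightarrow> p + 0 *\<^sub>R v + 0 *\<^sub>R w"
      by (intro tendsto_intros)
    then show ?thesis using tu by (intro exI[of _ "\<lambda>n. p + t n *\<^sub>R v + u n *\<^sub>R w"]) auto
  qed
  obtain q where q: "q \<longlonglongrightarrow> p" "\<And>n. f (p + s n *\<^sub>R v + s n *\<^sub>R w) - f (p + s n *\<^sub>R v) - f (p + s n *\<^sub>R w) + f p
      = (s n)^2 * dir_deriv w (dir_deriv v f) (q n)" using lim[of v w] by blast
  obtain r where r: "r \<longlonglongrightarrow> p" "\<And>n. f (p + s n *\<^sub>R w + s n *\<^sub>R v) - f (p + s n *\<^sub>R w) - f (p + s n *\<^sub>R v) + f p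
      = (s n)^2 * dir_deriv v (dir_deriv w f) (r n)" using lim[of w v] by blast
  have eq: "dir_deriv w (dir_deriv v f) (q n) = dir_deriv v (dir_deriv w f) (r n)" for n
  proof -
    have "(s n)\<^sup>2 * dir_deriv w (dir_deriv v f) (q n) = (s n)^2 * dir_deriv v (dir_deriv w f) (r n)"
      using q(2)[of n] r(2)[of n] by (simp add: algebra_simps)
    then show ?thesis using s[of n] by simp
  qed
  have "isCont (dir_deriv w (dir_deriv v f)) p" "isCont (dir_deriv v (dir_deriv w f)) p"
    using smooth_continuous[OF smooth_dir_deriv[OF smooth_dir_deriv[OF f]]]
    by (auto simp: continuous_on_eq_continuous_at)
  then have "(\<lambda>n. dir_deriv w (dir_deriv v f) (q n)) \<longlonglongrightarrow> dir_deriv w (dir_deriv v f) p"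
    "(\<lambda>n. dir_deriv v (dir_deriv w f) (r n)) \<longlonglongrightarrow> dir_deriv v (dir_deriv w f) p"
    using q(1) r(1) isCont_tendsto_compose by blast+
  then show ?thesis using LIMSEQ_unique unfolding eq by blast
qed

subsection \<open>Integrals over linear deformations\<close>

text \<open>The parameter \<open>t\<close> enters only through the scalars \<open>c q t\<close>; the
  linear maps \<open>T q\<close> are fixed. As the derivative is linear in its direction,
  differentiating in \<open>p\<close> yields a finite sum of integrals of the same shape, with
  weight \<open>w t * c q t\<close> and \<open>f\<close> replaced by its derivative along
  \<open>T q v\<close>. Rotations and partial scalings both have this form.\<close>

lemma
  fixes f :: "'a::euclidean_space \<Rightarrow> real" and T :: "'q \<Rightarrow> 'a \<Rightarrow> 'a"
    and w :: "real \<Rightarrow> real" and c :: "'q \<Rightarrow> real \<Rightarrow> real"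
  assumes w: "continuous_on {a..b} w" and Q: "finite Q"
    and T: "\<And>q. q \<in> Q \<Longrightarrow> bounded_linear (T q)" and c: "\<And>q. q \<in> Q \<Longrightarrow> continuous_on {a..b} (c q)"
    and f: "Ck (Suc 0) f"
  shows deformation_integral_has_derivative:
    "((\<lambda>p. integral {a..b} (\<lambda>t. w t * f (\<Sum>q\<in>Q. c q t *\<^sub>R T q p))) has_derivative
      (\<lambda>v. integral {a..b} (\<lambda>t. w t * dir_deriv (\<Sum>q\<in>Q. c q t *\<^sub>R T q v) f (\<Sum>q\<in>Q. c q t *\<^sub>R T q p)))) (at p)"
    (is ?D)
  and deformation_integral_derivative_sum:
    "integral {a..b} (\<lambda>t. w t * dir_deriv (\<Sum>q\<in>Q. c q t *\<^sub>R T q v) f (\<Sum>q\<in>Q. c q t *\<^sub>R T q p)) =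
      (\<Sum>q\<in>Q. integral {a..b} (\<lambda>t. (w t * c q t) * dir_deriv (T q v) f (\<Sum>q\<in>Q. c q t *\<^sub>R T q p)))"
    (is ?S)
proof -
  define L where "L t p = (\<Sum>q\<in>Q. c q t *\<^sub>R T q p)" for t p
  have blL: "bounded_linear (L t)" for t
    unfolding L_def by (intro bounded_linear_sum bounded_linear_scaleR_right[THEN bounded_linear_compose] T)
  have contL: "continuous_on (S \<times> {a..b}) (\<lambda>x. L (snd x) (fst x))" for S
    unfolding L_def
    by (intro continuous_on_sum continuous_on_scaleR)
      (auto intro!: continuous_on_compose2[OF c] continuous_on_compose2[OF linear_continuous_on[OF T, of _ UNIV]] continuous_intros)
  have diff: "f differentiable (at x)" for x using f by simp
  have lin: "linear (\<lambda>v. dir_deriv v f x)" for x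
    using has_derivative_linear[OF has_derivative_dir_deriv[OF diff]] .
  have bl: "bounded_linear (\<lambda>v. w t * dir_deriv (L t v) f x)" for t x
    using linear_compose[OF bounded_linear.linear[OF blL[of t]] lin[of x]]
    by (auto simp: o_def linear_conv_bounded_linear intro!: bounded_linear_mult_right[THEN bounded_linear_compose])
  have cf: "continuous_on UNIV f" using Ck_continuous[OF f] .
  have cd: "continuous_on UNIV (dir_deriv v f)" for v using f unfolding Ck_Suc_iff Ck.simps(1) by blast
  have expand: "w t * dir_deriv (L t v) f x = (\<Sum>q\<in>Q. (w t * c q t) * dir_deriv (T q v) f x)" for t v x
    unfolding L_def using linear_sum[OF lin[of x], of _ Q] linear_cmul[OF lin[of x]]
    by (simp add: sum_distrib_left mult_ac)
  have contw: "continuous_on (S \<times> {a..b}) (\<lambda>x. w (snd x))" for S :: "'a set"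
    by (rule continuous_on_compose2[OF w]) (auto intro!: continuous_intros)
  have contc: "continuous_on (S \<times> {a..b}) (\<lambda>x. c q (snd x))" if "q \<in> Q" for q and S :: "'a set"
    by (rule continuous_on_compose2[OF c[OF that]]) (auto intro!: continuous_intros)
  have inner: "continuous_on {a..b} (\<lambda>t. L t p)" for p
    unfolding L_def by (intro continuous_on_sum continuous_on_scaleR c continuous_on_const)
  \<comment> \<open>\<open>leibniz_rule\<close> takes the derivative of the integrand as a bounded
    linear map varying continuously with the parameters; continuity is then checked on basis
    vectors.\<close>
  define F where "F p t = Blinfun (\<lambda>v. w t * dir_deriv (L t v) f (L t p))" for p t
  have F: "blinfun_apply (F p t) v = w t * dir_deriv (L t v) f (L t p)" for p t v
    unfolding F_def by (simp add: bounded_linear_Blinfun_apply[OF bl])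
  have d: "((\<lambda>p. w t * f (L t p)) has_derivative blinfun_apply (F p t)) (at p within UNIV)" for p t
  proof -
    have "((\<lambda>p. f (L t p)) has_derivative (\<lambda>v. dir_deriv (L t v) f (L t p))) (at p)"
      by (rule has_derivative_compose[OF bounded_linear_imp_has_derivative[OF blL] has_derivative_dir_deriv[OF diff]])
    then have "((\<lambda>p. w t * f (L t p)) has_derivative (\<lambda>v. w t * dir_deriv (L t v) f (L t p))) (at p)"
      by (rule has_derivative_mult_right)
    moreover have "blinfun_apply (F p t) = (\<lambda>v. w t * dir_deriv (L t v) f (L t p))" using F by auto
    ultimately show ?thesis by simp
  qed
  have cF: "continuous_on (UNIV \<times> cbox a b) (\<lambda>(p, t). F p t)"
  proof (rule continuous_on_blinfun_componentwise)
    fix i :: 'a assume "i \<in> Basis"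
    have "continuous_on (UNIV \<times> {a..b}) (\<lambda>x. \<Sum>q\<in>Q. (w (snd x) * c q (snd x)) * dir_deriv (T q i) f (L (snd x) (fst x)))"
      by (intro continuous_on_sum continuous_on_mult contw contc continuous_on_compose2[OF cd contL]) auto
    then show "continuous_on (UNIV \<times> cbox a b) (\<lambda>x. blinfun_apply (case x of (p, t) \<Rightarrow> F p t) i)"
      by (simp add: split_beta F expand)
  qed
  have int1: "(\<lambda>t. w t * f (L t p)) integrable_on cbox a b" for p
    by (intro integrable_continuous continuous_on_mult) 
      (use w in \<open>auto intro!: continuous_on_compose2[OF cf inner]\<close>)
  have "continuous_on {a..b} (\<lambda>t. (p, t))" by (intro continuous_intros)
  from continuous_on_compose2[OF cF this] have intF: "F p integrable_on cbox a b"
    by (intro integrable_continuous) auto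
  have "((\<lambda>p. integral (cbox a b) (\<lambda>t. w t * f (L t p))) has_derivative integral (cbox a b) (F p)) (at p within UNIV)"
    by (rule leibniz_rule[OF d int1 cF]) auto
  moreover have "blinfun_apply (integral (cbox a b) (F p)) = (\<lambda>v. integral {a..b} (\<lambda>t. w t * dir_deriv (L t v) f (L t p)))"
    by (rule ext) (use blinfun_apply_integral[OF intF] F in simp)
  ultimately show ?D unfolding L_def[symmetric] by simp
  have "(\<lambda>t. (w t * c q t) * dir_deriv (T q v) f (L t p)) integrable_on {a..b}" if "q \<in> Q" for q
    by (intro integrable_continuous_real continuous_on_mult w c that continuous_on_compose2[OF cd inner]) auto
  then show ?S
    unfolding L_def[symmetric] expand by (intro integral_sum Q) auto
qed

text \<open>Weight and function are both generalised in the induction, since each differentiation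
  changes both.\<close>

lemma Ck_deformation_integral:
  fixes f :: "'a::euclidean_space \<Rightarrow> real" and T :: "'q \<Rightarrow> 'a \<Rightarrow> 'a"
    and w :: "real \<Rightarrow> real" and c :: "'q \<Rightarrow> real \<Rightarrow> real"
  assumes "continuous_on {a..b} w" and Q: "finite Q"
    and T: "\<And>q. q \<in> Q \<Longrightarrow> bounded_linear (T q)" and c: "\<And>q. q \<in> Q \<Longrightarrow> continuous_on {a..b} (c q)"
    and f: "smooth f"
  shows "Ck m (\<lambda>p. integral {a..b} (\<lambda>t. w t * f (\<Sum>q\<in>Q. c q t *\<^sub>R T q p)))"
  using assms(1) f
proof (induction m arbitrary: w f)
  case 0
  from 0(2) have "Ck (Suc 0) f" unfolding smooth_def by blast
  have "(\<lambda>p. integral {a..b} (\<lambda>t. w t * f (\<Sum>q\<in>Q. c q t *\<^sub>R T q p))) differentiable (at p)" for p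
    unfolding differentiable_def
    by (rule exI, rule deformation_integral_has_derivative[OF 0(1) Q _ _ \<open>Ck (Suc 0) f\<close>]) (auto intro: T c)
  then show ?case
    by (simp add: continuous_at_imp_continuous_on differentiable_imp_continuous_within)
next
  case (Suc m)
  from Suc(3) have f1: "Ck (Suc 0) f" unfolding smooth_def by blast
  have D: "((\<lambda>p. integral {a..b} (\<lambda>t. w t * f (\<Sum>q\<in>Q. c q t *\<^sub>R T q p))) has_derivative
      (\<lambda>v. \<Sum>q\<in>Q. integral {a..b} (\<lambda>t. (w t * c q t) * dir_deriv (T q v) f (\<Sum>q\<in>Q. c q t *\<^sub>R T q p)))) (at p)" for p
    using deformation_integral_has_derivative[OF Suc(2) Q T c f1, of "\<lambda>q. q" "\<lambda>q. q"]
    by (simp add: deformation_integral_derivative_sum[OF Suc(2) Q T c f1, of "\<lambda>q. q" "\<lambda>q. q", simplified])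
  show ?case
    by (rule Ck_SucI[OF D]) (use Suc in \<open>auto intro!: Ck_sum Suc.IH continuous_on_mult c smooth_dir_deriv\<close>)
qed

lemma smooth_deformation_integral:
  fixes f :: "'a::euclidean_space \<Rightarrow> real" and T :: "'q \<Rightarrow> 'a \<Rightarrow> 'a"
    and w :: "real \<Rightarrow> real" and c :: "'q \<Rightarrow> real \<Rightarrow> real"
  assumes "continuous_on {a..b} w" and Q: "finite Q"
    and T: "\<And>q. q \<in> Q \<Longrightarrow> bounded_linear (T q)" and c: "\<And>q. q \<in> Q \<Longrightarrow> continuous_on {a..b} (c q)"
    and f: "smooth f"
  shows "smooth (\<lambda>p. integral {a..b} (\<lambda>t. w t * f (\<Sum>q\<in>Q. c q t *\<^sub>R T q p)))"
  unfolding smooth_def by (intro allI Ck_deformation_integral assms)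

subsection \<open>Rotations in a single coordinate plane\<close>

definition ex :: "'n::finite \<Rightarrow> 'n pt" where "ex i = (axis i 1, 0)"
definition ey :: "'n::finite \<Rightarrow> 'n pt" where "ey i = (0, axis i 1)"

abbreviation cx :: "'n::finite \<Rightarrow> 'n pt \<Rightarrow> real" where "cx i p \<equiv> fst p $ i"
abbreviation cy :: "'n::finite \<Rightarrow> 'n pt \<Rightarrow> real" where "cy i p \<equiv> snd p $ i"

abbreviation lx :: "'n::finite \<Rightarrow> ('n pt \<Rightarrow> real) \<Rightarrow> 'n pt \<Rightarrow> real" where
  "lx i \<equiv> vf_apply (Xvf i)"

lemma coord_e [simp]:
  "cx i (ex j) = (if i = j then 1 else 0)" "cy i (ex j) = 0"
  "cx i (ey j) = 0" "cy i (ey j) = (if i = j then 1 else 0)"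
  by (auto simp: ex_def ey_def axis_def)

lemma pt_eqI: "(\<And>i. cx i p = cx i q) \<Longrightarrow> (\<And>i. cy i p = cy i q) \<Longrightarrow> p = q"
  by (simp add: prod_eq_iff vec_eq_iff)

lemma Xvf_e: "Xvf i p = (- 2 * cy i p) *\<^sub>R ex i + (2 * cx i p) *\<^sub>R ey i"
  by (simp add: Xvf_def ex_def ey_def)

lemma bounded_linear_cx: "bounded_linear (cx i)"
  by (rule bounded_linear_compose[OF bounded_linear_vec_nth bounded_linear_fst])

lemma bounded_linear_cy: "bounded_linear (cy i)"
  by (rule bounded_linear_compose[OF bounded_linear_vec_nth bounded_linear_snd])

lemmas smooth_cx [intro] = smooth_bounded_linear[OF bounded_linear_cx]
lemmas smooth_cy [intro] = smooth_bounded_linear[OF bounded_linear_cy]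

lemma bounded_linear_Xvf: "bounded_linear (Xvf i)"
  unfolding Xvf_e[abs_def]
  by (intro bounded_linear_add bounded_linear_scaleR_left[THEN bounded_linear_compose]
      bounded_linear_mult_right[THEN bounded_linear_compose] bounded_linear_cx bounded_linear_cy)

lemma Xvf_Xvf: "Xvf i (Xvf j p) = Xvf j (Xvf i p)"
  by (rule pt_eqI) (auto simp: Xvf_e)

lemma vf_apply_dir_deriv: "vf_apply V f p = dir_deriv (V p) f p"
  by (simp add: vf_apply_def dir_deriv_def)

lemma lx_eq:
  assumes "smooth f"
  shows "lx i f = (\<lambda>p. (- 2 * cy i p) * dir_deriv (ex i) f p + (2 * cx i p) * dir_deriv (ey i) f p)"
  unfolding vf_apply_dir_deriv Xvf_e linear_add[OF linear_dir_deriv[OF assms]] dir_deriv_scaleR[OF assms] ..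

lemma smooth_lx [intro]: "smooth f \<Longrightarrow> smooth (lx i f)"
  unfolding lx_eq by (intro smooth_add smooth_mult smooth_cmult smooth_cx smooth_cy smooth_dir_deriv)

lemma dir_deriv_lx:
  assumes f: "smooth f"
  shows "dir_deriv v (lx j f) p =
    (- 2 * cy j p) * dir_deriv v (dir_deriv (ex j) f) p + (- 2 * cy j v) * dir_deriv (ex j) f p +
    ((2 * cx j p) * dir_deriv v (dir_deriv (ey j) f) p + (2 * cx j v) * dir_deriv (ey j) f p)"
  unfolding lx_eq[OF f]
  by (simp only: dir_deriv_add dir_deriv_mult dir_deriv_const dir_deriv_bounded_linear[OF bounded_linear_cx] dir_deriv_bounded_linear[OF bounded_linear_cy]
      smooth_mult smooth_const smooth_cx smooth_cy smooth_dir_deriv f) simp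

text \<open>For different planes the coefficients of one field are constant along the other, so only
  second derivatives remain, and these are symmetric.\<close>

lemma lx_commute:
  assumes f: "smooth f"
  shows "lx i (lx j f) = lx j (lx i f)"
proof (cases "i = j")
  case False
  show ?thesis
  proof
    fix p
    show "lx i (lx j f) p = lx j (lx i f) p"
      unfolding lx_eq[OF smooth_lx[OF f]] dir_deriv_lx[OF f]
      using False by (simp add: dir_deriv_commute[OF f, of "ex j"] dir_deriv_commute[OF f, of "ey j"] algebra_simps)
  qed
qed simp

lemma vf_apply_add:
  "smooth f \<Longrightarrow> smooth g \<Longrightarrow> vf_apply V (\<lambda>p. f p + g p) = (\<lambda>p. vf_apply V f p + vf_apply V g p)"
  by (simp add: vf_apply_dir_deriv dir_deriv_add fun_eq_iff)

lemma vf_apply_mult: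
  "smooth f \<Longrightarrow> smooth g \<Longrightarrow> vf_apply V (\<lambda>p. f p * g p) = (\<lambda>p. f p * vf_apply V g p + vf_apply V f p * g p)"
  by (simp add: vf_apply_dir_deriv dir_deriv_mult fun_eq_iff)

lemma vf_apply_const [simp]: "vf_apply V (\<lambda>p. c) = (\<lambda>p. 0)"
  by (simp add: vf_apply_dir_deriv dir_deriv_const fun_eq_iff)

lemma vf_apply_cmult: "smooth f \<Longrightarrow> vf_apply V (\<lambda>p. c * f p) = (\<lambda>p. c * vf_apply V f p)"
  by (simp add: vf_apply_mult)

lemma vf_apply_minus: "smooth f \<Longrightarrow> vf_apply V (\<lambda>p. - f p) = (\<lambda>p. - vf_apply V f p)"
  using vf_apply_cmult[of f V "-1"] by simp

lemma vf_apply_sum: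
  "(\<And>i. i \<in> I \<Longrightarrow> smooth (f i)) \<Longrightarrow> vf_apply V (\<lambda>p. \<Sum>i\<in>I. f i p) = (\<lambda>p. \<Sum>i\<in>I. vf_apply V (f i) p)"
  by (induction I rule: infinite_finite_induct) (auto simp: vf_apply_add smooth_sum)

text \<open>Rotation by the angle \<open>t\<close> in the \<open>i\<close>-th plane, which is the
  flow of \<open>Xvf i\<close> at time t/2. It is written as \<open>p\<close> plus a displacement in
  the plane, so that differentiation in \<open>t\<close> only meets two scalar coefficients.\<close>

definition rot :: "'n::finite \<Rightarrow> real \<Rightarrow> 'n pt \<Rightarrow> 'n pt" where
  "rot i t p = p + ((cos t - 1) * cx i p - sin t * cy i p) *\<^sub>R ex i
                 + (sin t * cx i p + (cos t - 1) * cy i p) *\<^sub>R ey i"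

lemma rot_coord [simp]:
  "cx j (rot i t p) = (if j = i then cos t * cx i p - sin t * cy i p else cx j p)"
  "cy j (rot i t p) = (if j = i then sin t * cx i p + cos t * cy i p else cy j p)"
  by (auto simp: rot_def algebra_simps)

lemma rot_0 [simp]: "rot i 0 p = p" and rot_2pi [simp]: "rot i (2 * pi) p = p"
  by (auto intro!: pt_eqI)

text \<open>\<open>Xvf j\<close> is linear and commutes with every plane rotation, including that of
  its own plane; this is why the integral operators below commute with all
  \<open>lx j\<close>.\<close>

lemma rot_Xvf: "rot i t (Xvf j p) = Xvf j (rot i t p)"
  by (rule pt_eqI) (auto simp: Xvf_e algebra_simps)

lemma hfun_rot: "hfun j (rot i t p) = hfun j p"
proof (cases "j = i")
  case True
  have "(c * x - s * y)\<^sup>2 + (s * x + c * y)\<^sup>2 = (s\<^sup>2 + c\<^sup>2) * (x\<^sup>2 + y\<^sup>2)" for x y c s :: real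
    by (simp add: power2_eq_square algebra_simps)
  from this[of "cos t" _ "sin t"] have "(cos t * x - sin t * y)\<^sup>2 + (sin t * x + cos t * y)\<^sup>2 = x\<^sup>2 + y\<^sup>2" for x y
    by simp
  then show ?thesis using True by (simp add: hfun_def)
qed (simp add: hfun_def)

text \<open>The part of \<open>p\<close> outside the plane is fixed, the part in the plane is
  multiplied by the cosine, and its quarter turn \<open>(1/2) *\<^sub>R Xvf i p\<close> by the
  sine.\<close>

lemma rot_as_sum:
  "rot i t p = (\<Sum>q\<in>{0, 1, 2::nat}. (if q = 0 then 1 else if q = 1 then cos t else sin t) *\<^sub>R
     (if q = 0 then p - cx i p *\<^sub>R ex i - cy i p *\<^sub>R ey i
      else if q = 1 then cx i p *\<^sub>R ex i + cy i p *\<^sub>R ey i else (1/2) *\<^sub>R Xvf i p))"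
  by (rule pt_eqI) (auto simp: Xvf_e)

lemma
  fixes f :: "'n::finite pt \<Rightarrow> real" and w :: "real \<Rightarrow> real"
  assumes f: "smooth f" and w: "continuous_on {a..b} w"
  shows smooth_rot_integral: "smooth (\<lambda>p. integral {a..b} (\<lambda>t. w t * f (rot i t p)))"
    and lx_rot_integral: "lx j (\<lambda>p. integral {a..b} (\<lambda>t. w t * f (rot i t p))) p
      = integral {a..b} (\<lambda>t. w t * lx j f (rot i t p))"
proof -
  have 1: "bounded_linear (\<lambda>p. if q = (0::nat) then p - cx i p *\<^sub>R ex i - cy i p *\<^sub>R ey i
      else if q = 1 then cx i p *\<^sub>R ex i + cy i p *\<^sub>R ey i else (1/2) *\<^sub>R Xvf i p)" for q
  proof -
    have P: "bounded_linear (\<lambda>p. cx i p *\<^sub>R ex i)" "bounded_linear (\<lambda>p. cy i p *\<^sub>R ey i)"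
      by (rule bounded_linear_scaleR_left[THEN bounded_linear_compose], rule bounded_linear_cx bounded_linear_cy)+
    have "bounded_linear (\<lambda>p. (1/2) *\<^sub>R Xvf i p)"
      by (rule bounded_linear_scaleR_right[THEN bounded_linear_compose], rule bounded_linear_Xvf)
    moreover have "bounded_linear (\<lambda>p. p - cx i p *\<^sub>R ex i - cy i p *\<^sub>R ey i)"
      by (intro bounded_linear_sub bounded_linear_ident P)
    moreover have "bounded_linear (\<lambda>p. cx i p *\<^sub>R ex i + cy i p *\<^sub>R ey i)"
      by (intro bounded_linear_add P)
    ultimately show ?thesis by (cases "q = 0"; cases "q = 1") simp_all
  qed
  have 2: "continuous_on {a..b} (\<lambda>t. if q = (0::nat) then 1 else if q = 1 then cos t else sin t :: real)" for q
    by (cases "q = 0"; cases "q = 1") (auto intro!: continuous_intros)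
  have 3: "finite {0, 1, 2::nat}" by simp
  show "smooth (\<lambda>p. integral {a..b} (\<lambda>t. w t * f (rot i t p)))"
    unfolding rot_as_sum by (rule smooth_deformation_integral[OF w 3 1 2 f])
  have "Ck (Suc 0) f" using f unfolding smooth_def by blast
  from deformation_integral_has_derivative[OF w 3 1 2 this]
  have "((\<lambda>p. integral {a..b} (\<lambda>t. w t * f (rot i t p))) has_derivative
      (\<lambda>v. integral {a..b} (\<lambda>t. w t * dir_deriv (rot i t v) f (rot i t p)))) (at p)"
    unfolding rot_as_sum .
  \<comment> \<open>In the direction \<open>Xvf j p\<close> the inner derivative is along
    \<open>rot i t (Xvf j p)\<close>, which is \<open>Xvf j\<close> at the rotated point.\<close>
  from dir_deriv_eqI[OF this, of "Xvf j p"]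
  show "lx j (\<lambda>p. integral {a..b} (\<lambda>t. w t * f (rot i t p))) p
      = integral {a..b} (\<lambda>t. w t * lx j f (rot i t p))"
    unfolding vf_apply_dir_deriv rot_Xvf .
qed

lemma DERIV_rot:
  assumes "smooth f"
  shows "((\<lambda>t. f (rot i t p)) has_field_derivative lx i f (rot i t p) / 2) (at t)"
proof -
  have x: "((\<lambda>t. (cos t - 1) * cx i p - sin t * cy i p) has_field_derivative - sin t * cx i p - cos t * cy i p) (at t)"
    and y: "((\<lambda>t. sin t * cx i p + (cos t - 1) * cy i p) has_field_derivative cos t * cx i p - sin t * cy i p) (at t)"
    by (auto intro!: derivative_eq_intros)
  have "((\<lambda>t. rot i t p) has_derivative (\<lambda>s. 0 + ((- sin t * cx i p - cos t * cy i p) * s) *\<^sub>R ex i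
      + ((cos t * cx i p - sin t * cy i p) * s) *\<^sub>R ey i)) (at t)"
    unfolding rot_def
    by (intro has_derivative_add has_derivative_const has_derivative_scaleR_left
        x[unfolded has_field_derivative_def] y[unfolded has_field_derivative_def])
  moreover have "(\<lambda>s. 0 + ((- sin t * cx i p - cos t * cy i p) * s) *\<^sub>R ex i
      + ((cos t * cx i p - sin t * cy i p) * s) *\<^sub>R ey i) = (\<lambda>s. (s * (1/2)) *\<^sub>R Xvf i (rot i t p))"
    by (rule ext, rule pt_eqI) (simp_all add: Xvf_e algebra_simps)
  ultimately have 1: "((\<lambda>t. rot i t p) has_derivative (\<lambda>s. (s * (1/2)) *\<^sub>R Xvf i (rot i t p))) (at t)"
    by simp
  have "((\<lambda>t. f (rot i t p)) has_derivative (\<lambda>s. dir_deriv ((s * (1/2)) *\<^sub>R Xvf i (rot i t p)) f (rot i t p))) (at t)"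
    by (rule has_derivative_compose[OF 1 smooth_has_derivative[OF assms]])
  moreover have "(\<lambda>s. dir_deriv ((s * (1/2)) *\<^sub>R Xvf i (rot i t p)) f (rot i t p)) = (*) (lx i f (rot i t p) / 2)"
    by (simp add: fun_eq_iff dir_deriv_scaleR[OF assms] vf_apply_dir_deriv)
  ultimately show ?thesis by (simp add: has_field_derivative_def)
qed

lemma continuous_on_rot: "smooth f \<Longrightarrow> continuous_on S (\<lambda>t. f (rot i t p))"
  by (intro continuous_at_imp_continuous_on ballI DERIV_isCont[OF DERIV_rot])

section \<open>Circle averages and their homotopy operators\<close>

definition avg :: "'n::finite \<Rightarrow> ('n pt \<Rightarrow> real) \<Rightarrow> 'n pt \<Rightarrow> real" where
  "avg i f p = integral {0..2 * pi} (\<lambda>t. 1 / (2 * pi) * f (rot i t p))"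

definition homotopy_prim :: "'n::finite \<Rightarrow> ('n pt \<Rightarrow> real) \<Rightarrow> 'n pt \<Rightarrow> real" where
  "homotopy_prim i f p = integral {0..2 * pi} (\<lambda>t. t / (4 * pi) * f (rot i t p))"

lemma smooth_avg: "smooth f \<Longrightarrow> smooth (avg i f)"
  unfolding avg_def[abs_def] by (intro smooth_rot_integral continuous_intros)

lemma smooth_homotopy_prim: "smooth f \<Longrightarrow> smooth (homotopy_prim i f)"
  unfolding homotopy_prim_def[abs_def] by (rule smooth_rot_integral) (auto intro!: continuous_intros)

lemma lx_avg: "smooth f \<Longrightarrow> lx j (avg i f) = avg i (lx j f)"
  unfolding avg_def[abs_def] by (rule ext, rule lx_rot_integral) (auto intro!: continuous_intros)

lemma lx_homotopy_prim: "smooth f \<Longrightarrow> lx j (homotopy_prim i f) = homotopy_prim i (lx j f)"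
  unfolding homotopy_prim_def[abs_def] by (rule ext, rule lx_rot_integral) (auto intro!: continuous_intros)

lemma rot_integrable:
  fixes w :: "real \<Rightarrow> real"
  shows "smooth f \<Longrightarrow> continuous_on {a..b} w \<Longrightarrow> (\<lambda>t. w t * f (rot i t p)) integrable_on {a..b}"
  by (intro integrable_continuous_real continuous_on_mult continuous_on_rot)

lemma avg_add: "smooth f \<Longrightarrow> smooth g \<Longrightarrow> avg i (\<lambda>p. f p + g p) = (\<lambda>p. avg i f p + avg i g p)"
  unfolding avg_def[abs_def] distrib_left
  by (rule ext, rule integral_add; rule rot_integrable) (auto intro!: continuous_intros)

lemma avg_cmult: "avg i (\<lambda>p. c * f p) = (\<lambda>p. c * avg i f p)"
proof
  fix p
  have "(\<lambda>t. 1 / (2 * pi) * (c * f (rot i t p))) = (\<lambda>t. c * (1 / (2 * pi) * f (rot i t p)))"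
    by (rule ext) (rule mult.left_commute)
  then show "avg i (\<lambda>p. c * f p) p = c * avg i f p" unfolding avg_def by (simp only: integral_mult_right)
qed

lemma homotopy_prim_add: "smooth f \<Longrightarrow> smooth g \<Longrightarrow> homotopy_prim i (\<lambda>p. f p + g p) = (\<lambda>p. homotopy_prim i f p + homotopy_prim i g p)"
  unfolding homotopy_prim_def[abs_def] distrib_left
  by (rule ext, rule integral_add; rule rot_integrable) (auto intro!: continuous_intros)

lemma homotopy_prim_cmult: "homotopy_prim i (\<lambda>p. c * f p) = (\<lambda>p. c * homotopy_prim i f p)"
proof
  fix p
  have "(\<lambda>t. t / (4 * pi) * (c * f (rot i t p))) = (\<lambda>t. c * (t / (4 * pi) * f (rot i t p)))"
    by (rule ext) (rule mult.left_commute)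
  then show "homotopy_prim i (\<lambda>p. c * f p) p = c * homotopy_prim i f p" unfolding homotopy_prim_def by (simp only: integral_mult_right)
qed

text \<open>Up to a constant the integrand is the derivative of \<open>f\<close> along the closed
  orbit, so the endpoint values at 0 and 2 pi cancel.\<close>

lemma avg_lx:
  assumes "smooth f"
  shows "avg i (lx i f) = (\<lambda>p. 0)"
proof
  fix p
  have "((\<lambda>t. lx i f (rot i t p) / 2) has_integral (f (rot i (2 * pi) p) - f (rot i 0 p))) {0..2 * pi}"
    by (rule fundamental_theorem_of_calculus)
      (auto simp flip: has_real_derivative_iff_has_vector_derivative intro!: has_field_derivative_at_within DERIV_rot assms)
  then have "((\<lambda>t. lx i f (rot i t p) / 2) has_integral 0) {0..2 * pi}" by simp
  from has_integral_mult_right[OF this, of "1 / pi"]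
  have "((\<lambda>t. 1 / (2 * pi) * lx i f (rot i t p)) has_integral 0) {0..2 * pi}"
    by (simp add: mult.commute[of pi])
  then show "avg i (lx i f) p = 0" unfolding avg_def by (rule integral_unique)
qed

text \<open>Integration by parts over one period.\<close>
lemma homotopy_prim_lx:
  assumes "smooth f"
  shows "homotopy_prim i (lx i f) = (\<lambda>p. f p - avg i f p)"
proof
  fix p
  have d: "((\<lambda>t. t * f (rot i t p)) has_real_derivative f (rot i t p) + t * (lx i f (rot i t p) / 2)) (at t)" for t
    by (rule DERIV_cong[OF DERIV_mult[OF DERIV_ident DERIV_rot[OF assms]]]) simp
  have "((\<lambda>t. f (rot i t p) + t * (lx i f (rot i t p) / 2)) has_integral
      (2 * pi * f (rot i (2 * pi) p) - 0 * f (rot i 0 p))) {0..2 * pi}"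
    by (rule fundamental_theorem_of_calculus)
      (simp, rule has_field_derivative_at_within[OF d, unfolded has_real_derivative_iff_has_vector_derivative])
  from has_integral_mult_right[OF this, of "1 / (2 * pi)"]
  have "((\<lambda>t. 1 / (2 * pi) * (f (rot i t p) + t * (lx i f (rot i t p) / 2))) has_integral f p) {0..2 * pi}"
    by simp
  moreover have "1 / (2 * pi) * (f (rot i t p) + t * (lx i f (rot i t p) / 2)) =
      1 / (2 * pi) * f (rot i t p) + t / (4 * pi) * lx i f (rot i t p)" for t
    by (simp add: field_simps)
  ultimately have "((\<lambda>t. 1 / (2 * pi) * f (rot i t p) + t / (4 * pi) * lx i f (rot i t p)) has_integral f p) {0..2 * pi}"
    by simp
  then have "f p = integral {0..2 * pi} (\<lambda>t. 1 / (2 * pi) * f (rot i t p) + t / (4 * pi) * lx i f (rot i t p))"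
    by (simp add: integral_unique)
  also have "\<dots> = avg i f p + homotopy_prim i (lx i f) p"
    unfolding avg_def homotopy_prim_def
    by (rule integral_add; rule rot_integrable) (auto intro!: continuous_intros assms)
  finally show "homotopy_prim i (lx i f) p = f p - avg i f p" by simp
qed

lemma rot_invariant:
  assumes "smooth f" "lx i f = (\<lambda>p. 0)"
  shows "f (rot i t p) = f p"
  using DERIV_isconst_all[of "\<lambda>t. f (rot i t p)" t 0] DERIV_rot[OF assms(1), of i p] assms(2) by simp

lemma lx_of_rot_invariant:
  assumes "smooth f" "\<And>t p. f (rot i t p) = f p"
  shows "lx i f = (\<lambda>p. 0)"
proof
  fix p
  show "lx i f p = 0"
    using DERIV_unique[OF DERIV_rot[OF assms(1), of i p 0], of 0] assms(2) by simp
qed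

subsection \<open>Invariant functions vanishing on a coordinate subspace\<close>

text \<open>Continuity carries vanishing from the punctured line through \<open>p\<close> to
  \<open>p\<close> itself. With a suitable direction \<open>e\<close> the line leaves a coordinate
  subspace at once, so identities may be checked off that subspace.\<close>

lemma zero_by_density:
  fixes u :: "'a::real_normed_vector \<Rightarrow> real"
  assumes "continuous_on UNIV u" "\<And>t. t \<noteq> 0 \<Longrightarrow> u (p + t *\<^sub>R e) = 0"
  shows "u p = 0"
proof -
  have "(\<lambda>n. 1 / real (Suc n)) \<longlonglongrightarrow> 0"
    using LIMSEQ_inverse_real_of_nat by (simp add: inverse_eq_divide)
  then have "(\<lambda>n. p + (1 / real (Suc n)) *\<^sub>R e) \<longlonglongrightarrow> p + 0 *\<^sub>R e"
    by (intro tendsto_intros)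
  then have "(\<lambda>n. p + (1 / real (Suc n)) *\<^sub>R e) \<longlonglongrightarrow> p" by simp
  moreover have "isCont u p" using assms(1) by (simp add: continuous_on_eq_continuous_at)
  ultimately have "(\<lambda>n. u (p + (1 / real (Suc n)) *\<^sub>R e)) \<longlonglongrightarrow> u p"
    using isCont_tendsto_compose by blast
  moreover have "(\<lambda>n. u (p + (1 / real (Suc n)) *\<^sub>R e)) = (\<lambda>n. 0)"
    by (rule ext, rule assms(2)) simp
  ultimately show ?thesis using LIMSEQ_unique[OF tendsto_const, of 0 "u p"] by simp
qed

lemma hfun_eq_0_iff: "hfun i p = 0 \<longleftrightarrow> p \<in> Sigma_set i"
  by (simp add: hfun_def Sigma_set_def)

text \<open>h_i is not a zero divisor among continuous functions: where it vanishes, one steps off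
  \<open>Sigma_set i\<close> along \<open>ex i\<close>. Uniqueness of frame coefficients and
  injectivity of the final map on cohomology both rest on this.\<close>

lemma zero_of_hfun_mult_zero:
  assumes "continuous_on UNIV u" "\<And>p. hfun i p * u p = 0"
  shows "u p = 0"
proof (cases "hfun i p = 0")
  case True
  show ?thesis
  proof (rule zero_by_density[OF assms(1)])
    fix t :: real assume "t \<noteq> 0"
    moreover have "cx i p = 0" "cy i p = 0" using True by (auto simp: hfun_def)
    ultimately have "hfun i (p + t *\<^sub>R ex i) \<noteq> 0" by (simp add: hfun_def)
    then show "u (p + t *\<^sub>R ex i) = 0" using assms(2) by (metis mult_eq_0_iff)
  qed
qed (use assms(2)[of p] in simp)

lemma smooth_hfun: "smooth (hfun i)"
  unfolding hfun_def[abs_def] power2_eq_square by (intro smooth_add smooth_mult smooth_cx smooth_cy)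

lemma lx_hfun: "lx j (hfun i) = (\<lambda>p. 0)"
  by (rule lx_of_rot_invariant[OF smooth_hfun]) (rule hfun_rot)

text \<open>Since h_i is itself invariant, the product rule gives h_i X_j u = 0.\<close>

lemma lx_quotient_hfun:
  assumes u: "smooth u" and g: "lx j (\<lambda>p. hfun i p * u p) = (\<lambda>p. 0)"
  shows "lx j u = (\<lambda>p. 0)"
proof
  fix p
  show "lx j u p = 0"
  proof (rule zero_of_hfun_mult_zero[OF smooth_continuous[OF smooth_lx[OF u]]])
    fix p show "hfun i p * lx j u p = 0"
      using fun_cong[OF g, of p] by (simp add: vf_apply_mult[OF smooth_hfun u] lx_hfun)
  qed
qed

text \<open>For a projection \<open>P\<close> the integrand samples \<open>f\<close> on the segment
  from p - P p, where the \<open>P\<close> component is removed, to \<open>p\<close>. These are the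
  integrals that occur in Hadamard quotients.\<close>

lemma smooth_scaling_integral:
  assumes f: "smooth f" and w: "continuous_on {a..b} (w :: real \<Rightarrow> real)" and P: "bounded_linear P"
  shows "smooth (\<lambda>p. integral {a..b} (\<lambda>t. w t * f (p - P p + t *\<^sub>R P p)))"
proof -
  have sum: "p - P p + t *\<^sub>R P p = (\<Sum>q\<in>{False, True}. (if q then t else 1) *\<^sub>R (if q then P p else p - P p))" for t p
    by simp
  have 1: "bounded_linear (\<lambda>p. if q then P p else p - P p)" for q
    by (cases q) (simp_all add: P bounded_linear_sub bounded_linear_ident)
  have 2: "continuous_on {a..b} (\<lambda>t. if q then t else 1 :: real)" for q
    by (cases q) (simp_all)
  show ?thesis unfolding sum by (rule smooth_deformation_integral[OF w _ 1 2 f]) simp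
qed

lemma integral_dir_deriv_line:
  assumes f: "smooth f"
  shows "((\<lambda>t. dir_deriv v f (q + t *\<^sub>R v)) has_integral f (q + v) - f q) {0..1}"
proof -
  have "((\<lambda>t. dir_deriv v f (q + t *\<^sub>R v)) has_integral f (q + 1 *\<^sub>R v) - f (q + 0 *\<^sub>R v)) {0..1}"
    by (rule fundamental_theorem_of_calculus)
      (simp, rule has_field_derivative_at_within[OF smooth_DERIV_line[OF f], unfolded has_real_derivative_iff_has_vector_derivative])
  then show ?thesis by simp
qed

text \<open>Writing \<open>g\<^sub>x = x a\<close> (Hadamard), invariance \<open>x g\<^sub>y = y g\<^sub>x\<close> forces \<open>g\<^sub>y = y a\<close>,
  so that \<open>d/dt g(tz) = t h a(tz)\<close>, which is then integrated from the vanishing locus.\<close>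
lemma divisible_by_hfun:
  assumes g: "smooth g" and inv: "lx i g = (\<lambda>p. 0)" and van: "\<And>p. p \<in> Sigma_set i \<Longrightarrow> g p = 0"
  shows "\<exists>u. smooth u \<and> (\<forall>p. g p = hfun i p * u p)"
proof -
  let ?gx = "dir_deriv (ex i) g" and ?gy = "dir_deriv (ey i) g"
  \<comment> \<open>\<open>Q\<close> projects to the x_i axis and serves the Hadamard quotient of
    g_x; \<open>P\<close> projects to the whole plane and serves the radial integration from
    \<open>Sigma_set i\<close>.\<close>
  define Q where "Q p = cx i p *\<^sub>R ex i" for p :: "'a pt"
  define P where "P p = cx i p *\<^sub>R ex i + cy i p *\<^sub>R ey i" for p :: "'a pt"
  have Q: "bounded_linear Q" unfolding Q_def[abs_def]
    by (rule bounded_linear_scaleR_left[THEN bounded_linear_compose], rule bounded_linear_cx)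
  have P: "bounded_linear P" unfolding P_def[abs_def]
    by (rule bounded_linear_add; rule bounded_linear_scaleR_left[THEN bounded_linear_compose],
        rule bounded_linear_cx bounded_linear_cy)
  define a where "a p = integral {0..1} (\<lambda>t. 1 * dir_deriv (ex i) ?gx (p - Q p + t *\<^sub>R Q p))" for p
  have a: "smooth a" unfolding a_def[abs_def]
    by (rule smooth_scaling_integral[OF smooth_dir_deriv[OF smooth_dir_deriv[OF g]] _ Q]) (rule continuous_on_const)
  have sgx: "smooth ?gx" and sgy: "smooth ?gy" by (rule smooth_dir_deriv[OF g])+
  have rel: "cx i p * ?gy p = cy i p * ?gx p" for p
    using fun_cong[OF inv, of p] unfolding lx_eq[OF g] by simp
  \<comment> \<open>On x_i = 0 invariance reads y_i g_x = 0, so g_x vanishes where y_i is nonzero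
    and, by density along \<open>ey i\<close>, everywhere on x_i = 0.\<close>
  have gx0: "?gx p = 0" if x: "cx i p = 0" for p
  proof (rule zero_by_density[OF smooth_continuous[OF sgx]])
    fix t :: real assume t: "t \<noteq> 0"
    show "?gx (p + t *\<^sub>R ey i) = 0"
    proof (cases "cy i p + t = 0")
      case False
      then show ?thesis using rel[of "p + t *\<^sub>R ey i"] x by simp
    next
      case True
      \<comment> \<open>The shifted point may itself lie on y_i = 0; from there every further
        nonzero shift leaves that set.\<close>
      show ?thesis
      proof (rule zero_by_density[OF smooth_continuous[OF sgx]])
        fix s :: real assume "s \<noteq> 0"
        then show "?gx (p + t *\<^sub>R ey i + s *\<^sub>R ey i) = 0"
          using rel[of "p + t *\<^sub>R ey i + s *\<^sub>R ey i"] x True by simp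
      qed
    qed
  qed
  have gxa: "?gx p = cx i p * a p" for p
  proof -
    have "((\<lambda>t. dir_deriv (Q p) ?gx (p - Q p + t *\<^sub>R Q p)) has_integral ?gx (p - Q p + Q p) - ?gx (p - Q p)) {0..1}"
      by (rule integral_dir_deriv_line[OF sgx])
    moreover have "?gx (p - Q p) = 0" by (rule gx0) (simp add: Q_def)
    moreover have "dir_deriv (Q p) ?gx x = cx i p * (1 * dir_deriv (ex i) ?gx x)" for x
      by (simp add: Q_def dir_deriv_scaleR[OF sgx])
    ultimately have "((\<lambda>t. cx i p * (1 * dir_deriv (ex i) ?gx (p - Q p + t *\<^sub>R Q p))) has_integral ?gx p) {0..1}"
      by simp
    then have "?gx p = integral {0..1} (\<lambda>t. cx i p * (1 * dir_deriv (ex i) ?gx (p - Q p + t *\<^sub>R Q p)))"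
      by (rule integral_unique[symmetric])
    then show ?thesis unfolding a_def by (simp only: integral_mult_right)
  qed
  have gya: "?gy p = cy i p * a p" for p
  proof -
    have s: "smooth (\<lambda>p. ?gy p - cy i p * a p)" by (intro smooth_diff sgy smooth_mult smooth_cy a)
    have nz: "?gy q - cy i q * a q = 0" if "cx i q \<noteq> 0" for q
    proof -
      have "cx i q * (?gy q - cy i q * a q) = 0"
        using rel[of q] gxa[of q] by (simp add: right_diff_distrib)
      then show ?thesis using that by simp
    qed
    have "?gy p - cy i p * a p = 0"
    proof (cases "cx i p = 0")
      case True
      show ?thesis
        by (rule zero_by_density[OF smooth_continuous[OF s], where e = "ex i"], rule nz) (simp add: True)
    qed (rule nz)
    then show ?thesis by simp
  qed
  define u where "u p = integral {0..1} (\<lambda>t. t * a (p - P p + t *\<^sub>R P p))" for p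
  have "smooth u" unfolding u_def[abs_def]
    by (rule smooth_scaling_integral[OF a _ P]) (rule continuous_on_id)
  moreover have "g p = hfun i p * u p" for p
  proof -
    have "((\<lambda>t. dir_deriv (P p) g (p - P p + t *\<^sub>R P p)) has_integral g (p - P p + P p) - g (p - P p)) {0..1}"
      by (rule integral_dir_deriv_line[OF g])
    moreover have "g (p - P p) = 0" by (rule van) (simp add: P_def Sigma_set_def)
    moreover have "dir_deriv (P p) g (p - P p + t *\<^sub>R P p) = hfun i p * (t * a (p - P p + t *\<^sub>R P p))" for t
    proof -
      let ?q = "p - P p + t *\<^sub>R P p"
      have q: "cx i ?q = t * cx i p" "cy i ?q = t * cy i p" by (simp_all add: P_def)
      have "dir_deriv (P p) g ?q = cx i p * ?gx ?q + cy i p * ?gy ?q"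
        unfolding P_def linear_add[OF linear_dir_deriv[OF g]] dir_deriv_scaleR[OF g] ..
      also have "\<dots> = hfun i p * (t * a ?q)"
        unfolding gxa gya q hfun_def by (simp add: power2_eq_square algebra_simps)
      finally show ?thesis .
    qed
    ultimately have "((\<lambda>t. hfun i p * (t * a (p - P p + t *\<^sub>R P p))) has_integral g p) {0..1}"
      by simp
    then have "g p = integral {0..1} (\<lambda>t. hfun i p * (t * a (p - P p + t *\<^sub>R P p)))"
      by (rule integral_unique[symmetric])
    then show ?thesis unfolding u_def by (simp only: integral_mult_right)
  qed
  ultimately show ?thesis by blast
qed

text \<open>One factor h_j is divided out at a time. The quotient must still vanish on the other
  \<open>Sigma_set l\<close>: off \<open>Sigma_set j\<close> this is cancellation, and points of
  both sets are approached along \<open>ex j\<close>, a direction that stays inside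
  \<open>Sigma_set l\<close>.\<close>

lemma divisible_by_hfun_prod:
  assumes "finite J" "smooth g" "\<And>i. lx i g = (\<lambda>p. 0)" "\<And>j p. j \<in> J \<Longrightarrow> p \<in> Sigma_set j \<Longrightarrow> g p = 0"
  shows "\<exists>u. smooth u \<and> (\<forall>i. lx i u = (\<lambda>p. 0)) \<and> (\<forall>p. g p = (\<Prod>j\<in>J. hfun j p) * u p)"
  using assms
proof (induction J arbitrary: g)
  case empty
  then show ?case by auto
next
  case (insert j J)
  obtain u where u: "smooth u" "\<And>p. g p = hfun j p * u p"
    using divisible_by_hfun[of g j] insert.prems by blast
  have "g = (\<lambda>p. hfun j p * u p)" using u(2) by auto
  then have "lx i u = (\<lambda>p. 0)" for i
    using lx_quotient_hfun[OF u(1), of i j] insert.prems(2)[of i] by simp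
  moreover have "u p = 0" if l: "l \<in> J" "p \<in> Sigma_set l" for l p
  proof -
    have "l \<noteq> j" using l insert.hyps by auto
    have van: "hfun j q * u q = 0" if "q \<in> Sigma_set l" for q
      using insert.prems(3)[of l q] l that u(2) by simp
    show ?thesis
    proof (cases "hfun j p = 0")
      case True
      show ?thesis
      proof (rule zero_by_density[OF smooth_continuous[OF u(1)]])
        fix t :: real assume "t \<noteq> 0"
        moreover have "cx j p = 0" "cy j p = 0" using True by (auto simp: hfun_def)
        ultimately have "hfun j (p + t *\<^sub>R ex j) \<noteq> 0" by (simp add: hfun_def)
        moreover have "p + t *\<^sub>R ex j \<in> Sigma_set l" using l \<open>l \<noteq> j\<close> by (simp add: Sigma_set_def)
        ultimately show "u (p + t *\<^sub>R ex j) = 0" using van by (metis mult_eq_0_iff)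
      qed
    qed (use van[OF l(2)] in simp)
  qed
  ultimately obtain v where v: "smooth v" "\<And>i. lx i v = (\<lambda>p. 0)" "\<And>p. u p = (\<Prod>j\<in>J. hfun j p) * v p"
    using insert.IH[OF u(1)] by blast
  have "g p = (\<Prod>j\<in>insert j J. hfun j p) * v p" for p
    using insert.hyps by (simp add: u(2) v(3) mult.assoc)
  then show ?case using v by blast
qed

lemma zero_of_hfun_prod_mult_zero:
  assumes "finite J" "smooth u" "\<And>p. (\<Prod>j\<in>J. hfun j p) * u p = 0"
  shows "u p = 0"
  using assms
proof (induction J arbitrary: u p)
  case (insert j J)
  have s: "smooth (\<lambda>p. (\<Prod>j\<in>J. hfun j p) * u p)"
    by (intro smooth_mult smooth_prod smooth_hfun insert.prems)
  have "(\<Prod>j\<in>J. hfun j p) * u p = 0" for p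
    by (rule zero_of_hfun_mult_zero[OF smooth_continuous[OF s], of j])
      (use insert.prems(2) insert.hyps in \<open>simp add: mult.assoc\<close>)
  then show ?case by (rule insert.IH[OF insert.prems(1)])
qed simp

subsection \<open>Functions invariant under the torus\<close>

text \<open>Each plane is rotated separately until its point lies on the nonnegative x_i axis, which
  leaves \<open>u\<close> unchanged. With \<open>S\<close> everything, \<open>u\<close> is expressed
  by the h_i alone.\<close>

lemma torus_invariant_normal_form:
  fixes p :: "'n::finite pt"
  assumes u: "smooth u" "\<And>i. lx i u = (\<lambda>p. 0)" and "finite S"
  shows "u (\<chi> i. if i \<in> S then sqrt (hfun i p) else cx i p, \<chi> i. if i \<in> S then 0 else cy i p) = u p"
  using \<open>finite S\<close>
proof (induction S)
  case empty
  have "(\<chi> i. cx i p, \<chi> i. cy i p) = p" by (rule pt_eqI) simp_all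
  then show ?case by simp
next
  case (insert i S)
  let ?n = "\<lambda>S. (\<chi> i. if i \<in> S then sqrt (hfun i p) else cx i p, \<chi> i. if i \<in> S then 0 else cy i p) :: 'n pt"
  let ?r = "sqrt (hfun i p)"
  \<comment> \<open>\<open>t\<close> is the polar angle in the \<open>i\<close>-th plane; at the
    origin of the plane any angle will do.\<close>
  have "\<exists>t. cx i p = ?r * cos t \<and> cy i p = ?r * sin t"
  proof (cases "?r = 0")
    case True
    then show ?thesis by (auto simp: hfun_def)
  next
    case False
    have "(cx i p / ?r)\<^sup>2 + (cy i p / ?r)\<^sup>2 = hfun i p / ?r\<^sup>2"
      unfolding power_divide hfun_def add_divide_distrib ..
    also have "\<dots> = 1" using False by (simp add: hfun_def)
    finally obtain t where "cx i p / ?r = cos t" "cy i p / ?r = sin t"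
      using sincos_total_2pi by metis
    then show ?thesis using False by (intro exI[of _ t]) (auto simp: field_simps)
  qed
  then obtain t where t: "cx i p = ?r * cos t" "cy i p = ?r * sin t" by blast
  have "rot i t (?n (insert i S)) = ?n S"
    by (rule pt_eqI) (use insert.hyps t in \<open>auto simp: mult.commute\<close>)
  then have "u (?n (insert i S)) = u (?n S)"
    using rot_invariant[OF u(1) u(2), of i t "?n (insert i S)"] by simp
  then show ?case using insert.IH by simp
qed

lemma torus_invariant_iff:
  fixes u :: "'n::finite pt \<Rightarrow> real"
  assumes "smooth u"
  shows "(\<exists>f. \<forall>p. u p = f (hvec p)) \<longleftrightarrow> (\<forall>i. lx i u = (\<lambda>p. 0))"
proof
  assume "\<exists>f. \<forall>p. u p = f (hvec p)"
  then obtain f where f: "\<And>p. u p = f (hvec p)" by blast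
  have "hvec (rot i t p) = hvec p" for i t and p :: "'n pt" by (simp add: hvec_def hfun_rot)
  then have "u (rot i t p) = u p" for i t p by (simp add: f)
  then show "\<forall>i. lx i u = (\<lambda>p. 0)" by (intro allI lx_of_rot_invariant[OF assms])
next
  assume "\<forall>i. lx i u = (\<lambda>p. 0)"
  then have "u p = u (\<chi> i. sqrt (hvec p $ i), \<chi> i. 0)" for p
    using torus_invariant_normal_form[OF assms, of UNIV p] by (simp add: hvec_def)
  then show "\<exists>f. \<forall>p. u p = f (hvec p)"
    \<comment> \<open>The profile function may be arbitrary, so it is read off at the point of the
      x-axes whose coordinates are the square roots of the \<open>v $ i\<close>.\<close>
    by (intro exI[of _ "\<lambda>v. u (\<chi> i. sqrt (v $ i), \<chi> i. 0)"] allI)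
qed

subsection \<open>Alternating functions of tuples\<close>

definition swap_adj :: "nat \<Rightarrow> (nat \<Rightarrow> 'a) \<Rightarrow> nat \<Rightarrow> 'a" where
  "swap_adj m z = z(m := z (Suc m), Suc m := z m)"

definition depends_below :: "nat \<Rightarrow> ((nat \<Rightarrow> 'a) \<Rightarrow> 'b) \<Rightarrow> bool" where
  "depends_below k f \<longleftrightarrow> (\<forall>z z'. (\<forall>m<k. z m = z' m) \<longrightarrow> f z = f z')"

text \<open>Adjacent transpositions generate all permutations, so antisymmetry under them suffices,
  and no permutation signs have to be handled.\<close>

definition antisym_swap :: "nat \<Rightarrow> ((nat \<Rightarrow> 'a) \<Rightarrow> real) \<Rightarrow> bool" where
  "antisym_swap k f \<longleftrightarrow> (\<forall>z m. Suc m < k \<longrightarrow> f (swap_adj m z) = - f z)"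

lemma omit_0_prepend [simp]: "omit 0 (prepend a z) = z"
  by (simp add: omit_def prepend_def)

lemma prepend_0 [simp]: "prepend a z 0 = a" and prepend_Suc [simp]: "prepend a z (Suc m) = z m"
  by (simp_all add: prepend_def)

lemma omit_0: "omit 0 z m = z (Suc m)"
  by (simp add: omit_def)

lemma omit_Suc_prepend: "omit (Suc m) (prepend a z) = prepend a (omit m z)"
  by (auto simp: omit_def prepend_def fun_eq_iff split: nat.splits)

lemma prepend_omit_0 [simp]: "prepend (z 0) (omit 0 z) = z"
  by (auto simp: omit_def prepend_def fun_eq_iff split: nat.splits)

lemma fun_upd_0_eq_prepend: "z(0 := a) = prepend a (omit 0 z)"
  by (auto simp: omit_def prepend_def fun_eq_iff split: nat.splits)

lemma prepend_upd: "(prepend a z)(Suc i := b) = prepend a (z(i := b))"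
  by (auto simp: prepend_def fun_eq_iff split: nat.splits)

lemma omit_upd_eq: "omit i (z(i := b)) = omit i z"
  by (auto simp: omit_def fun_eq_iff)

lemma omit_upd_less: "l < i \<Longrightarrow> omit i (z(l := b)) = (omit i z)(l := b)"
  by (auto simp: omit_def fun_eq_iff)

lemma omit_upd_greater: "i < l \<Longrightarrow> omit i (z(l := b)) = (omit i z)(l - 1 := b)"
  by (auto simp: omit_def fun_eq_iff)

lemma omit_omit: "i < j \<Longrightarrow> omit i (omit j z) = omit (j - 1) (omit i z)"
  by (auto simp: omit_def fun_eq_iff)

lemma swap_adj_prepend: "swap_adj (Suc m) (prepend a z) = prepend a (swap_adj m z)"
  by (simp add: swap_adj_def prepend_upd)

lemma swap_adj_0_prepend: "swap_adj 0 (prepend a (prepend b z)) = prepend b (prepend a z)"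
  by (auto simp: swap_adj_def prepend_def fun_eq_iff split: nat.splits)

lemma omit_swap_adj:
  "omit m (swap_adj m z) = omit (Suc m) z" "omit (Suc m) (swap_adj m z) = omit m z"
  "l < m \<Longrightarrow> omit l (swap_adj m z) = swap_adj (m - 1) (omit l z)"
  "Suc m < l \<Longrightarrow> omit l (swap_adj m z) = swap_adj m (omit l z)"
  by (auto simp: omit_def swap_adj_def fun_eq_iff less_Suc_eq)

lemma localD: "depends_below k f \<Longrightarrow> (\<And>m. m < k \<Longrightarrow> z m = z' m) \<Longrightarrow> f z = f z'"
  unfolding depends_below_def by blast

lemma depends_below_prepend: "depends_below (Suc k) f \<Longrightarrow> depends_below k (\<lambda>z. f (prepend a z))"
  unfolding depends_below_def by (auto simp: prepend_def split: nat.splits)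

lemma antisym_swap_prepend: "antisym_swap (Suc k) f \<Longrightarrow> antisym_swap k (\<lambda>z. f (prepend a z))"
  unfolding antisym_swap_def
proof (intro allI impI)
  fix z m assume f: "\<forall>z m. Suc m < Suc k \<longrightarrow> f (swap_adj m z) = - f z" and m: "Suc m < k"
  from f m have "f (swap_adj (Suc m) (prepend a z)) = - f (prepend a z)" by blast
  then show "f (prepend a (swap_adj m z)) = - f (prepend a z)" by (simp only: swap_adj_prepend)
qed

lemma antisym_swap_move_front:
  assumes "antisym_swap k f" "m < k"
  shows "f (prepend (z m) (omit m z)) = (-1)^m * f z"
  using assms(2)
proof (induction m arbitrary: z)
  case (Suc m)
  have "f (prepend (swap_adj m z m) (omit m (swap_adj m z))) = (-1)^m * f (swap_adj m z)"
    using Suc by simp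
  moreover have "f (swap_adj m z) = - f z" using assms(1) Suc.prems unfolding antisym_swap_def by blast
  ultimately show ?case by (simp add: omit_swap_adj) (simp add: swap_adj_def)
qed simp

text \<open>Two moves to the front bring the equal entries into slots 0 and 1, where a transposition
  fixes the tuple and negates the value. Moving entry \<open>i\<close> first leaves entry
  \<open>j\<close> in place because i < j.\<close>

lemma antisym_swap_eq_0:
  assumes f: "antisym_swap k f" and z: "z i = z j" "i < j" "j < k"
  shows "f z = 0"
proof -
  define w where "w = prepend (z i) (omit i z)"
  define v where "v = prepend (w j) (omit j w)"
  have w: "w 0 = z i" "w j = z j" using z by (cases j; simp add: w_def omit_def)+
  have "v 0 = z j" "v (Suc 0) = z i" using w z by (simp_all add: v_def omit_def)
  then have "swap_adj 0 v = v" using z by (auto simp: swap_adj_def)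
  moreover have "Suc 0 < k" using z by simp
  ultimately have "f v = - f v" using f unfolding antisym_swap_def by metis
  then have "f v = 0" by simp
  moreover have "f v = (-1)^j * f w" unfolding v_def by (rule antisym_swap_move_front[OF f z(3)])
  moreover have "f w = (-1)^i * f z" unfolding w_def by (rule antisym_swap_move_front[OF f]) (use z in simp)
  ultimately show ?thesis by simp
qed

text \<open>A transposition at \<open>m\<close> exchanges the summands of index \<open>m\<close> and
  \<open>m + 1\<close>, whose alternating signs differ; every other summand changes sign because
  \<open>F\<close> is antisymmetric. This serves both the differential and the dual
  cochains.\<close>

lemma antisym_swap_alternating_sum:
  fixes F :: "'a \<Rightarrow> (nat \<Rightarrow> 'a) \<Rightarrow> real"
  assumes F: "\<And>x. antisym_swap k (F x)"
  shows "antisym_swap (Suc k) (\<lambda>z. \<Sum>l\<le>k. (-1)^l * F (z l) (omit l z))"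
  unfolding antisym_swap_def
proof (intro allI impI)
  fix z :: "nat \<Rightarrow> 'a" and m
  assume m: "Suc m < Suc k"
  define \<tau> where "\<tau> l = (if l = m then Suc m else if l = Suc m then m else l)" for l
  define t where "t l = (-1)^l * F (z l) (omit l z)" for l
  have neg: "F x (swap_adj j y) = - F x y" if "Suc j < k" for x j y using F that unfolding antisym_swap_def by blast
  have "(-1)^l * F (swap_adj m z l) (omit l (swap_adj m z)) = - t (\<tau> l)" if "l \<le> k" for l
  proof -
    consider "l = m" | "l = Suc m" | "l < m" | "Suc m < l" by linarith
    then show ?thesis
    proof cases
      case 3
      then have "omit l (swap_adj m z) = swap_adj (m - 1) (omit l z)" "Suc (m - 1) < k"
        using m by (auto simp: omit_swap_adj(3))
      with 3 show ?thesis by (simp add: t_def \<tau>_def swap_adj_def[of m z] neg)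
    next
      case 4
      with that show ?thesis by (simp add: t_def \<tau>_def omit_swap_adj(4) neg) (simp add: swap_adj_def)
    qed (simp_all add: t_def \<tau>_def omit_swap_adj, simp_all add: swap_adj_def)
  qed
  then have "(\<Sum>l\<le>k. (-1)^l * F (swap_adj m z l) (omit l (swap_adj m z))) = (\<Sum>l\<le>k. - t (\<tau> l))"
    by (intro sum.cong) auto
  also have "\<dots> = (\<Sum>l\<le>k. - t l)"
    by (rule sum.reindex_bij_witness[where i = \<tau> and j = \<tau>]) (use m in \<open>auto simp: \<tau>_def\<close>)
  finally show "(\<Sum>l\<le>k. (-1)^l * F (swap_adj m z l) (omit l (swap_adj m z))) = - (\<Sum>l\<le>k. (-1)^l * F (z l) (omit l z))"
    by (simp add: t_def sum_negf)
qed

lemma image_omit: "inj_on z {..k} \<Longrightarrow> m \<le> k \<Longrightarrow> omit m z ` {..<k} = z ` {..k} - {z m}"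
proof (intro equalityI subsetI)
  fix x assume z: "inj_on z {..k}" "m \<le> k" and x: "x \<in> z ` {..k} - {z m}"
  then obtain j where j: "j \<le> k" "x = z j" "j \<noteq> m" by auto
  show "x \<in> omit m z ` {..<k}"
  proof (cases "j < m")
    case True
    then show ?thesis using z j by (intro image_eqI[of _ _ j]) (auto simp: omit_def)
  next
    case False
    then show ?thesis using z j by (intro image_eqI[of _ _ "j - 1"]) (auto simp: omit_def)
  qed
qed (auto simp: omit_def inj_on_def split: if_splits; fail)

lemma inj_on_omit: "inj_on z {..k} \<Longrightarrow> m \<le> k \<Longrightarrow> inj_on (omit m z) {..<k}"
proof (rule inj_onI)
  fix x y assume z: "inj_on z {..k}" "m \<le> k" and xy: "x \<in> {..<k}" "y \<in> {..<k}" "omit m z x = omit m z y"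
  have "(if x < m then x else Suc x) = (if y < m then y else Suc y)"
    by (rule inj_onD[OF z(1)]) (use z xy in \<open>auto simp: omit_def split: if_splits\<close>)
  then show "x = y" by (auto split: if_splits)
qed

text \<open>Injective tuples with the same entries differ by a permutation, hence their values
  differ at most by a sign. The induction brings the entry of \<open>e\<close> equal to
  \<open>z 0\<close> to the front and compares the remaining tuples.\<close>

lemma antisym_swap_eq_0_of_same_image:
  assumes "depends_below k f" "antisym_swap k f" "inj_on e {..<k}" "inj_on z {..<k}" "e ` {..<k} = z ` {..<k}" "f e = 0"
  shows "f z = 0"
  using assms
proof (induction k arbitrary: f e z)
  case 0
  then show ?case using localD[OF 0(1), of z e] by simp
next
  case (Suc k)
  have le: "{..<Suc k} = {..k}" by auto
  have "z 0 \<in> e ` {..<Suc k}" using Suc.prems(5) by auto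
  then obtain m where "m < Suc k" and e: "z 0 = e m" by (elim imageE) simp
  then have m: "m \<le> k" "z 0 = e m" by simp_all
  have "f (prepend (z 0) (omit 0 z)) = 0"
  proof (rule Suc.IH[of "\<lambda>y. f (prepend (z 0) y)" "omit m e" "omit 0 z"])
    show "omit m e ` {..<k} = omit 0 z ` {..<k}"
      using image_omit[of e k m] image_omit[of z k 0] Suc.prems(3,4,5) m unfolding le by simp
    show "f (prepend (z 0) (omit m e)) = 0"
      unfolding m(2) using antisym_swap_move_front[OF Suc.prems(2), of m e] m Suc.prems(6) by simp
  qed (use Suc.prems m in \<open>auto simp: le intro: depends_below_prepend antisym_swap_prepend inj_on_omit\<close>)
  then show ?case by simp
qed

text \<open>The determinant of the matrix of Kronecker deltas between \<open>e\<close> and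
  \<open>z\<close>, expanded along the row of \<open>e 0\<close>; equivalently, the wedge product of
  the covectors dual to \<open>e\<close>, evaluated on \<open>z\<close>.\<close>

primrec dual_cochain :: "nat \<Rightarrow> (nat \<Rightarrow> 'a) \<Rightarrow> (nat \<Rightarrow> 'a) \<Rightarrow> real" where
  "dual_cochain 0 e z = 1"
| "dual_cochain (Suc k) e z = (\<Sum>l\<le>k. (-1)^l * (if z l = e 0 then dual_cochain k (omit 0 e) (omit l z) else 0))"

lemma depends_below_dual_cochain: "depends_below k (dual_cochain k e)"
proof (induction k arbitrary: e)
  case (Suc k)
  show ?case unfolding depends_below_def
  proof (intro allI impI)
    fix z z' :: "nat \<Rightarrow> 'a" assume z: "\<forall>m<Suc k. z m = z' m"
    have "dual_cochain k (omit 0 e) (omit l z) = dual_cochain k (omit 0 e) (omit l z')" if "l \<le> k" for l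
      by (rule localD[OF Suc]) (use z that in \<open>auto simp: omit_def\<close>)
    then show "dual_cochain (Suc k) e z = dual_cochain (Suc k) e z'"
      using z by (auto intro!: sum.cong)
  qed
qed (simp add: depends_below_def)

lemma antisym_swap_dual_cochain: "antisym_swap k (dual_cochain k e)"
proof (induction k arbitrary: e)
  case (Suc k)
  have "antisym_swap k (\<lambda>z. if x = e 0 then dual_cochain k (omit 0 e) z else 0)" for x
    using Suc[of "omit 0 e"] by (auto simp: antisym_swap_def)
  from antisym_swap_alternating_sum[of k "\<lambda>x z. if x = e 0 then dual_cochain k (omit 0 e) z else 0", OF this]
  show ?case by (simp add: antisym_swap_def)
qed (simp add: antisym_swap_def)

lemma dual_cochain_self: "inj_on e {..<k} \<Longrightarrow> dual_cochain k e e = 1"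
proof (induction k arbitrary: e)
  case (Suc k)
  have le: "{..<Suc k} = {..k}" by auto
  have "(-1)^l * (if e l = e 0 then dual_cochain k (omit 0 e) (omit l e) else 0) = (if l = 0 then 1 else 0)" if "l \<le> k" for l
    using Suc.IH[OF inj_on_omit[of e k 0]] Suc.prems that unfolding le by (auto simp: inj_on_def)
  then have "dual_cochain (Suc k) e e = (\<Sum>l\<le>k. if l = 0 then 1 else 0)" by simp
  then show ?case by simp
qed simp

lemma dual_cochain_nonzero_image: "dual_cochain k e z \<noteq> 0 \<Longrightarrow> e ` {..<k} \<subseteq> z ` {..<k}"
proof (induction k arbitrary: e z)
  case (Suc k)
  then obtain l where l: "l \<le> k" "z l = e 0" "dual_cochain k (omit 0 e) (omit l z) \<noteq> 0"
    by (auto elim!: sum.not_neutral_contains_not_neutral split: if_splits)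
  from Suc.IH[OF l(3)] have sub: "omit 0 e ` {..<k} \<subseteq> omit l z ` {..<k}" .
  have "omit l z ` {..<k} \<subseteq> z ` {..<Suc k}" by (auto simp: omit_def)
  moreover have "e ` {..<Suc k} = insert (e 0) (omit 0 e ` {..<k})"
    by (simp add: lessThan_Suc_eq_insert_0 image_image omit_0)
  moreover have "e 0 \<in> z ` {..<Suc k}" using l by (intro image_eqI[of _ _ l]) auto
  ultimately show ?case using sub by auto
qed simp

subsection \<open>Coefficients with respect to the frame\<close>

definition frame :: "('n::finite \<Rightarrow> 'n pt \<Rightarrow> real) \<Rightarrow> 'n pt \<Rightarrow> 'n pt" where
  "frame c = (\<lambda>p. \<Sum>i\<in>UNIV. c i p *\<^sub>R Xvf i p)"

text \<open>The choice is unique on \<open>Fmod\<close> by \<open>frame_inj\<close>, so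
  \<open>coef\<close> is linear over smooth functions there.\<close>

definition coef :: "('n::finite pt \<Rightarrow> 'n pt) \<Rightarrow> 'n \<Rightarrow> 'n pt \<Rightarrow> real" where
  "coef V = (SOME c. (\<forall>i. smooth (c i)) \<and> V = frame c)"

lemma Fmod_frame: "V \<in> Fmod \<longleftrightarrow> (\<exists>c. (\<forall>i. smooth (c i)) \<and> V = frame c)"
  by (simp add: Fmod_def frame_def)

lemma frame_in_Fmod: "(\<And>i. smooth (c i)) \<Longrightarrow> frame c \<in> Fmod"
  unfolding Fmod_frame by blast

lemma smooth_coef: "V \<in> Fmod \<Longrightarrow> smooth (coef V i)"
  and frame_coef: "V \<in> Fmod \<Longrightarrow> frame (coef V) = V"
proof -
  assume "V \<in> Fmod"
  then have "\<exists>c. (\<forall>i. smooth (c i)) \<and> V = frame c" unfolding Fmod_frame .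
  from someI_ex[OF this] show "smooth (coef V i)" "frame (coef V) = V"
    unfolding coef_def by auto
qed

lemma coord_frame:
  "cx i (frame c p) = - 2 * cy i p * c i p" "cy i (frame c p) = 2 * cx i p * c i p"
proof -
  have "cx i (frame c p) = (\<Sum>j\<in>UNIV. c j p * cx i (Xvf j p))"
    "cy i (frame c p) = (\<Sum>j\<in>UNIV. c j p * cy i (Xvf j p))"
    by (simp_all add: frame_def fst_sum snd_sum)
  moreover have "c j p * cx i (Xvf j p) = (if j = i then - 2 * cy i p * c i p else 0)"
    "c j p * cy i (Xvf j p) = (if j = i then 2 * cx i p * c i p else 0)" for j
    by (auto simp: Xvf_e)
  ultimately show "cx i (frame c p) = - 2 * cy i p * c i p" "cy i (frame c p) = 2 * cx i p * c i p"
    by simp_all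
qed

lemma frame_inj:
  assumes c: "\<And>i. smooth (c i)" and d: "\<And>i. smooth (d i)" and eq: "frame c = frame d"
  shows "c = d"
proof (rule ext, rule ext)
  fix i p
  have "c i p - d i p = 0"
  proof (rule zero_of_hfun_mult_zero[of "\<lambda>p. c i p - d i p" i])
    show "continuous_on UNIV (\<lambda>p. c i p - d i p)"
      by (rule smooth_continuous[OF smooth_diff[OF c d]])
    fix p
    have "cy i p * c i p = cy i p * d i p" "cx i p * c i p = cx i p * d i p"
      using coord_frame[where i = i and c = c and p = p] coord_frame[where i = i and c = d and p = p] eq by auto
    then have "cy i p * (c i p - d i p) = 0" "cx i p * (c i p - d i p) = 0"
      by (simp_all add: right_diff_distrib)
    then show "hfun i p * (c i p - d i p) = 0" by (auto simp: hfun_def)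
  qed
  then show "c i p = d i p" by simp
qed

lemma coef_frame:
  assumes "\<And>i. smooth (c i)"
  shows "coef (frame c) = c"
  by (rule frame_inj) (auto simp: assms frame_in_Fmod frame_coef intro: smooth_coef)

lemma Xvf_eq_frame: "Xvf j = frame (\<lambda>i p. if i = j then 1 else 0)"
proof
  fix p
  have "(if i = j then 1 else 0) *\<^sub>R Xvf i p = (if i = j then Xvf j p else 0)" for i by simp
  then show "Xvf j p = frame (\<lambda>i p. if i = j then 1 else 0) p" unfolding frame_def by simp
qed

lemma Xvf_in_Fmod [simp]: "Xvf j \<in> Fmod"
  unfolding Xvf_eq_frame by (rule frame_in_Fmod) simp

lemma coef_Xvf: "coef (Xvf j) i = (\<lambda>p. if i = j then 1 else 0)"
  unfolding Xvf_eq_frame by (subst coef_frame) simp_all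

lemma lincomb_eq_frame:
  assumes "V \<in> Fmod" "W \<in> Fmod"
  shows "(\<lambda>p. f p *\<^sub>R V p + g p *\<^sub>R W p) = frame (\<lambda>i p. f p * coef V i p + g p * coef W i p)"
proof
  fix p
  have "f p *\<^sub>R V p + g p *\<^sub>R W p = f p *\<^sub>R frame (coef V) p + g p *\<^sub>R frame (coef W) p"
    using assms by (simp add: frame_coef)
  then show "f p *\<^sub>R V p + g p *\<^sub>R W p = frame (\<lambda>i p. f p * coef V i p + g p * coef W i p) p"
    by (simp add: frame_def scaleR_sum_right scaleR_add_left sum.distrib)
qed

lemma lincomb_in_Fmod:
  assumes "V \<in> Fmod" "W \<in> Fmod" "smooth f" "smooth g"
  shows "(\<lambda>p. f p *\<^sub>R V p + g p *\<^sub>R W p) \<in> Fmod"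
  unfolding lincomb_eq_frame[OF assms(1,2)]
  by (intro frame_in_Fmod smooth_add smooth_mult smooth_coef assms)

lemma coef_lincomb:
  assumes "V \<in> Fmod" "W \<in> Fmod" "smooth f" "smooth g"
  shows "coef (\<lambda>p. f p *\<^sub>R V p + g p *\<^sub>R W p) i = (\<lambda>p. f p * coef V i p + g p * coef W i p)"
  unfolding lincomb_eq_frame[OF assms(1,2)]
  by (subst coef_frame) (auto intro!: smooth_coef assms)

subsection \<open>Forms and cochains\<close>

text \<open>The linear half of \<open>Omega\<close>, separated from smoothness and alternation so
  that it can be established for maps such as \<open>dF k \<alpha>\<close> before they are known to
  be forms.\<close>

definition multilin :: "nat \<Rightarrow> ('n::finite) form \<Rightarrow> bool" where
  "multilin k F \<longleftrightarrow> depends_below k F \<and>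
    (\<forall>Y i f g V W. args_in_F k Y \<and> i < k \<and> smooth f \<and> smooth g \<and> V \<in> Fmod \<and> W \<in> Fmod \<longrightarrow>
        F (Y(i := (\<lambda>p. f p *\<^sub>R V p + g p *\<^sub>R W p))) = (\<lambda>p. f p * F (Y(i := V)) p + g p * F (Y(i := W)) p))"

lemma multilinD:
  assumes "multilin k F" "args_in_F k Y" "i < k" "smooth f" "smooth g" "V \<in> Fmod" "W \<in> Fmod"
  shows "F (Y(i := (\<lambda>p. f p *\<^sub>R V p + g p *\<^sub>R W p))) p = f p * F (Y(i := V)) p + g p * F (Y(i := W)) p"
  using assms unfolding multilin_def by simp

lemma args_in_F_upd: "args_in_F k Y \<Longrightarrow> V \<in> Fmod \<Longrightarrow> args_in_F k (Y(i := V))"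
  by (simp add: args_in_F_def)

lemma args_in_F_prepend: "args_in_F (Suc k) (prepend V Y) \<longleftrightarrow> V \<in> Fmod \<and> args_in_F k Y"
  by (auto simp: args_in_F_def less_Suc_eq_0_disj)

lemma args_in_F_omit: "args_in_F (Suc k) Y \<Longrightarrow> i \<le> k \<Longrightarrow> args_in_F k (omit i Y)"
  by (auto simp: args_in_F_def omit_def)

lemma args_in_F_swap_adj: "Suc m < k \<Longrightarrow> args_in_F k (swap_adj m Y) \<longleftrightarrow> args_in_F k Y"
proof
  have *: "args_in_F k (swap_adj m Y)" if "Suc m < k" "args_in_F k Y" for Y
    using that by (auto simp: args_in_F_def swap_adj_def)
  assume m: "Suc m < k"
  show "args_in_F k Y \<Longrightarrow> args_in_F k (swap_adj m Y)" using *[OF m] .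
  have "swap_adj m (swap_adj m Y) = Y" by (auto simp: swap_adj_def)
  then show "args_in_F k (swap_adj m Y) \<Longrightarrow> args_in_F k Y" using *[OF m, of "swap_adj m Y"] by simp
qed

lemma depends_below_args_in_F: "depends_below k (args_in_F k)"
  by (auto simp: depends_below_def args_in_F_def)

lemma depends_below_trunc: "depends_below k F \<longleftrightarrow> (\<forall>Y. F Y = F (trunc k Y))"
proof
  assume "depends_below k F"
  then show "\<forall>Y. F Y = F (trunc k Y)" by (auto intro!: localD[of k F] simp: trunc_def)
next
  assume F: "\<forall>Y. F Y = F (trunc k Y)"
  show "depends_below k F" unfolding depends_below_def
  proof (intro allI impI)
    fix z z' :: "nat \<Rightarrow> 'a pt \<Rightarrow> 'a pt" assume "\<forall>m<k. z m = z' m"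
    then have "trunc k z = trunc k z'" by (auto simp: trunc_def)
    then show "F z = F z'" using F by metis
  qed
qed

lemma multilin_add_slot:
  assumes "multilin k F" "args_in_F k Y" "i < k" "V \<in> Fmod" "W \<in> Fmod"
  shows "F (Y(i := (\<lambda>p. V p + W p))) p = F (Y(i := V)) p + F (Y(i := W)) p"
  using multilinD[OF assms(1-3) smooth_const[of 1] smooth_const[of 1] assms(4,5)] by simp

lemma multilin_zero_slot:
  assumes "multilin k F" "args_in_F k Y" "i < k"
  shows "F (Y(i := (\<lambda>p. 0))) p = 0"
  using multilinD[OF assms smooth_const[of 0] smooth_const[of 0], of "Xvf undefined" "Xvf undefined"] by simp

lemma multilin_frame_slot:
  assumes F: "multilin k F" "args_in_F k Y" "i < k" and c: "\<And>b. smooth (c b)"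
  shows "F (Y(i := frame c)) p = (\<Sum>b\<in>UNIV. c b p * F (Y(i := Xvf b)) p)"
proof -
  \<comment> \<open>Membership of the partial sums in \<open>Fmod\<close> is carried along, because
    linearity in a slot is available only for arguments from \<open>Fmod\<close>.\<close>
  have "(\<lambda>p. \<Sum>b\<in>B. c b p *\<^sub>R Xvf b p) \<in> Fmod \<and>
    F (Y(i := (\<lambda>p. \<Sum>b\<in>B. c b p *\<^sub>R Xvf b p))) p = (\<Sum>b\<in>B. c b p * F (Y(i := Xvf b)) p)"
    if "finite B" for B using that
  proof (induction B)
    case empty
    have "(\<lambda>p. 0) \<in> Fmod"
      using frame_in_Fmod[of "\<lambda>i p. 0"] by (simp add: frame_def)
    then show ?case by (simp only: sum.empty multilin_zero_slot[OF F] simp_thms)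
  next
    case (insert b B)
    let ?S = "\<lambda>p. \<Sum>b\<in>B. c b p *\<^sub>R Xvf b p"
    have eq: "(\<lambda>p. \<Sum>b\<in>insert b B. c b p *\<^sub>R Xvf b p) = (\<lambda>p. c b p *\<^sub>R Xvf b p + 1 *\<^sub>R ?S p)"
      using insert.hyps by simp
    show ?case
      unfolding eq using insert
      by (auto simp: multilinD[OF F c smooth_const[of 1]] intro: lincomb_in_Fmod c simp del: scaleR_one fun_upd_apply)
  qed
  from this[of UNIV] show ?thesis by (simp add: frame_def)
qed

text \<open>The multilinear extension of frame values \<open>a\<close>: the sum over all index
  tuples of the product of the coefficients of \<open>Y 0\<close>, \<open>Y 1\<close>, ... times
  \<open>a\<close>. At length 0 the constant \<open>undefined\<close> tuple is a placeholder,
  harmless when \<open>a\<close> depends on no entries.\<close>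

primrec frame_expansion :: "nat \<Rightarrow> ((nat \<Rightarrow> 'n::finite) \<Rightarrow> 'n pt \<Rightarrow> real) \<Rightarrow> 'n form" where
  "frame_expansion 0 a Y = a (\<lambda>_. undefined)"
| "frame_expansion (Suc k) a Y = (\<lambda>p. \<Sum>b\<in>UNIV. coef (Y 0) b p * frame_expansion k (\<lambda>js. a (prepend b js)) (omit 0 Y) p)"

lemma depends_below_frame_expansion: "depends_below k (frame_expansion k a)"
proof (induction k arbitrary: a)
  case (Suc k)
  show ?case unfolding depends_below_def
  proof (intro allI impI)
    fix Y Y' :: "nat \<Rightarrow> 'a pt \<Rightarrow> 'a pt" assume z: "\<forall>m<Suc k. Y m = Y' m"
    have "frame_expansion k (\<lambda>js. a (prepend b js)) (omit 0 Y) = frame_expansion k (\<lambda>js. a (prepend b js)) (omit 0 Y')" for b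
      by (rule localD[OF Suc]) (use z in \<open>auto simp: omit_0\<close>)
    then show "frame_expansion (Suc k) a Y = frame_expansion (Suc k) a Y'" using z by simp
  qed
qed (simp add: depends_below_def)

lemma multilin_frame_expansion: "multilin k (frame_expansion k a)"
proof -
  have "frame_expansion k a (Y(i := (\<lambda>p. f p *\<^sub>R V p + g p *\<^sub>R W p))) p = f p * frame_expansion k a (Y(i := V)) p + g p * frame_expansion k a (Y(i := W)) p"
    if i: "i < k" and VW: "smooth f" "smooth g" "V \<in> Fmod" "W \<in> Fmod" for Y i f g V W p
    using i
  proof (induction k arbitrary: a i Y)
    case (Suc k)
    show ?case
    proof (cases i)
      case 0
      show ?thesis
        unfolding 0 frame_expansion.simps omit_upd_eq fun_upd_same coef_lincomb[OF VW(3,4,1,2)]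
        by (simp add: sum_distrib_left sum.distrib ring_distribs mult_ac del: fun_upd_apply)
    next
      case (Suc j)
      then have "omit 0 (Y(i := V)) = (omit 0 Y)(j := V)" for V by (simp add: omit_upd_greater)
      moreover have "(Y(i := V)) 0 = Y 0" for V using Suc by simp
      moreover have "j < k" using Suc Suc.prems by simp
      ultimately show ?thesis
        by (simp only: frame_expansion.simps Suc.IH) (simp add: sum_distrib_left sum.distrib ring_distribs mult_ac del: fun_upd_apply)
    qed
  qed simp
  then show ?thesis unfolding multilin_def by (auto simp: depends_below_frame_expansion fun_eq_iff)
qed

lemma smooth_frame_expansion: "args_in_F k Y \<Longrightarrow> (\<And>js. smooth (a js)) \<Longrightarrow> smooth (frame_expansion k a Y)"
proof (induction k arbitrary: a Y)
  case (Suc k)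
  have "Y 0 \<in> Fmod" using Suc.prems(1) by (simp add: args_in_F_def)
  then show ?case
    unfolding frame_expansion.simps
    by (intro smooth_sum smooth_mult smooth_coef Suc.IH args_in_F_omit[OF Suc.prems(1)] Suc.prems(2)) auto
qed simp

lemma frame_expansion_add: "frame_expansion k (\<lambda>js p. a js p + b js p) Y p = frame_expansion k a Y p + frame_expansion k b Y p"
  by (induction k arbitrary: a b Y) (simp_all add: ring_distribs sum.distrib)

lemma frame_expansion_cmult: "frame_expansion k (\<lambda>js p. c * a js p) Y p = c * frame_expansion k a Y p"
  by (induction k arbitrary: a Y) (simp_all add: sum_distrib_left mult_ac)

text \<open>A transposition away from slot 0 is passed to the shorter expansion. At slot 0 it
  exchanges the two outer sums, and antisymmetry of \<open>a\<close> in its first two indices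
  supplies the sign.\<close>

lemma antisym_swap_frame_expansion:
  assumes "\<And>p. antisym_swap k (\<lambda>js. a js p)"
  shows "antisym_swap k (\<lambda>Y. frame_expansion k a Y p)"
  using assms
proof (induction k arbitrary: a)
  case (Suc k)
  show ?case unfolding antisym_swap_def
  proof (intro allI impI)
    fix Y :: "nat \<Rightarrow> 'a pt \<Rightarrow> 'a pt" and m assume m: "Suc m < Suc k"
    show "frame_expansion (Suc k) a (swap_adj m Y) p = - frame_expansion (Suc k) a Y p"
    proof (cases m)
      case (Suc l)
      have "omit 0 (swap_adj m Y) = swap_adj l (omit 0 Y)" "swap_adj m Y 0 = Y 0"
        by (auto simp: Suc omit_swap_adj(3)) (simp add: swap_adj_def)
      moreover have "antisym_swap k (\<lambda>Y. frame_expansion k (\<lambda>js. a (prepend b js)) Y p)" for b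
        by (rule Suc.IH) (rule antisym_swap_prepend[OF Suc.prems])
      ultimately show ?thesis using m Suc by (simp add: antisym_swap_def sum_negf)
    next
      case 0
      with m obtain l where l: "k = Suc l" by (cases k) auto
      have neg: "a (prepend b (prepend c js)) p = - 1 * a (prepend c (prepend b js)) p" for b c js p
      proof -
        have "a (swap_adj 0 (prepend c (prepend b js))) p = - a (prepend c (prepend b js)) p"
          using Suc.prems[of p] l unfolding antisym_swap_def by blast
        then show ?thesis by (simp add: swap_adj_0_prepend)
      qed
      have neg': "frame_expansion l (\<lambda>js. a (prepend b (prepend c js))) Z p = - frame_expansion l (\<lambda>js. a (prepend c (prepend b js))) Z p" for b c Z
      proof -
        have "(\<lambda>js. a (prepend b (prepend c js))) = (\<lambda>js p. - 1 * a (prepend c (prepend b js)) p)"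
          by (rule ext)+ (rule neg)
        then have "frame_expansion l (\<lambda>js. a (prepend b (prepend c js))) Z p = - 1 * frame_expansion l (\<lambda>js. a (prepend c (prepend b js))) Z p"
          by (simp only: frame_expansion_cmult)
        then show ?thesis by simp
      qed
      have "frame_expansion (Suc k) a (swap_adj 0 Y) p = (\<Sum>b\<in>UNIV. \<Sum>c\<in>UNIV. coef (Y (Suc 0)) b p * (coef (Y 0) c p *
          frame_expansion l (\<lambda>js. a (prepend b (prepend c js))) (omit 0 (omit 0 Y)) p))"
        by (simp add: l sum_distrib_left omit_swap_adj) (simp add: swap_adj_def omit_def)
      also have "\<dots> = (\<Sum>b\<in>UNIV. \<Sum>c\<in>UNIV. - (coef (Y (Suc 0)) b p * (coef (Y 0) c p *
          frame_expansion l (\<lambda>js. a (prepend c (prepend b js))) (omit 0 (omit 0 Y)) p)))"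
        by (intro sum.cong refl, subst neg') simp
      also have "\<dots> = - frame_expansion (Suc k) a Y p"
        by (subst sum.swap) (simp add: l sum_distrib_left sum_negf mult_ac omit_0)
      finally show ?thesis using 0 by simp
    qed
  qed
qed (simp add: antisym_swap_def)

lemma frame_expansion_basis: "depends_below k a \<Longrightarrow> frame_expansion k a (\<lambda>m. Xvf (js m)) = a js"
proof (induction k arbitrary: a js)
  case 0
  then show ?case by (auto intro: localD)
next
  case (Suc k)
  have "omit 0 (\<lambda>m. Xvf (js m)) = (\<lambda>m. Xvf (omit 0 js m))" by (simp add: omit_def fun_eq_iff)
  moreover have "(\<Sum>b\<in>UNIV. (if b = c then 1 else 0) * x b) = x c" for c and x :: "'a \<Rightarrow> real"
    by (subst sum.cong[OF refl, of _ _ "\<lambda>b. if b = c then x b else 0"]) auto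
  ultimately show ?case
    by (simp only: frame_expansion.simps coef_Xvf Suc.IH[OF depends_below_prepend[OF Suc.prems]] prepend_omit_0)
qed

lemma multilin_prepend:
  assumes F: "multilin (Suc k) F" and V: "V \<in> Fmod"
  shows "multilin k (\<lambda>Y. F (prepend V Y))"
proof -
  have "depends_below (Suc k) F" using F by (simp add: multilin_def)
  moreover have "F (prepend V (Y(i := (\<lambda>p. f p *\<^sub>R U p + g p *\<^sub>R W p)))) p =
      f p * F (prepend V (Y(i := U))) p + g p * F (prepend V (Y(i := W))) p"
    if "args_in_F k Y" "i < k" "smooth f" "smooth g" "U \<in> Fmod" "W \<in> Fmod" for Y i f g U W p
    using multilinD[OF F, of "prepend V Y" "Suc i" f g U W p] that V
    by (simp add: args_in_F_prepend prepend_upd)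
  ultimately show ?thesis unfolding multilin_def by (auto simp: depends_below_prepend)
qed

text \<open>Expanding slot 0 in the frame leaves multilinear maps with one argument fewer.
  Multilinear maps with equal frame values therefore agree on tuples from \<open>Fmod\<close>, which
  is how the differential is identified below.\<close>

lemma multilin_eq_frame_expansion:
  assumes "multilin k F" "args_in_F k Y"
  shows "F Y = frame_expansion k (\<lambda>js. F (\<lambda>m. Xvf (js m))) Y"
  using assms
proof (induction k arbitrary: F Y)
  case 0
  then show ?case using localD[of 0 F Y] by (simp add: multilin_def)
next
  case (Suc k)
  have Y0: "Y 0 \<in> Fmod" using Suc.prems by (simp add: args_in_F_def)
  show ?case
  proof
    fix p
    have "F Y p = F (Y(0 := frame (coef (Y 0)))) p" by (simp add: frame_coef[OF Y0])
    also have "\<dots> = (\<Sum>b\<in>UNIV. coef (Y 0) b p * F (Y(0 := Xvf b)) p)"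
      by (rule multilin_frame_slot[OF Suc.prems]) (simp_all add: smooth_coef[OF Y0])
    also have "\<dots> = (\<Sum>b\<in>UNIV. coef (Y 0) b p * frame_expansion k (\<lambda>js. F (prepend (Xvf b) (\<lambda>m. Xvf (js m)))) (omit 0 Y) p)"
      unfolding fun_upd_0_eq_prepend
      by (subst Suc.IH[OF multilin_prepend[OF Suc.prems(1)] args_in_F_omit[OF Suc.prems(2)]]) simp_all
    also have "\<dots> = frame_expansion (Suc k) (\<lambda>js. F (\<lambda>m. Xvf (js m))) Y p"
    proof -
      have "prepend (Xvf b) (\<lambda>m. Xvf (js m)) = (\<lambda>m. Xvf (prepend b js m))" for b and js :: "nat \<Rightarrow> 'a"
        by (auto simp: prepend_def fun_eq_iff split: nat.splits)
      then show ?thesis by simp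
    qed
    finally show "F Y p = frame_expansion (Suc k) (\<lambda>js. F (\<lambda>m. Xvf (js m))) Y p" .
  qed
qed

section \<open>Correspondence between forms and antisymmetric coefficient families\<close>

definition cochain :: "nat \<Rightarrow> ((nat \<Rightarrow> 'n::finite) \<Rightarrow> 'n pt \<Rightarrow> real) \<Rightarrow> bool" where
  "cochain k a \<longleftrightarrow> depends_below k a \<and> (\<forall>js. smooth (a js)) \<and> (\<forall>p. antisym_swap k (\<lambda>js. a js p))"

text \<open>Vanishing on tuples outside \<open>Fmod\<close> matches the canonical representatives in
  \<open>Omega\<close>, so that \<open>form_of\<close> and \<open>coords\<close> become inverse to
  each other.\<close>

definition form_of :: "nat \<Rightarrow> ((nat \<Rightarrow> 'n::finite) \<Rightarrow> 'n pt \<Rightarrow> real) \<Rightarrow> 'n form" where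
  "form_of k a Y = (if args_in_F k Y then frame_expansion k a Y else (\<lambda>p. 0))"

definition coords :: "('n::finite) form \<Rightarrow> (nat \<Rightarrow> 'n) \<Rightarrow> 'n pt \<Rightarrow> real" where
  "coords \<alpha> js = \<alpha> (\<lambda>m. Xvf (js m))"

lemma args_in_F_Xvf [simp]: "args_in_F k (\<lambda>m. Xvf (js m))"
  by (simp add: args_in_F_def)

lemma smooth_cochain: "cochain k a \<Longrightarrow> smooth (a js)"
  by (simp add: cochain_def)

text \<open>Slotwise linear combinations stay in \<open>Fmod\<close>, so agreement on such tuples
  transfers linearity; this covers \<open>form_of\<close>, which is cut off elsewhere.\<close>

lemma multilin_cong:
  fixes F G :: "'n::finite form"
  assumes F: "multilin k F" and G: "depends_below k G" and eq: "\<And>Y. args_in_F k Y \<Longrightarrow> G Y = F Y"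
  shows "multilin k G"
  unfolding multilin_def
proof (intro conjI allI impI)
  fix Y :: "nat \<Rightarrow> 'n pt \<Rightarrow> 'n pt" and i and f g :: "'n pt \<Rightarrow> real" and V W :: "'n pt \<Rightarrow> 'n pt"
  assume a: "args_in_F k Y \<and> i < k \<and> smooth f \<and> smooth g \<and> V \<in> Fmod \<and> W \<in> Fmod"
  then have "G (Y(i := \<lambda>p. f p *\<^sub>R V p + g p *\<^sub>R W p)) = F (Y(i := \<lambda>p. f p *\<^sub>R V p + g p *\<^sub>R W p))"
    "G (Y(i := V)) = F (Y(i := V))" "G (Y(i := W)) = F (Y(i := W))"
    using lincomb_in_Fmod[of V W f g] by (auto intro!: eq args_in_F_upd)
  with a F show "G (Y(i := \<lambda>p. f p *\<^sub>R V p + g p *\<^sub>R W p)) = (\<lambda>p. f p * G (Y(i := V)) p + g p * G (Y(i := W)) p)"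
    unfolding multilin_def by simp
qed (rule G)

lemma Omega_iff:
  "\<alpha> \<in> Omega k \<longleftrightarrow> multilin k \<alpha> \<and> (\<forall>Y. \<not> args_in_F k Y \<longrightarrow> \<alpha> Y = (\<lambda>p. 0)) \<and>
     (\<forall>Y. args_in_F k Y \<longrightarrow> smooth (\<alpha> Y)) \<and>
     (\<forall>Y i j. args_in_F k Y \<and> i < k \<and> j < k \<and> i \<noteq> j \<and> Y i = Y j \<longrightarrow> \<alpha> Y = (\<lambda>p. 0))"
  by (simp only: Omega_def multilin_def depends_below_trunc mem_Collect_eq conj_ac)

lemma OmegaD:
  assumes "\<alpha> \<in> Omega k"
  shows Omega_multilin: "multilin k \<alpha>" and Omega_eq_0: "\<not> args_in_F k Y \<Longrightarrow> \<alpha> Y = (\<lambda>p. 0)"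
    and Omega_smooth: "args_in_F k Y \<Longrightarrow> smooth (\<alpha> Y)"
    and Omega_antisym_swap: "antisym_swap k (\<lambda>Y. \<alpha> Y p)"
proof -
  show m: "multilin k \<alpha>" and 0: "\<And>Y. \<not> args_in_F k Y \<Longrightarrow> \<alpha> Y = (\<lambda>p. 0)"
    and "args_in_F k Y \<Longrightarrow> smooth (\<alpha> Y)"
    using assms by (simp_all only: Omega_iff simp_thms)
  have alt: "\<alpha> Y = (\<lambda>p. 0)" if "args_in_F k Y" "i < k" "j < k" "i \<noteq> j" "Y i = Y j" for Y i j
    using assms that by (auto simp only: Omega_iff)
  show "antisym_swap k (\<lambda>Y. \<alpha> Y p)" unfolding antisym_swap_def
  proof (intro allI impI)
    fix Y m assume k: "Suc m < k"
    show "\<alpha> (swap_adj m Y) p = - \<alpha> Y p"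
    proof (cases "args_in_F k Y")
      case False
      then show ?thesis using 0 k by (simp add: args_in_F_swap_adj)
    next
      case True
      let ?V = "Y m" and ?W = "Y (Suc m)"
      let ?S = "\<lambda>p. ?V p + ?W p"
      have V: "?V \<in> Fmod" "?W \<in> Fmod" using True k by (simp_all add: args_in_F_def)
      have S: "?S \<in> Fmod" using lincomb_in_Fmod[OF V smooth_const[of 1] smooth_const[of 1]] by simp
      have mk: "m < k" using k by simp
      let ?a = "\<lambda>U U'. \<alpha> ((Y(m := U))(Suc m := U')) p"
      have z: "?a U U = 0" if "U \<in> Fmod" for U
        using alt[of "Y(m := U, Suc m := U)" m "Suc m"] k mk that True by (simp add: args_in_F_upd)
      have l: "?a U ?S = ?a U ?V + ?a U ?W" if "U \<in> Fmod" for U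
        by (rule multilin_add_slot[OF m _ k V]) (rule args_in_F_upd[OF True that])
      have r: "?a ?S U = ?a ?V U + ?a ?W U" if "U \<in> Fmod" for U
        using multilin_add_slot[OF m args_in_F_upd[OF True that, of "Suc m"] mk V, of p]
        by (simp only: fun_upd_twist[of "Suc m" m] n_not_Suc_n simp_thms not_sym)
      \<comment> \<open>Polarisation: the value on the pair (V + W, V + W) is zero, and after
        expanding so are the two diagonal terms.\<close>
      have "0 = ?a ?S ?S" using z[OF S] by simp
      also have "\<dots> = ?a ?V ?W + ?a ?W ?V" unfolding l[OF S] r[OF V(1)] r[OF V(2)] z[OF V(1)] z[OF V(2)] by simp
      finally show ?thesis by (simp add: swap_adj_def)
    qed
  qed
qed

lemma OmegaI:
  assumes m: "multilin k \<alpha>" and 0: "\<And>Y. \<not> args_in_F k Y \<Longrightarrow> \<alpha> Y = (\<lambda>p. 0)"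
    and s: "\<And>Y. args_in_F k Y \<Longrightarrow> smooth (\<alpha> Y)" and alt: "\<And>p. antisym_swap k (\<lambda>Y. \<alpha> Y p)"
  shows "\<alpha> \<in> Omega k"
proof -
  have "\<alpha> Y = (\<lambda>p. 0)" if "i < k" "j < k" "i \<noteq> j" "Y i = Y j" for Y i j
  proof
    fix p
    show "\<alpha> Y p = 0"
      using antisym_swap_eq_0[OF alt[of p], of Y i j] antisym_swap_eq_0[OF alt[of p], of Y j i] that by (cases "i < j") auto
  qed
  then show ?thesis using m 0 s unfolding Omega_iff by simp blast
qed

lemma form_in_Omega:
  assumes "cochain k a"
  shows "form_of k a \<in> Omega k"
proof (rule OmegaI)
  have l: "depends_below k (form_of k a)"
    unfolding depends_below_def form_of_def using localD[OF depends_below_args_in_F] localD[OF depends_below_frame_expansion] by metis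
  show "multilin k (form_of k a)"
    by (rule multilin_cong[OF multilin_frame_expansion l]) (simp add: form_of_def)
  show "smooth (form_of k a Y)" if "args_in_F k Y" for Y
    using that smooth_frame_expansion[OF that smooth_cochain[OF assms]] by (simp add: form_of_def)
  have "antisym_swap k (\<lambda>Y. frame_expansion k a Y p)" for p by (rule antisym_swap_frame_expansion) (use assms in \<open>unfold cochain_def, blast\<close>)
  then show "antisym_swap k (\<lambda>Y. form_of k a Y p)" for p
    by (simp add: antisym_swap_def form_of_def args_in_F_swap_adj)
qed (simp add: form_of_def)

lemma coords_form: "cochain k a \<Longrightarrow> coords (form_of k a) = a"
  by (rule ext) (simp add: coords_def form_of_def frame_expansion_basis cochain_def)

lemma form_coords:
  assumes "\<alpha> \<in> Omega k"
  shows "form_of k (coords \<alpha>) = \<alpha>"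
proof
  fix Y
  show "form_of k (coords \<alpha>) Y = \<alpha> Y"
    using multilin_eq_frame_expansion[OF Omega_multilin[OF assms], of Y] Omega_eq_0[OF assms, of Y]
    by (simp add: form_of_def coords_def[abs_def])
qed

lemma cochain_coords:
  assumes "\<alpha> \<in> Omega k"
  shows "cochain k (coords \<alpha>)"
  unfolding cochain_def
proof (intro conjI allI)
  show "depends_below k (coords \<alpha>)"
    using Omega_multilin[OF assms] unfolding multilin_def depends_below_def coords_def by simp
  show "smooth (coords \<alpha> js)" for js
    unfolding coords_def by (rule Omega_smooth[OF assms]) simp
  have "(\<lambda>l. Xvf (swap_adj m js l)) = swap_adj m (\<lambda>l. Xvf (js l))" for m and js :: "nat \<Rightarrow> 'a"
    by (auto simp: swap_adj_def)
  then show "antisym_swap k (\<lambda>js. coords \<alpha> js p)" for p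
    using Omega_antisym_swap[OF assms, of p] by (simp add: antisym_swap_def coords_def)
qed

lemma Omega_eqI: "\<alpha> \<in> Omega k \<Longrightarrow> \<beta> \<in> Omega k \<Longrightarrow> coords \<alpha> = coords \<beta> \<Longrightarrow> \<alpha> = \<beta>"
  by (metis form_coords)

subsection \<open>The differential in coordinates\<close>

definition delta :: "nat \<Rightarrow> ((nat \<Rightarrow> 'n::finite) \<Rightarrow> 'n pt \<Rightarrow> real) \<Rightarrow> (nat \<Rightarrow> 'n) \<Rightarrow> 'n pt \<Rightarrow> real" where
  "delta k a js p = (\<Sum>i\<le>k. (-1)^i * lx (js i) (a (omit i js)) p)"

lemma cochain_delta:
  assumes "cochain k a"
  shows "cochain (Suc k) (delta k a)"
  unfolding cochain_def
proof (intro conjI allI)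
  have s: "smooth (a js)" for js using assms by (simp add: cochain_def)
  show "depends_below (Suc k) (delta k a)" unfolding depends_below_def
  proof (intro allI impI ext)
    fix z z' :: "nat \<Rightarrow> 'a" and p assume z: "\<forall>m<Suc k. z m = z' m"
    have "a (omit i z) = a (omit i z')" if "i \<le> k" for i
      by (rule localD[of k]) (use assms z that in \<open>auto simp: cochain_def omit_def\<close>)
    then show "delta k a z p = delta k a z' p"
      unfolding delta_def using z by (intro sum.cong) auto
  qed
  show "smooth (delta k a js)" for js
    unfolding delta_def[abs_def] by (intro smooth_sum smooth_cmult smooth_lx s)
  show "antisym_swap (Suc k) (\<lambda>js. delta k a js p)" for p
    unfolding delta_def
  proof (rule antisym_swap_alternating_sum)
    fix x
    show "antisym_swap k (\<lambda>js. lx x (a js) p)" unfolding antisym_swap_def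
    proof (intro allI impI)
      fix z m assume "Suc m < k"
      then have "a (swap_adj m z) = (\<lambda>p. - a z p)" using assms unfolding cochain_def antisym_swap_def by blast
      then show "lx x (a (swap_adj m z)) p = - lx x (a z) p" by (simp add: vf_apply_minus[OF s])
    qed
  qed
qed

lemma smooth_vf_apply:
  assumes "V \<in> Fmod" "smooth f"
  shows "smooth (vf_apply V f)"
proof -
  have "vf_apply V f = (\<lambda>p. \<Sum>i\<in>UNIV. coef V i p * lx i f p)"
  proof
    fix p
    have "V p = (\<Sum>i\<in>UNIV. coef V i p *\<^sub>R Xvf i p)" using frame_coef[OF assms(1)] by (metis frame_def)
    then show "vf_apply V f p = (\<Sum>i\<in>UNIV. coef V i p * lx i f p)"
      unfolding vf_apply_dir_deriv by (simp add: dir_deriv_vec_sum dir_deriv_scaleR assms(2))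
  qed
  then show ?thesis by (auto intro!: smooth_sum smooth_mult smooth_coef smooth_lx assms)
qed

section \<open>Lie brackets in the module and tensoriality of the differential\<close>

lemma frame_has_derivative:
  assumes "\<And>i. smooth (c i)"
  shows "(frame c has_derivative (\<lambda>v. \<Sum>i\<in>UNIV. c i p *\<^sub>R Xvf i v + dir_deriv v (c i) p *\<^sub>R Xvf i p)) (at p)"
  unfolding frame_def
  by (intro has_derivative_sum has_derivative_scaleR smooth_has_derivative assms
      bounded_linear_imp_has_derivative bounded_linear_Xvf)

lemma Fmod_differentiable: "V \<in> Fmod \<Longrightarrow> V differentiable (at p)"
  unfolding Fmod_frame differentiable_def using frame_has_derivative by blast

text \<open>The terms without derivatives of coefficients carry brackets of the linear fields X_i,
  which commute, and so they cancel. What is left is again a combination of the frame.\<close>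

lemma lie_bracket_frame:
  fixes c d :: "'n::finite \<Rightarrow> 'n pt \<Rightarrow> real"
  assumes c: "\<And>i. smooth (c i)" and d: "\<And>i. smooth (d i)"
  shows "lie_bracket (frame c) (frame d) = frame (\<lambda>i p. vf_apply (frame c) (d i) p - vf_apply (frame d) (c i) p)"
proof
  fix p
  note D = frechet_derivative_at[OF frame_has_derivative, symmetric]
  have X: "Xvf i (frame e p) = (\<Sum>j\<in>UNIV. e j p *\<^sub>R Xvf i (Xvf j p))" for i and e :: "'n \<Rightarrow> 'n pt \<Rightarrow> real"
    unfolding frame_def using bounded_linear.linear[OF bounded_linear_Xvf[of i]]
    by (simp add: linear_sum linear_cmul)
  have "(\<Sum>i\<in>UNIV. d i p *\<^sub>R Xvf i (frame c p)) = (\<Sum>i\<in>UNIV. c i p *\<^sub>R Xvf i (frame d p))"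
    unfolding X scaleR_sum_right by (subst sum.swap) (simp add: Xvf_Xvf mult.commute)
  moreover define e where "e i p = vf_apply (frame c) (d i) p - vf_apply (frame d) (c i) p" for i p
  have "frame e p = (\<Sum>i\<in>UNIV. dir_deriv (frame c p) (d i) p *\<^sub>R Xvf i p) - (\<Sum>i\<in>UNIV. dir_deriv (frame d p) (c i) p *\<^sub>R Xvf i p)"
    unfolding frame_def[of e] by (simp add: e_def vf_apply_dir_deriv scaleR_diff_left sum_subtractf)
  ultimately show "lie_bracket (frame c) (frame d) p = frame (\<lambda>i p. vf_apply (frame c) (d i) p - vf_apply (frame d) (c i) p) p"
    unfolding lie_bracket_def D[OF c] D[OF d] e_def[abs_def] by (simp add: sum.distrib)
qed

lemma lie_bracket_in_Fmod:
  assumes "V \<in> Fmod" "W \<in> Fmod"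
  shows "lie_bracket V W \<in> Fmod"
proof -
  have "lie_bracket (frame (coef V)) (frame (coef W)) \<in> Fmod"
    unfolding lie_bracket_frame[OF smooth_coef[OF assms(1)] smooth_coef[OF assms(2)]]
    by (intro frame_in_Fmod smooth_diff smooth_vf_apply smooth_coef assms) 
  then show ?thesis by (simp add: frame_coef assms)
qed

lemma lie_bracket_Xvf: "lie_bracket (Xvf i) (Xvf j) = (\<lambda>p. 0)"
proof -
  have "frechet_derivative (Xvf j) (at p) = Xvf j" for j and p :: "'a pt"
    using frechet_derivative_at[OF bounded_linear_imp_has_derivative[OF bounded_linear_Xvf[of j]]] by metis
  then show ?thesis unfolding lie_bracket_def by (simp add: Xvf_Xvf[of i j])
qed

text \<open>The derivative terms are kept as a separate combination of \<open>V\<close> and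
  \<open>W\<close>, in the second identity with the minus sign inside the coefficients, so that both
  summands are literally members of \<open>Fmod\<close> and additivity of a form applies.\<close>

lemma lie_bracket_lincomb:
  assumes "V \<in> Fmod" "W \<in> Fmod" "smooth f" "smooth g" "Z \<in> Fmod"
  shows "lie_bracket Z (\<lambda>p. f p *\<^sub>R V p + g p *\<^sub>R W p) p =
      (f p *\<^sub>R lie_bracket Z V p + g p *\<^sub>R lie_bracket Z W p)
      + (vf_apply Z f p *\<^sub>R V p + vf_apply Z g p *\<^sub>R W p)"
    and "lie_bracket (\<lambda>p. f p *\<^sub>R V p + g p *\<^sub>R W p) Z p =
      (f p *\<^sub>R lie_bracket V Z p + g p *\<^sub>R lie_bracket W Z p)
      + (- vf_apply Z f p *\<^sub>R V p + - vf_apply Z g p *\<^sub>R W p)"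
proof -
  have dV: "(V has_derivative frechet_derivative V (at p)) (at p)"
    and dW: "(W has_derivative frechet_derivative W (at p)) (at p)"
    using Fmod_differentiable assms frechet_derivative_works by blast+
  have lin: "linear (frechet_derivative Z (at p))"
    using Fmod_differentiable[OF assms(5)] linear_frechet_derivative by blast
  have "((\<lambda>p. f p *\<^sub>R V p + g p *\<^sub>R W p) has_derivative
    (\<lambda>v. (f p *\<^sub>R frechet_derivative V (at p) v + dir_deriv v f p *\<^sub>R V p)
      + (g p *\<^sub>R frechet_derivative W (at p) v + dir_deriv v g p *\<^sub>R W p))) (at p)"
    by (intro has_derivative_add has_derivative_scaleR smooth_has_derivative assms dV dW)
  note D = frechet_derivative_at[OF this, symmetric]
  show "lie_bracket Z (\<lambda>p. f p *\<^sub>R V p + g p *\<^sub>R W p) p =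
      (f p *\<^sub>R lie_bracket Z V p + g p *\<^sub>R lie_bracket Z W p)
      + (vf_apply Z f p *\<^sub>R V p + vf_apply Z g p *\<^sub>R W p)"
    unfolding lie_bracket_def D
    by (simp add: linear_add[OF lin] linear_cmul[OF lin] vf_apply_dir_deriv algebra_simps)
  show "lie_bracket (\<lambda>p. f p *\<^sub>R V p + g p *\<^sub>R W p) Z p =
      (f p *\<^sub>R lie_bracket V Z p + g p *\<^sub>R lie_bracket W Z p)
      + (- vf_apply Z f p *\<^sub>R V p + - vf_apply Z g p *\<^sub>R W p)"
    unfolding lie_bracket_def D
    by (simp add: linear_add[OF lin] linear_cmul[OF lin] vf_apply_dir_deriv algebra_simps)
qed

lemma vf_apply_lincomb: "smooth f \<Longrightarrow> vf_apply (\<lambda>p. a p *\<^sub>R V p + b p *\<^sub>R W p) f p = a p * vf_apply V f p + b p * vf_apply W f p"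
  by (simp add: vf_apply_dir_deriv linear_add[OF linear_dir_deriv] dir_deriv_scaleR)

lemma multilin_prepend_lincomb:
  assumes "multilin (Suc k) \<alpha>" "args_in_F k Z" "smooth f" "smooth g" "V \<in> Fmod" "W \<in> Fmod"
  shows "\<alpha> (prepend (\<lambda>p. f p *\<^sub>R V p + g p *\<^sub>R W p) Z) p = f p * \<alpha> (prepend V Z) p + g p * \<alpha> (prepend W Z) p"
  using multilinD[OF assms(1), of "prepend V Z" 0 f g V W p] assms
  by (simp add: args_in_F_prepend fun_upd_0_eq_prepend del: fun_upd_apply)

lemma multilin_prepend_add:
  assumes "multilin (Suc k) \<alpha>" "args_in_F k Z" "V \<in> Fmod" "W \<in> Fmod"
  shows "\<alpha> (prepend (\<lambda>p. V p + W p) Z) p = \<alpha> (prepend V Z) p + \<alpha> (prepend W Z) p"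
  using multilin_prepend_lincomb[OF assms(1,2) smooth_const[of 1] smooth_const[of 1] assms(3,4)] by simp

lemma multilin_prepend_bracket:
  assumes \<alpha>: "multilin (Suc k) \<alpha>" and Z: "args_in_F k Z" and fg: "smooth f" "smooth g"
    and VW: "V \<in> Fmod" "W \<in> Fmod" and U: "U \<in> Fmod"
  shows "\<alpha> (prepend (lie_bracket U (\<lambda>p. f p *\<^sub>R V p + g p *\<^sub>R W p)) Z) p =
      f p * \<alpha> (prepend (lie_bracket U V) Z) p + g p * \<alpha> (prepend (lie_bracket U W) Z) p
      + (vf_apply U f p * \<alpha> (prepend V Z) p + vf_apply U g p * \<alpha> (prepend W Z) p)"
    and "\<alpha> (prepend (lie_bracket (\<lambda>p. f p *\<^sub>R V p + g p *\<^sub>R W p) U) Z) p =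
      f p * \<alpha> (prepend (lie_bracket V U) Z) p + g p * \<alpha> (prepend (lie_bracket W U) Z) p
      - (vf_apply U f p * \<alpha> (prepend V Z) p + vf_apply U g p * \<alpha> (prepend W Z) p)"
proof -
  note b = lie_bracket_in_Fmod[OF U VW(1)] lie_bracket_in_Fmod[OF U VW(2)]
    lie_bracket_in_Fmod[OF VW(1) U] lie_bracket_in_Fmod[OF VW(2) U]
  note s = smooth_vf_apply[OF U fg(1)] smooth_vf_apply[OF U fg(2)]
    smooth_minus[OF smooth_vf_apply[OF U fg(1)]] smooth_minus[OF smooth_vf_apply[OF U fg(2)]]
  show "\<alpha> (prepend (lie_bracket U (\<lambda>p. f p *\<^sub>R V p + g p *\<^sub>R W p)) Z) p =
      f p * \<alpha> (prepend (lie_bracket U V) Z) p + g p * \<alpha> (prepend (lie_bracket U W) Z) p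
      + (vf_apply U f p * \<alpha> (prepend V Z) p + vf_apply U g p * \<alpha> (prepend W Z) p)"
    unfolding ext[OF lie_bracket_lincomb(1)[OF VW fg U]]
      multilin_prepend_add[OF \<alpha> Z lincomb_in_Fmod[OF b(1,2) fg] lincomb_in_Fmod[OF VW s(1,2)]]
      multilin_prepend_lincomb[OF \<alpha> Z fg b(1,2)] multilin_prepend_lincomb[OF \<alpha> Z s(1,2) VW] ..
  show "\<alpha> (prepend (lie_bracket (\<lambda>p. f p *\<^sub>R V p + g p *\<^sub>R W p) U) Z) p =
      f p * \<alpha> (prepend (lie_bracket V U) Z) p + g p * \<alpha> (prepend (lie_bracket W U) Z) p
      - (vf_apply U f p * \<alpha> (prepend V Z) p + vf_apply U g p * \<alpha> (prepend W Z) p)"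
    unfolding ext[OF lie_bracket_lincomb(2)[OF VW fg U]]
      multilin_prepend_add[OF \<alpha> Z lincomb_in_Fmod[OF b(3,4) fg] lincomb_in_Fmod[OF VW s(3,4)]]
      multilin_prepend_lincomb[OF \<alpha> Z fg b(3,4)] multilin_prepend_lincomb[OF \<alpha> Z s(3,4) VW] by simp
qed

text \<open>Slot \<open>l\<close> survives both omissions and moves down by one for each omitted
  index below it; the new position does not depend on the inserted \<open>U\<close>.\<close>

lemma omit_omit_upd:
  assumes "i < j" "j \<le> Suc k" "l \<le> Suc k" "l \<noteq> i" "l \<noteq> j"
  shows "\<exists>l'<k. \<forall>U. omit i (omit j (Y(l := U))) = (omit i (omit j Y))(l' := U)"
proof -
  define m where "m = (if l < j then l else l - 1)"
  have m: "omit j (Y(l := U)) = (omit j Y)(m := U)" for U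
    using assms by (cases "l < j") (simp_all add: m_def omit_upd_less omit_upd_greater del: fun_upd_apply)
  have "m \<noteq> i" using assms by (auto simp: m_def)
  then have "omit i ((omit j Y)(m := U)) = (omit i (omit j Y))((if m < i then m else m - 1) := U)" for U
    by (cases "m < i") (simp_all add: omit_upd_less omit_upd_greater del: fun_upd_apply)
  then show ?thesis unfolding m
    by (intro exI[of _ "if m < i then m else m - 1"]) (use assms in \<open>auto simp: m_def simp del: fun_upd_apply\<close>)
qed

text \<open>Tensoriality of the Cartan formula: the derivatives of the coefficients \<open>f, g\<close> in the slot \<open>l\<close>
  produced by the first sum cancel against those produced by the brackets.\<close>
lemma cartan_slot:
  fixes \<alpha> :: "'n::finite form"
  defines "T \<equiv> \<lambda>Y p i. (-1)^i * vf_apply (Y i) (\<alpha> (omit i Y)) p"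
    and "B \<equiv> \<lambda>Y p i j. (-1)^(i+j) * \<alpha> (prepend (lie_bracket (Y i) (Y j)) (omit i (omit j Y))) p"
  assumes \<alpha>: "\<alpha> \<in> Omega k" and Y: "args_in_F (Suc k) Y" and l: "l \<le> k"
    and fg: "smooth f" "smooth g" and VW: "V \<in> Fmod" "W \<in> Fmod"
  defines "U \<equiv> \<lambda>p. f p *\<^sub>R V p + g p *\<^sub>R W p"
  defines "D \<equiv> \<lambda>Y p. (\<Sum>i\<le>k. T Y p i) + (\<Sum>i\<le>k. \<Sum>j\<in>{i<..k}. B Y p i j)"
  shows "D (Y(l := U)) p = f p * D (Y(l := V)) p + g p * D (Y(l := W)) p"
proof -
  note m = Omega_multilin[OF \<alpha>]
  have U: "U \<in> Fmod" unfolding U_def by (rule lincomb_in_Fmod[OF VW fg])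
  have Yi: "Y i \<in> Fmod" if "i \<le> k" for i using Y that by (simp add: args_in_F_def)
  \<comment> \<open>\<open>E i\<close> is the non-tensorial defect of the \<open>i\<close>-th term
    of the first sum, for i different from \<open>l\<close>. The bracket of the slots
    \<open>i\<close> and \<open>l\<close> has to produce its negative.\<close>
  define E where "E i = (-1)^i * (vf_apply (Y i) f p * \<alpha> (omit i (Y(l := V))) p
      + vf_apply (Y i) g p * \<alpha> (omit i (Y(l := W))) p)" for i
  have T: "T (Y(l := U)) p i = f p * T (Y(l := V)) p i + g p * T (Y(l := W)) p i + (if i = l then 0 else E i)"
    if i: "i \<le> k" for i
  proof (cases "i = l")
    case True
    have "smooth (\<alpha> (omit l Y))" by (rule Omega_smooth[OF \<alpha> args_in_F_omit[OF Y l]])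
    then show ?thesis using True
      by (simp add: T_def omit_upd_eq U_def vf_apply_lincomb) (simp add: algebra_simps)
  next
    case False
    define l' where "l' = (if l < i then l else l - 1)"
    have l': "l' < k" "omit i (Y(l := X)) = (omit i Y)(l' := X)" for X
      using False l i by (auto simp: l'_def omit_upd_less omit_upd_greater simp del: fun_upd_apply)
    note Z = args_in_F_omit[OF Y i]
    have "\<alpha> (omit i (Y(l := U))) = (\<lambda>p. f p * \<alpha> (omit i (Y(l := V))) p + g p * \<alpha> (omit i (Y(l := W))) p)"
      unfolding l' U_def by (rule ext) (rule multilinD[OF m Z l'(1) fg VW])
    moreover have "smooth (\<alpha> (omit i (Y(l := V))))" "smooth (\<alpha> (omit i (Y(l := W))))"
      unfolding l'(2) by (rule Omega_smooth[OF \<alpha> args_in_F_upd[OF Z]], rule VW)+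
    ultimately have "vf_apply (Y i) (\<alpha> (omit i (Y(l := U)))) p =
      f p * vf_apply (Y i) (\<alpha> (omit i (Y(l := V)))) p + vf_apply (Y i) f p * \<alpha> (omit i (Y(l := V))) p +
      (g p * vf_apply (Y i) (\<alpha> (omit i (Y(l := W)))) p + vf_apply (Y i) g p * \<alpha> (omit i (Y(l := W))) p)"
      using fg by (simp add: vf_apply_add vf_apply_mult smooth_mult del: fun_upd_apply)
    moreover have "(Y(l := X)) i = Y i" for X using False by simp
    ultimately show ?thesis using False
      unfolding T_def E_def by (simp only: if_False) (simp only: algebra_simps)
  qed
  have B: "B (Y(l := U)) p i j = f p * B (Y(l := V)) p i j + g p * B (Y(l := W)) p i j
      - (if j = l then E i else 0) - (if i = l then E j else 0)"
    if ij: "i < j" "j \<le> k" for i j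
  proof -
    obtain k' where k': "k = Suc k'" using ij by (cases k) auto
    note m' = m[unfolded k']
    have Z: "args_in_F k' (omit i (omit j Y))"
      by (rule args_in_F_omit) (use Y k' ij args_in_F_omit[of k Y j] in auto)
    have alt: "antisym_swap k (\<lambda>Y. \<alpha> Y p)" by (rule Omega_antisym_swap[OF \<alpha>])
    consider (neither) "l \<noteq> i" "l \<noteq> j" | (right) "l = j" | (left) "l = i" by blast
    then show ?thesis
    proof cases
      case neither
      obtain l' where l': "l' < k'" "\<And>X. omit i (omit j (Y(l := X))) = (omit i (omit j Y))(l' := X)"
        using omit_omit_upd[of i j k' l Y] ij l neither unfolding k' by blast
      let ?b = "lie_bracket (Y i) (Y j)"
      have b: "args_in_F k (prepend ?b (omit i (omit j Y)))"
        unfolding k' args_in_F_prepend using Z Yi ij by (auto intro: lie_bracket_in_Fmod)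
      have s: "Suc l' < k" using l' k' by simp
      have "\<alpha> (prepend ?b (omit i (omit j (Y(l := U))))) p =
        f p * \<alpha> (prepend ?b (omit i (omit j (Y(l := V))))) p + g p * \<alpha> (prepend ?b (omit i (omit j (Y(l := W))))) p"
        unfolding l'(2) prepend_upd[symmetric] U_def by (rule multilinD[OF m b s fg VW])
      moreover have "(Y(l := X)) i = Y i" "(Y(l := X)) j = Y j" for X using neither by auto
      ultimately show ?thesis using neither
        unfolding B_def by (simp only: if_False) (simp add: algebra_simps del: fun_upd_apply)
    next
      case right
      have e: "omit i (omit j (Y(l := X))) = omit i (omit j Y)" for X
        using right by (simp add: omit_upd_eq)
      \<comment> \<open>Here i < j = l: once \<open>i\<close> is omitted, slot \<open>l\<close> has
        become l - 1, and l - 1 transpositions relate it to the leading slot. Together with the sign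
        of the bracket term this gives the minus in front of \<open>E i\<close>.\<close>
      have mv: "\<alpha> (prepend X (omit i (omit j Y))) p = (-1)^(l - 1) * \<alpha> (omit i (Y(l := X))) p" for X
      proof -
        have "omit i (Y(l := X)) (l - 1) = X" using ij right by (auto simp: omit_def)
        moreover have "omit (l - 1) (omit i (Y(l := X))) = omit i (omit j Y)"
          using omit_omit[of i l "Y(l := X)"] ij right by (simp add: omit_upd_eq)
        ultimately show ?thesis
          using antisym_swap_move_front[OF alt, of "l - 1" "omit i (Y(l := X))"] ij right by simp
      qed
      have sg: "(-1)^(i + j) * ((-1)^(l - 1) * x) = - ((-1)^i * x)" for x :: real
      proof -
        obtain n where "j = Suc n" using ij by (cases j) auto
        then show ?thesis using right by (simp add: power_add mult.assoc)
      qed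
      have "B (Y(l := U)) p i j = (-1)^(i + j) * \<alpha> (prepend (lie_bracket (Y i) U) (omit i (omit j Y))) p"
        unfolding B_def e using ij right by simp
      also have "\<dots> = f p * B (Y(l := V)) p i j + g p * B (Y(l := W)) p i j
          + ((-1)^(i + j) * ((-1)^(l - 1) * (vf_apply (Y i) f p * \<alpha> (omit i (Y(l := V))) p))
           + (-1)^(i + j) * ((-1)^(l - 1) * (vf_apply (Y i) g p * \<alpha> (omit i (Y(l := W))) p)))"
      proof -
        have "(Y(l := X)) i = Y i" "(Y(l := X)) j = X" for X using ij right by auto
        then show ?thesis
          unfolding U_def B_def e multilin_prepend_bracket(1)[OF m' Z fg VW Yi[of i, OF less_imp_le[OF less_le_trans[OF ij]]]] mv[of V] mv[of W]
          by (simp only: algebra_simps)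
      qed
      finally show ?thesis unfolding sg E_def using ij right by (simp add: ring_distribs del: fun_upd_apply)
    next
      case left
      have e: "omit i (omit j (Y(l := X))) = omit i (omit j Y)" for X
        using left ij by (simp add: omit_upd_less omit_upd_eq del: fun_upd_apply)
      \<comment> \<open>Here l = i < j, so omitting \<open>j\<close> does not shift slot
        \<open>l\<close>. The remaining sign is that of \<open>E j\<close>, and the minus now comes
        from the second bracket identity.\<close>
      have mv: "\<alpha> (prepend X (omit i (omit j Y))) p = (-1)^l * \<alpha> (omit j (Y(l := X))) p" for X
      proof -
        have "omit j (Y(l := X)) l = X" using ij left by (auto simp: omit_def)
        moreover have "omit l (omit j (Y(l := X))) = omit i (omit j Y)"
          using e left by simp
        ultimately show ?thesis
          using antisym_swap_move_front[OF alt, of l "omit j (Y(l := X))"] ij left by simp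
      qed
      have sg: "(-1)^(i + j) * ((-1)^l * x) = (-1)^j * x" for x :: real
        using left by (simp add: power_add)
      have "B (Y(l := U)) p i j = (-1)^(i + j) * \<alpha> (prepend (lie_bracket U (Y j)) (omit i (omit j Y))) p"
        unfolding B_def e using ij left by simp
      also have "\<dots> = f p * B (Y(l := V)) p i j + g p * B (Y(l := W)) p i j
          - ((-1)^(i + j) * ((-1)^l * (vf_apply (Y j) f p * \<alpha> (omit j (Y(l := V))) p))
           + (-1)^(i + j) * ((-1)^l * (vf_apply (Y j) g p * \<alpha> (omit j (Y(l := W))) p)))"
      proof -
        have "(Y(l := X)) i = X" "(Y(l := X)) j = Y j" for X using ij left by auto
        then show ?thesis
          unfolding U_def B_def e multilin_prepend_bracket(2)[OF m' Z fg VW Yi[OF ij(2)]] mv[of V] mv[of W]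
          by (simp only: algebra_simps)
      qed
      finally show ?thesis unfolding sg E_def using ij left by (simp add: ring_distribs del: fun_upd_apply)
    qed
  qed
  have TS: "(\<Sum>i\<le>k. T (Y(l := U)) p i) = f p * (\<Sum>i\<le>k. T (Y(l := V)) p i) + g p * (\<Sum>i\<le>k. T (Y(l := W)) p i)
      + (\<Sum>i\<le>k. if i = l then 0 else E i)"
    using T by (simp add: sum.distrib sum_distrib_left del: fun_upd_apply)
  have BS: "(\<Sum>i\<le>k. \<Sum>j\<in>{i<..k}. B (Y(l := U)) p i j) = f p * (\<Sum>i\<le>k. \<Sum>j\<in>{i<..k}. B (Y(l := V)) p i j)
      + g p * (\<Sum>i\<le>k. \<Sum>j\<in>{i<..k}. B (Y(l := W)) p i j)
      - (\<Sum>i\<le>k. \<Sum>j\<in>{i<..k}. if j = l then E i else 0) - (\<Sum>i\<le>k. \<Sum>j\<in>{i<..k}. if i = l then E j else 0)"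
    using B by (simp add: sum.distrib sum_subtractf sum_distrib_left del: fun_upd_apply)
  \<comment> \<open>Each pair (i, l) with i < l and each pair (l, j) with l < j contributes once, so
    the brackets remove exactly the terms \<open>E i\<close> with i different from
    \<open>l\<close>.\<close>
  have "(\<Sum>i\<le>k. \<Sum>j\<in>{i<..k}. if j = l then E i else 0) = (\<Sum>i\<le>k. if i < l then E i else 0)"
    using l by (intro sum.cong) auto
  moreover have "(\<Sum>i\<le>k. \<Sum>j\<in>{i<..k}. if i = l then E j else 0) = (\<Sum>j\<le>k. if l < j then E j else 0)"
  proof -
    have "(\<Sum>i\<le>k. \<Sum>j\<in>{i<..k}. if i = l then E j else 0) = (\<Sum>i\<le>k. if i = l then (\<Sum>j\<in>{i<..k}. E j) else 0)"
      by (intro sum.cong) auto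
    also have "\<dots> = (\<Sum>j\<in>{l<..k}. E j)" using l by simp
    also have "\<dots> = (\<Sum>j\<le>k. if l < j then E j else 0)"
      by (rule sum.mono_neutral_cong_left) auto
    finally show ?thesis .
  qed
  moreover have "(\<Sum>i\<le>k. if i = l then 0 else E i) = (\<Sum>i\<le>k. if i < l then E i else 0) + (\<Sum>i\<le>k. if l < i then E i else 0)"
    unfolding sum.distrib[symmetric] by (intro sum.cong) auto
  ultimately show ?thesis unfolding D_def TS BS by (simp add: algebra_simps del: fun_upd_apply)
qed

text \<open>Both sides are multilinear on tuples from \<open>Fmod\<close>, so it suffices to compare
  them on the frame, where all brackets vanish. Multilinearity of \<open>dF k \<alpha>\<close> is
  supplied by \<open>cartan_slot\<close>.\<close>

lemma dF_eq_form:
  fixes \<alpha> :: "'n::finite form"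
  assumes \<alpha>: "\<alpha> \<in> Omega k" and k: "k < CARD('n)"
  shows "dF k \<alpha> = form_of (Suc k) (delta k (coords \<alpha>))"
proof -
  have loc: "depends_below k \<alpha>" using Omega_multilin[OF \<alpha>] by (simp add: multilin_def)
  have "depends_below (Suc k) (dF k \<alpha>)" unfolding depends_below_def
  proof (intro allI impI)
    fix Y Y' :: "nat \<Rightarrow> 'n pt \<Rightarrow> 'n pt" assume eq: "\<forall>m<Suc k. Y m = Y' m"
    have "args_in_F (Suc k) Y = args_in_F (Suc k) Y'" by (rule localD[OF depends_below_args_in_F]) (use eq in blast)
    moreover have "\<alpha> (omit i Y) = \<alpha> (omit i Y')" if "i \<le> k" for i
      by (rule localD[OF loc]) (use eq that in \<open>auto simp: omit_def\<close>)
    moreover have "\<alpha> (prepend (lie_bracket (Y i) (Y j)) (omit i (omit j Y))) =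
        \<alpha> (prepend (lie_bracket (Y' i) (Y' j)) (omit i (omit j Y')))" if "i < j" "j \<le> k" for i j
      by (rule localD[OF loc]) (use eq that in \<open>auto simp: omit_def prepend_def split: nat.splits\<close>)
    ultimately show "dF k \<alpha> Y = dF k \<alpha> Y'" using eq unfolding dF_def by (auto intro!: ext arg_cong2[of _ _ _ _ "(+)"] sum.cong)
  qed
  then have m: "multilin (Suc k) (dF k \<alpha>)" unfolding multilin_def
  proof (intro conjI allI impI)
    fix Y :: "nat \<Rightarrow> 'n pt \<Rightarrow> 'n pt" and l and f g :: "'n pt \<Rightarrow> real" and V W :: "'n pt \<Rightarrow> 'n pt"
    let ?U = "\<lambda>p. f p *\<^sub>R V p + g p *\<^sub>R W p"
    assume "args_in_F (Suc k) Y \<and> l < Suc k \<and> smooth f \<and> smooth g \<and> V \<in> Fmod \<and> W \<in> Fmod"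
    then have Y: "args_in_F (Suc k) Y" "l \<le> k" and fg: "smooth f" "smooth g" and VW: "V \<in> Fmod" "W \<in> Fmod" by auto
    have "args_in_F (Suc k) (Y(l := ?U))" "args_in_F (Suc k) (Y(l := V))" "args_in_F (Suc k) (Y(l := W))"
      by (intro args_in_F_upd Y VW lincomb_in_Fmod fg)+
    with k show "dF k \<alpha> (Y(l := ?U)) = (\<lambda>p. f p * dF k \<alpha> (Y(l := V)) p + g p * dF k \<alpha> (Y(l := W)) p)"
      unfolding dF_def using cartan_slot[OF \<alpha> Y fg VW] by (simp only: simp_thms if_True)
  qed
  have "coords (dF k \<alpha>) js p = delta k (coords \<alpha>) js p" for js p
  proof -
    have o: "omit i (\<lambda>m. Xvf (js m)) = (\<lambda>m. Xvf (omit i js m))" for i and js :: "nat \<Rightarrow> 'n"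
      by (simp add: omit_def fun_eq_iff)
    \<comment> \<open>For k = 0 the double sum is empty, so a first slot for the zero bracket exists
      whenever it is needed.\<close>
    have "\<alpha> (prepend (\<lambda>p. 0) (\<lambda>m. Xvf (js m))) p = 0" if "0 < k" for p and js :: "nat \<Rightarrow> 'n"
      using multilin_zero_slot[OF Omega_multilin[OF \<alpha>] args_in_F_Xvf that, of "prepend undefined js" p]
      by (simp add: fun_upd_0_eq_prepend omit_def del: fun_upd_apply)
    then have "(\<Sum>i\<le>k. \<Sum>j\<in>{i<..k}. (-1)^(i+j) *
       \<alpha> (prepend (lie_bracket (Xvf (js i)) (Xvf (js j))) (omit i (omit j (\<lambda>m. Xvf (js m))))) p) = 0"
      by (intro sum.neutral ballI) (simp add: lie_bracket_Xvf o)
    then show ?thesis using k by (simp add: coords_def dF_def delta_def o)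
  qed
  then have c: "coords (dF k \<alpha>) = delta k (coords \<alpha>)" by (intro ext)
  show ?thesis
  proof
    fix Y
    show "dF k \<alpha> Y = form_of (Suc k) (delta k (coords \<alpha>)) Y"
    proof (cases "args_in_F (Suc k) Y")
      case True
      have "dF k \<alpha> Y = frame_expansion (Suc k) (coords (dF k \<alpha>)) Y"
        using multilin_eq_frame_expansion[OF m True] unfolding coords_def[abs_def] .
      then show ?thesis unfolding c form_of_def using True by simp
    qed (simp add: form_of_def dF_def)
  qed
qed

lemma form_zero: "form_of k (\<lambda>js p. 0) = zero_form"
proof -
  have "frame_expansion k (\<lambda>js p. 0) Y p = 0" for Y :: "nat \<Rightarrow> 'a pt \<Rightarrow> 'a pt" and p
    using frame_expansion_cmult[of k 0 "\<lambda>js p. 0" Y p] by simp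
  then show ?thesis by (simp add: form_of_def zero_form_def fun_eq_iff)
qed

lemma cochain_zero: "cochain k (\<lambda>js p. 0)"
  by (simp add: cochain_def depends_below_def antisym_swap_def)

lemma cochain_lincomb:
  fixes a b :: "(nat \<Rightarrow> 'n::finite) \<Rightarrow> 'n pt \<Rightarrow> real"
  assumes a: "cochain k a" and b: "cochain k b" and that: "smooth f" "smooth g"
  shows "cochain k (\<lambda>js p. f p * a js p + g p * b js p)"
  unfolding cochain_def
proof (intro conjI allI)
  show "depends_below k (\<lambda>js p. f p * a js p + g p * b js p)" unfolding depends_below_def
  proof (intro allI impI ext)
    fix z z' :: "nat \<Rightarrow> 'n" and p assume "\<forall>m<k. z m = z' m"
    then have "a z = a z'" "b z = b z'" using a b unfolding cochain_def depends_below_def by blast+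
    then show "f p * a z p + g p * b z p = f p * a z' p + g p * b z' p" by simp
  qed
  show "smooth (\<lambda>p. f p * a js p + g p * b js p)" for js
    by (intro smooth_add smooth_mult that smooth_cochain[OF a] smooth_cochain[OF b])
  show "antisym_swap k (\<lambda>js. f p * a js p + g p * b js p)" for p unfolding antisym_swap_def
  proof (intro allI impI)
    fix z m assume "Suc m < k"
    then have "a (swap_adj m z) p = - a z p" "b (swap_adj m z) p = - b z p"
      using a b unfolding cochain_def antisym_swap_def by blast+
    then show "f p * a (swap_adj m z) p + g p * b (swap_adj m z) p = - (f p * a z p + g p * b z p)" by simp
  qed
qed

lemma cochain_add: "cochain k a \<Longrightarrow> cochain k b \<Longrightarrow> cochain k (\<lambda>js p. a js p + b js p)"
  using cochain_lincomb[OF _ _ smooth_const[of 1] smooth_const[of 1], of k a b] by simp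

lemma form_add_form: "form_add (form_of k a) (form_of k b) = form_of k (\<lambda>js p. a js p + b js p)"
  by (simp add: form_add_def form_of_def frame_expansion_add fun_eq_iff)

lemma delta_add:
  assumes "\<And>js. smooth (a js)" "\<And>js. smooth (b js)"
  shows "delta k (\<lambda>js p. a js p + b js p) = (\<lambda>js p. delta k a js p + delta k b js p)"
  by (simp add: delta_def fun_eq_iff vf_apply_add assms ring_distribs sum.distrib)

lemma delta_diff:
  assumes "\<And>js. smooth (a js)" "\<And>js. smooth (b js)"
  shows "delta k (\<lambda>js p. a js p - b js p) = (\<lambda>js p. delta k a js p - delta k b js p)"
proof -
  have "smooth (\<lambda>p. - b js p)" for js by (rule smooth_minus[OF assms(2)])
  from delta_add[of a "\<lambda>js p. - b js p", OF assms(1) this]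
  show ?thesis by (simp add: delta_def fun_eq_iff vf_apply_minus assms sum_negf)
qed

lemma delta_of_invariant: "(\<And>i js. lx i (a js) = (\<lambda>p. 0)) \<Longrightarrow> delta k a = (\<lambda>js p. 0)"
  by (simp add: delta_def fun_eq_iff)

section \<open>Contraction, Cartan's identity and the square of the differential\<close>

lemma cochain_prepend:
  assumes "cochain (Suc k) a"
  shows "cochain k (\<lambda>js. a (prepend i js))"
  unfolding cochain_def
proof (intro conjI allI)
  show "depends_below k (\<lambda>js. a (prepend i js))" by (rule depends_below_prepend) (use assms in \<open>simp add: cochain_def\<close>)
  show "smooth (a (prepend i js))" for js using assms by (simp add: cochain_def)
  have "antisym_swap (Suc k) (\<lambda>js. a js p)" for p using assms unfolding cochain_def by blast
  then show "antisym_swap k (\<lambda>js. a (prepend i js) p)" for p by (rule antisym_swap_prepend)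
qed

text \<open>The summand of index 0 is X_i applied to \<open>a\<close>; the other indices shift by
  one and change sign, which produces the differential of the contraction.\<close>

lemma delta_prepend:
  "delta (Suc k) a (prepend i js) = (\<lambda>p. lx i (a js) p - delta k (\<lambda>js. a (prepend i js)) js p)"
  by (simp add: delta_def fun_eq_iff sum.atMost_Suc_shift omit_Suc_prepend sum_negf del: sum.atMost_Suc)

lemma lx_delta: "(\<And>js. smooth (a js)) \<Longrightarrow> lx i (delta k a js) = delta k (\<lambda>js. lx i (a js)) js"
  by (simp add: delta_def[abs_def] vf_apply_sum vf_apply_cmult smooth_cmult smooth_lx lx_commute[of _ i])

text \<open>Contraction with \<open>X\<^sub>i\<close> turns the claim into the one in lower degree, by the Cartan
  identity \<open>delta_prepend\<close>.\<close>
lemma delta_delta: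
  fixes a :: "(nat \<Rightarrow> 'n::finite) \<Rightarrow> 'n pt \<Rightarrow> real"
  shows "cochain k a \<Longrightarrow> delta (Suc k) (delta k a) = (\<lambda>js p. 0)"
proof (induction k arbitrary: a)
  case 0
  have a: "a js = a js'" for js js' by (rule localD[of 0 a]) (use 0 in \<open>simp_all add: cochain_def\<close>)
  show ?case
  proof (intro ext)
    fix js :: "nat \<Rightarrow> 'n" and p
    have "delta 0 a z = lx (z 0) (a js)" for z
      by (simp add: delta_def fun_eq_iff a[of "omit 0 z" js])
    moreover have "lx (js 0) (lx (js (Suc 0)) (a js)) = lx (js (Suc 0)) (lx (js 0) (a js))"
      by (rule lx_commute[OF smooth_cochain[OF 0]])
    moreover have "omit 0 js 0 = js (Suc 0)" "omit (Suc 0) js 0 = js 0" by (simp_all add: omit_def)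
    ultimately show "delta (Suc 0) (delta 0 a) js p = 0"
      by (simp add: delta_def[of "Suc 0"])
  qed
next
  case (Suc k)
  show ?case
  proof
    fix js :: "nat \<Rightarrow> 'n"
    let ?i = "js 0" and ?z = "omit 0 js"
    note s = smooth_cochain[OF Suc.prems]
    note c = cochain_prepend[OF Suc.prems, of ?i]
    have "delta (Suc (Suc k)) (delta (Suc k) a) (prepend ?i ?z) = (\<lambda>p. lx ?i (delta (Suc k) a ?z) p -
       delta (Suc k) (\<lambda>js p. lx ?i (a js) p - delta k (\<lambda>js. a (prepend ?i js)) js p) ?z p)"
      unfolding delta_prepend ..
    also have "\<dots> = (\<lambda>p. 0)"
      by (simp add: delta_diff smooth_lx s smooth_cochain[OF cochain_delta[OF c]] Suc.IH[OF c] lx_delta[OF s])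
    finally show "delta (Suc (Suc k)) (delta (Suc k) a) js = (\<lambda>p. 0)" by simp
  qed
qed

text \<open>In degrees k >= n the definition sets \<open>dF\<close> to zero; \<open>delta\<close>
  vanishes there as well, since more than n frame indices must repeat. Hence one criterion serves
  all degrees.\<close>

lemma closed_forms_iff:
  fixes \<alpha> :: "'n::finite form"
  shows "\<alpha> \<in> closed_forms k \<longleftrightarrow> \<alpha> \<in> Omega k \<and> delta k (coords \<alpha>) = (\<lambda>js p. 0)"
proof (cases "\<alpha> \<in> Omega k")
  case True
  note c = cochain_delta[OF cochain_coords[OF True]]
  show ?thesis
  proof (cases "k < CARD('n)")
    case k: True
    have "form_of (Suc k) (delta k (coords \<alpha>)) = zero_form \<longleftrightarrow> delta k (coords \<alpha>) = (\<lambda>js p. 0)"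
    proof
      assume "form_of (Suc k) (delta k (coords \<alpha>)) = zero_form"
      then have "coords (form_of (Suc k) (delta k (coords \<alpha>))) = (\<lambda>js p. 0)"
        by (simp add: coords_def[abs_def] zero_form_def)
      then show "delta k (coords \<alpha>) = (\<lambda>js p. 0)" by (simp add: coords_form[OF c])
    qed (simp add: form_zero)
    then show ?thesis using True by (simp add: closed_forms_def dF_eq_form[OF True k])
  next
    case False
    have "delta k (coords \<alpha>) js p = 0" for js p
    proof -
      have "\<not> inj_on js {..<Suc k}"
        using False card_mono[OF finite, of "js ` {..<Suc k}" UNIV] by (auto dest!: card_image)
      then obtain x y where "x < Suc k" "y < Suc k" "js x = js y" "x \<noteq> y"
        unfolding inj_on_def by auto
      then have "\<exists>i j. i < j \<and> j < Suc k \<and> js i = js j"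
        by (cases "x < y") (metis, metis linorder_neqE_nat)
      then obtain i j where "i < j" "j < Suc k" "js i = js j" by blast
      moreover have "antisym_swap (Suc k) (\<lambda>js. delta k (coords \<alpha>) js p)" using c unfolding cochain_def by blast
      ultimately show ?thesis by (intro antisym_swap_eq_0)
    qed
    moreover have "dF k \<alpha> = zero_form" using False by (simp add: dF_def zero_form_def fun_eq_iff)
    ultimately show ?thesis using True by (simp add: closed_forms_def fun_eq_iff)
  qed
qed (simp add: closed_forms_def)

lemma exact_forms_Suc:
  fixes \<alpha> :: "'n::finite form"
  assumes k: "k < CARD('n)"
  shows "\<alpha> \<in> exact_forms (Suc k) \<longleftrightarrow> (\<exists>b. cochain k b \<and> \<alpha> = form_of (Suc k) (delta k b))"
proof
  assume "\<alpha> \<in> exact_forms (Suc k)"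
  then obtain \<beta> where \<beta>: "\<beta> \<in> Omega k" "\<alpha> = dF k \<beta>" by (auto simp: exact_forms_def)
  then show "\<exists>b. cochain k b \<and> \<alpha> = form_of (Suc k) (delta k b)"
    using dF_eq_form[OF \<beta>(1) k] cochain_coords[OF \<beta>(1)] by (intro exI[of _ "coords \<beta>"]) simp
next
  assume "\<exists>b. cochain k b \<and> \<alpha> = form_of (Suc k) (delta k b)"
  then obtain b where b: "cochain k b" "\<alpha> = form_of (Suc k) (delta k b)" by blast
  then have "\<alpha> = dF k (form_of k b)" by (simp add: dF_eq_form[OF form_in_Omega k] coords_form)
  then show "\<alpha> \<in> exact_forms (Suc k)" using form_in_Omega[OF b(1)] by (simp add: exact_forms_def)
qed

lemma Wforms_iff: "\<alpha> \<in> Wforms k \<longleftrightarrow> \<alpha> \<in> Omega k \<and> (\<forall>i js. lx i (coords \<alpha> js) = (\<lambda>p. 0))"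
  by (simp add: Wforms_def coords_def)

subsection \<open>Averaging over the torus\<close>

definition avg_list :: "'n::finite list \<Rightarrow> ('n pt \<Rightarrow> real) \<Rightarrow> 'n pt \<Rightarrow> real" where
  "avg_list xs f = foldr avg xs f"

lemma avg_list_simps [simp]: "avg_list [] f = f" "avg_list (x # xs) f = avg x (avg_list xs f)"
  by (simp_all add: avg_list_def)

lemma smooth_avg_list: "smooth f \<Longrightarrow> smooth (avg_list xs f)"
  by (induction xs) (auto intro: smooth_avg)

lemma avg_list_add: "smooth f \<Longrightarrow> smooth g \<Longrightarrow> avg_list xs (\<lambda>p. f p + g p) = (\<lambda>p. avg_list xs f p + avg_list xs g p)"
  by (induction xs) (simp_all add: avg_add smooth_avg_list)

lemma avg_list_cmult: "avg_list xs (\<lambda>p. c * f p) = (\<lambda>p. c * avg_list xs f p)"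
  by (induction xs) (simp_all add: avg_cmult)

lemma lx_avg_list: "smooth f \<Longrightarrow> lx j (avg_list xs f) = avg_list xs (lx j f)"
  by (induction xs) (simp_all add: lx_avg smooth_avg_list)

lemma avg_zero: "avg i (\<lambda>p. 0) = (\<lambda>p. 0)"
  using avg_cmult[of i 0 "\<lambda>p. 0"] by simp

lemma homotopy_prim_zero: "homotopy_prim i (\<lambda>p. 0) = (\<lambda>p. 0)"
  using homotopy_prim_cmult[of i 0 "\<lambda>p. 0"] by simp

text \<open>\<open>lx j\<close> passes through the outer averages until it meets
  \<open>avg j\<close>, which annihilates it.\<close>

lemma lx_avg_list_zero: "smooth f \<Longrightarrow> j \<in> set xs \<Longrightarrow> lx j (avg_list xs f) = (\<lambda>p. 0)"
  by (induction xs) (auto simp: lx_avg smooth_avg_list avg_lx avg_zero)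

lemma avg_list_invariant:
  assumes "smooth f" "\<And>i. lx i f = (\<lambda>p. 0)"
  shows "avg_list xs f = f"
proof (induction xs)
  case (Cons x xs)
  have "avg x f = f"
    using homotopy_prim_lx[OF assms(1), of x] by (simp add: assms(2) homotopy_prim_zero fun_eq_iff)
  then show ?case using Cons by simp
qed simp

lemma cochain_map:
  assumes a: "cochain k a" and T: "\<And>f. smooth f \<Longrightarrow> smooth (T f)" "\<And>c f. T (\<lambda>p. c * f p) = (\<lambda>p. c * T f p)"
  shows "cochain k (\<lambda>js. T (a js))"
  unfolding cochain_def
proof (intro conjI allI)
  have "depends_below k a" using a by (simp add: cochain_def)
  then show "depends_below k (\<lambda>js. T (a js))" unfolding depends_below_def by (intro allI impI arg_cong[where f = T]) simp
  show "smooth (T (a js))" for js by (rule T(1)[OF smooth_cochain[OF a]])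
  show "antisym_swap k (\<lambda>js. T (a js) p)" for p unfolding antisym_swap_def
  proof (intro allI impI)
    fix z m assume "Suc m < k"
    then have "a (swap_adj m z) p = - a z p" for p using a unfolding cochain_def antisym_swap_def by blast
    then have "a (swap_adj m z) = (\<lambda>p. -1 * a z p)" by (simp add: fun_eq_iff)
    then have "T (a (swap_adj m z)) p = -1 * T (a z) p" by (simp only: T(2))
    then show "T (a (swap_adj m z)) p = - T (a z) p" by simp
  qed
qed

text \<open>A linear operator commuting with every \<open>lx i\<close> acts on coefficients as a
  cochain map. The instances are the homotopy operator, the iterated averages and the torus
  average.\<close>

lemma delta_map:
  assumes a: "\<And>js. smooth (a js)" and T: "\<And>c f. T (\<lambda>p. c * f p) = (\<lambda>p. c * T f p)"
    "\<And>f g. smooth f \<Longrightarrow> smooth g \<Longrightarrow> T (\<lambda>p. f p + g p) = (\<lambda>p. T f p + T g p)"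
    "\<And>i f. smooth f \<Longrightarrow> lx i (T f) = T (lx i f)"
  shows "delta k (\<lambda>js. T (a js)) js = T (delta k a js)"
proof -
  have 0: "T (\<lambda>p. 0) = (\<lambda>p. 0)" using T(1)[of 0 "\<lambda>p. 0"] by simp
  have "T (\<lambda>p. \<Sum>i\<in>I. f i p) = (\<lambda>p. \<Sum>i\<in>I. T (f i) p)" if "finite I" "\<And>i. smooth (f i)" for I :: "nat set" and f
    using that(1) by induction (simp_all add: 0 T(2) that(2) smooth_sum)
  from this[of "{..k}" "\<lambda>i p. (-1)^i * lx (js i) (a (omit i js)) p"]
  show ?thesis by (simp add: delta_def[abs_def] T(1,3) a smooth_cmult smooth_lx)
qed

text \<open>The primitive is the homotopy operator applied to the contraction. For closed
  \<open>a\<close> Cartan's identity says that the differential of the contraction is X_i a.\<close>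

lemma closed_minus_avg:
  assumes a: "cochain (Suc k) a" "delta (Suc k) a = (\<lambda>js p. 0)"
  shows "\<exists>b. cochain k b \<and> delta k b = (\<lambda>js p. a js p - avg i (a js) p)"
proof (intro exI conjI)
  let ?b = "\<lambda>js. homotopy_prim i (a (prepend i js))"
  note c = cochain_prepend[OF a(1), of i]
  show "cochain k ?b" by (rule cochain_map[where T = "homotopy_prim i", OF c]) (simp_all add: smooth_homotopy_prim homotopy_prim_cmult)
  show "delta k ?b = (\<lambda>js p. a js p - avg i (a js) p)"
  proof
    fix js
    have "(\<lambda>p. lx i (a js) p - delta k (\<lambda>js. a (prepend i js)) js p) = (\<lambda>p. 0)"
      using delta_prepend[of k a i js] a(2) by simp
    then have "delta k (\<lambda>js. a (prepend i js)) js = lx i (a js)" by (simp add: fun_eq_iff)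
    moreover have "delta k ?b js = homotopy_prim i (delta k (\<lambda>js. a (prepend i js)) js)"
      by (rule delta_map[where T = "homotopy_prim i" and a = "\<lambda>js. a (prepend i js)"])
        (simp_all add: smooth_cochain[OF c] homotopy_prim_cmult homotopy_prim_add lx_homotopy_prim)
    ultimately show "delta k ?b js = (\<lambda>p. a js p - avg i (a js) p)"
      by (simp add: homotopy_prim_lx[OF smooth_cochain[OF a(1)]])
  qed
qed

text \<open>Telescoping: the averaged family is closed again, and averaging it over one more circle
  changes it by another exact family.\<close>

lemma closed_minus_avg_list:
  assumes a: "cochain (Suc k) a" "delta (Suc k) a = (\<lambda>js p. 0)"
  shows "\<exists>b. cochain k b \<and> delta k b = (\<lambda>js p. a js p - avg_list xs (a js) p)"
proof (induction xs)
  case Nil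
  have "delta k (\<lambda>js p. 0) = (\<lambda>js p. 0)" by (rule delta_of_invariant) simp
  then show ?case by (intro exI[of _ "\<lambda>js p. 0"] conjI cochain_zero) simp
next
  case (Cons x xs)
  from Cons.IH obtain b where b: "cochain k b" "delta k b = (\<lambda>js p. a js p - avg_list xs (a js) p)"
    by (elim exE conjE) (rule that)
  have d: "delta (Suc k) (\<lambda>js. avg_list xs (a js)) js = (\<lambda>p. 0)" for js
  proof -
    have "delta (Suc k) (\<lambda>js. avg_list xs (a js)) js = avg_list xs (delta (Suc k) a js)"
      by (rule delta_map[where T = "avg_list xs" and a = a])
        (simp_all add: smooth_cochain[OF a(1)] avg_list_cmult avg_list_add lx_avg_list)
    then show ?thesis using avg_list_cmult[of xs 0 "\<lambda>p. 0"] by (simp add: a(2))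
  qed
  have cc: "cochain (Suc k) (\<lambda>js. avg_list xs (a js))"
    by (rule cochain_map[where T = "avg_list xs", OF a(1)]) (simp_all add: smooth_avg_list avg_list_cmult)
  obtain c where c: "cochain k c" "delta k c = (\<lambda>js p. avg_list xs (a js) p - avg x (avg_list xs (a js)) p)"
    using closed_minus_avg[OF cc ext[OF d], of x] by (elim exE conjE) (rule that)
  have "delta k (\<lambda>js p. b js p + c js p) = (\<lambda>js p. a js p - avg_list (x # xs) (a js) p)"
    unfolding delta_add[OF smooth_cochain[OF b(1)] smooth_cochain[OF c(1)]] b(2) c(2) by simp
  then show ?case by (intro exI[of _ "\<lambda>js p. b js p + c js p"] conjI cochain_add b(1) c(1))
qed

text \<open>Any list exhausting the indices serves; the facts about \<open>avg_list\<close> applied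
  to it involve only which indices occur.\<close>

definition torus_avg :: "('n::finite pt \<Rightarrow> real) \<Rightarrow> 'n pt \<Rightarrow> real" where
  "torus_avg = avg_list (SOME xs. set xs = UNIV)"

lemma set_torus_avg: "set (SOME xs. set xs = (UNIV :: 'n::finite set)) = UNIV"
  by (rule someI_ex) (rule finite_list[OF finite])

lemma smooth_torus_avg: "smooth f \<Longrightarrow> smooth (torus_avg f)"
  unfolding torus_avg_def by (rule smooth_avg_list)

lemma torus_avg_add: "smooth f \<Longrightarrow> smooth g \<Longrightarrow> torus_avg (\<lambda>p. f p + g p) = (\<lambda>p. torus_avg f p + torus_avg g p)"
  unfolding torus_avg_def by (rule avg_list_add)

lemma torus_avg_cmult: "torus_avg (\<lambda>p. c * f p) = (\<lambda>p. c * torus_avg f p)"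
  unfolding torus_avg_def by (rule avg_list_cmult)

lemma lx_torus_avg_commute: "smooth f \<Longrightarrow> lx j (torus_avg f) = torus_avg (lx j f)"
  unfolding torus_avg_def by (rule lx_avg_list)

lemma lx_torus_avg: "smooth f \<Longrightarrow> lx j (torus_avg f) = (\<lambda>p. 0)"
  unfolding torus_avg_def by (rule lx_avg_list_zero) (simp_all add: set_torus_avg)

lemma torus_avg_delta:
  assumes "\<And>js. smooth (a js)"
  shows "torus_avg (delta k a js) = (\<lambda>p. 0)"
proof -
  have "torus_avg (delta k a js) = delta k (\<lambda>js. torus_avg (a js)) js"
    by (rule delta_map[where T = torus_avg and a = a, symmetric])
      (simp_all add: assms torus_avg_cmult torus_avg_add lx_torus_avg_commute)
  then show ?thesis by (simp add: delta_of_invariant lx_torus_avg assms)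
qed

lemma torus_avg_invariant: "smooth f \<Longrightarrow> (\<And>i. lx i f = (\<lambda>p. 0)) \<Longrightarrow> torus_avg f = f"
  unfolding torus_avg_def by (rule avg_list_invariant)

lemma cochain_torus_avg: "cochain k a \<Longrightarrow> cochain k (\<lambda>js. torus_avg (a js))"
  by (rule cochain_map[where T = torus_avg]) (simp_all add: smooth_torus_avg torus_avg_cmult)

subsection \<open>The cohomology\<close>

text \<open>The index type carries no order, so an arbitrary enumeration replaces the increasing
  one. Another choice changes a coefficient by a sign only.\<close>

definition enum :: "'a::finite set \<Rightarrow> nat \<Rightarrow> 'a" where
  "enum J = (SOME e. bij_betw e {..<card J} J)"

lemma bij_betw_enum: "bij_betw (enum J) {..<card J} J"
proof -
  have "\<exists>e. bij_betw e {..<card J} J"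
    using ex_bij_betw_nat_finite[OF finite[of J]] by (simp add: atLeast0LessThan)
  then show ?thesis unfolding enum_def by (rule someI_ex)
qed

lemma dual_cochain_enum: "card J = k \<Longrightarrow> card J' = k \<Longrightarrow> dual_cochain k (enum J') (enum J) = (if J' = J then 1 else 0)"
  for J J' :: "'a::finite set"
proof (cases "J' = J")
  case False
  assume k: "card J = k" "card J' = k"
  have im: "enum J ` {..<k} = J" "enum J' ` {..<k} = J'"
    using bij_betw_enum[of J] bij_betw_enum[of J'] k by (auto simp: bij_betw_def)
  have "dual_cochain k (enum J') (enum J) = 0"
  proof (rule ccontr)
    assume "dual_cochain k (enum J') (enum J) \<noteq> 0"
    from dual_cochain_nonzero_image[OF this] have "J' \<subseteq> J" unfolding im .
    then have "J' = J" using k by (intro card_subset_eq) auto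
    with False show False ..
  qed
  then show ?thesis using False by simp
qed (use bij_betw_enum[of J] in \<open>auto simp: bij_betw_def intro: dual_cochain_self\<close>)

text \<open>Tuples with a repeated index give zero, and any other tuple has the same entries as the
  enumeration of its image.\<close>

lemma cochain_zero_of_enum:
  assumes a: "cochain k a" and 0: "\<And>J. card J = k \<Longrightarrow> a (enum J) = (\<lambda>p. 0)"
  shows "a = (\<lambda>js p. 0)"
proof (intro ext)
  fix js :: "nat \<Rightarrow> 'a" and p
  have l: "depends_below k (\<lambda>js. a js p)" and antisym_swap: "antisym_swap k (\<lambda>js. a js p)"
    using a unfolding cochain_def depends_below_def by (metis, metis)
  show "a js p = 0"
  proof (cases "inj_on js {..<k}")
    case True
    let ?J = "js ` {..<k}"
    have c: "card ?J = k" using True by (simp add: card_image)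
    show ?thesis
    proof (rule antisym_swap_eq_0_of_same_image[OF l antisym_swap _ True])
      show "inj_on (enum ?J) {..<k}" "enum ?J ` {..<k} = js ` {..<k}"
        using bij_betw_enum[of ?J] c by (auto simp: bij_betw_def)
      show "a (enum ?J) p = 0" using 0[OF c] by simp
    qed
  next
    case False
    then obtain i j where "i < k" "j < k" "i \<noteq> j" "js i = js j" unfolding inj_on_def by auto
    then show ?thesis
      using antisym_swap_eq_0[OF antisym_swap, of js i j] antisym_swap_eq_0[OF antisym_swap, of js j i] by (cases "i < j") auto
  qed
qed

lemma cochain_dual_cochain_sum:
  fixes u :: "'n::finite set \<Rightarrow> 'n pt \<Rightarrow> real"
  assumes "\<And>J. J \<in> S \<Longrightarrow> smooth (u J)"
  shows "cochain k (\<lambda>js p. \<Sum>J\<in>S. dual_cochain k (enum J) js * u J p)"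
  unfolding cochain_def
proof (intro conjI allI)
  show "depends_below k (\<lambda>js p. \<Sum>J\<in>S. dual_cochain k (enum J) js * u J p)" unfolding depends_below_def
  proof (intro allI impI ext)
    fix z z' :: "nat \<Rightarrow> 'n" and p assume "\<forall>m<k. z m = z' m"
    then have "dual_cochain k (enum J) z = dual_cochain k (enum J) z'" for J by (intro localD[OF depends_below_dual_cochain]) simp
    then show "(\<Sum>J\<in>S. dual_cochain k (enum J) z * u J p) = (\<Sum>J\<in>S. dual_cochain k (enum J) z' * u J p)" by simp
  qed
  show "smooth (\<lambda>p. \<Sum>J\<in>S. dual_cochain k (enum J) js * u J p)" for js
    by (intro smooth_sum smooth_cmult assms)
  show "antisym_swap k (\<lambda>js. \<Sum>J\<in>S. dual_cochain k (enum J) js * u J p)" for p unfolding antisym_swap_def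
  proof (intro allI impI)
    fix z :: "nat \<Rightarrow> 'n" and m assume "Suc m < k"
    then have "dual_cochain k e (swap_adj m z) = - dual_cochain k e z" for e using antisym_swap_dual_cochain[of k e] unfolding antisym_swap_def by blast
    then show "(\<Sum>J\<in>S. dual_cochain k (enum J) (swap_adj m z) * u J p) = - (\<Sum>J\<in>S. dual_cochain k (enum J) z * u J p)"
      by (simp add: sum_negf)
  qed
qed

text \<open>The factor \<open>\<Prod>\<^bsub>j\<in>J\<^esub> h\<^sub>j\<close> identifies the invariant functions with the invariant functions
  that vanish on \<open>\<Union>\<^bsub>j\<in>J\<^esub> \<Sigma>\<^sub>j\<close>.\<close>
definition cohom_map :: "nat \<Rightarrow> ('n::finite) form \<Rightarrow> 'n set \<Rightarrow> 'n pt \<Rightarrow> real" where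
  "cohom_map k \<alpha> J = (if card J = k then (\<lambda>p. (\<Prod>j\<in>J. hfun j p) * torus_avg (coords \<alpha> (enum J)) p) else (\<lambda>p. 0))"

lemma cohom_map_in_direct_sum:
  assumes "\<alpha> \<in> Omega k"
  shows "cohom_map k \<alpha> \<in> direct_sum k"
proof -
  have "(\<lambda>p. (\<Prod>j\<in>J. hfun j p) * torus_avg (coords \<alpha> (enum J)) p) \<in> summand J" for J
  proof -
    have s: "smooth (coords \<alpha> (enum J))" by (rule smooth_cochain[OF cochain_coords[OF assms]])
    have "smooth (\<lambda>p. (\<Prod>j\<in>J. hfun j p) * torus_avg (coords \<alpha> (enum J)) p)"
      by (intro smooth_mult smooth_prod smooth_hfun smooth_torus_avg s)
    moreover obtain f where "\<And>p. torus_avg (coords \<alpha> (enum J)) p = f (hvec p)"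
      using torus_invariant_iff[OF smooth_torus_avg[OF s]] lx_torus_avg[OF s] by blast
    then have "(\<Prod>j\<in>J. hfun j p) * torus_avg (coords \<alpha> (enum J)) p = (\<lambda>v. (\<Prod>j\<in>J. v $ j) * f v) (hvec p)" for p
      by (simp add: hvec_def)
    then have "\<exists>f. \<forall>p. (\<Prod>j\<in>J. hfun j p) * torus_avg (coords \<alpha> (enum J)) p = f (hvec p)"
      by (intro exI[of _ "\<lambda>v. (\<Prod>j\<in>J. v $ j) * f v"] allI)
    moreover have "(\<Prod>j\<in>J. hfun j p) = 0" if "p \<in> (\<Union>j\<in>J. Sigma_set j)" for p
      using that by (auto simp: hfun_eq_0_iff)
    ultimately show ?thesis by (auto simp: summand_def)
  qed
  then show ?thesis by (simp add: direct_sum_def cohom_map_def)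
qed

text \<open>Each component is divided by its product of h_j, and the invariant quotients are glued
  along the dual cochains. The resulting coefficients are invariant, which makes the form
  closed.\<close>

lemma direct_sum_subset_cohom_map: "direct_sum k \<subseteq> cohom_map k ` closed_forms k"
proof
  fix \<phi> :: "'n::finite set \<Rightarrow> 'n pt \<Rightarrow> real" assume \<phi>: "\<phi> \<in> direct_sum k"
  let ?S = "{J :: 'n set. card J = k}"
  define R where "R J u \<longleftrightarrow> smooth u \<and> (\<forall>i. lx i u = (\<lambda>p. 0)) \<and> (\<forall>p. \<phi> J p = (\<Prod>j\<in>J. hfun j p) * u p)" for J u
  have ex: "\<exists>u. R J u" if "J \<in> ?S" for J
    unfolding R_def
  proof (rule divisible_by_hfun_prod)
    have *: "\<phi> J \<in> summand J" using \<phi> that by (simp add: direct_sum_def)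
    show s: "smooth (\<phi> J)" using * by (simp add: summand_def)
    show "lx i (\<phi> J) = (\<lambda>p. 0)" for i
      using * torus_invariant_iff[OF s] by (simp add: summand_def)
    show "\<phi> J p = 0" if "j \<in> J" "p \<in> Sigma_set j" for j p
      using * that by (auto simp: summand_def)
  qed simp
  define u where "u J = (SOME u. R J u)" for J
  have "R J (u J)" if "J \<in> ?S" for J unfolding u_def by (rule someI_ex[OF ex[OF that]])
  then have u: "\<And>J. J \<in> ?S \<Longrightarrow> smooth (u J)" "\<And>J i. J \<in> ?S \<Longrightarrow> lx i (u J) = (\<lambda>p. 0)"
    "\<And>J p. J \<in> ?S \<Longrightarrow> \<phi> J p = (\<Prod>j\<in>J. hfun j p) * u J p" unfolding R_def by blast+
  define w where "w js p = (\<Sum>J\<in>?S. dual_cochain k (enum J) js * u J p)" for js p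
  have w: "cochain k w" unfolding w_def[abs_def] by (rule cochain_dual_cochain_sum[OF u(1)])
  have inv: "lx i (w js) = (\<lambda>p. 0)" for i js
  proof -
    have "lx i (w js) = (\<lambda>p. \<Sum>J\<in>?S. lx i (\<lambda>p. dual_cochain k (enum J) js * u J p) p)"
      unfolding w_def[abs_def] by (rule vf_apply_sum) (rule smooth_cmult[OF u(1)])
    also have "\<dots> = (\<lambda>p. 0)"
      by (intro ext sum.neutral ballI) (simp only: vf_apply_cmult[OF u(1)] u(2) mult_zero_right)
    finally show ?thesis .
  qed
  have "form_of k w \<in> closed_forms k"
    unfolding closed_forms_iff coords_form[OF w] by (intro conjI form_in_Omega w delta_of_invariant inv)
  moreover have "\<phi> = cohom_map k (form_of k w)"
  proof
    fix J
    show "\<phi> J = cohom_map k (form_of k w) J"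
    proof (cases "J \<in> ?S")
      case True
      have "w (enum J) p = (\<Sum>J'\<in>?S. if J' = J then u J p else 0)" for p
        unfolding w_def using True by (intro sum.cong) (simp_all add: dual_cochain_enum)
      then have "w (enum J) p = u J p" for p using True by simp
      then have "torus_avg (w (enum J)) = u J"
        using torus_avg_invariant[OF smooth_cochain[OF w] inv] by (simp add: fun_eq_iff)
      then show ?thesis using True u(3)[OF True] by (simp add: cohom_map_def coords_form[OF w] fun_eq_iff)
    next
      case False
      then show ?thesis using \<phi> by (simp add: cohom_map_def direct_sum_def)
    qed
  qed
  ultimately show "\<phi> \<in> cohom_map k ` closed_forms k" by blast
qed

text \<open>The product of the h_j is not a zero divisor among smooth functions, so the factor in
  \<open>cohom_map\<close> does not enlarge the kernel; the enumerated values then determine all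
  coefficients.\<close>

lemma cohom_map_eq_0_iff:
  assumes "\<alpha> \<in> Omega k"
  shows "cohom_map k \<alpha> = (\<lambda>J p. 0) \<longleftrightarrow> (\<forall>js. torus_avg (coords \<alpha> js) = (\<lambda>p. 0))"
proof
  note c = cochain_coords[OF assms]
  assume 0: "cohom_map k \<alpha> = (\<lambda>J p. 0)"
  have "(\<lambda>js. torus_avg (coords \<alpha> js)) = (\<lambda>js p. 0)"
  proof (rule cochain_zero_of_enum[OF cochain_torus_avg[OF c]])
    fix J :: "'a set" assume J: "card J = k"
    have "(\<Prod>j\<in>J. hfun j p) * torus_avg (coords \<alpha> (enum J)) p = 0" for p
      using fun_cong[OF fun_cong[OF 0, of J], of p] J by (simp add: cohom_map_def)
    then show "torus_avg (coords \<alpha> (enum J)) = (\<lambda>p. 0)"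
      by (intro ext zero_of_hfun_prod_mult_zero[OF finite[of J] smooth_torus_avg[OF smooth_cochain[OF c]]])
  qed
  then show "\<forall>js. torus_avg (coords \<alpha> js) = (\<lambda>p. 0)" by (simp add: fun_eq_iff)
qed (simp add: cohom_map_def fun_eq_iff)

lemma exact_iff_torus_avg_zero:
  fixes \<alpha> :: "'n::finite form"
  assumes \<alpha>: "\<alpha> \<in> closed_forms (Suc k)" and k: "k < CARD('n)"
  shows "\<alpha> \<in> exact_forms (Suc k) \<longleftrightarrow> (\<forall>js. torus_avg (coords \<alpha> js) = (\<lambda>p. 0))"
proof
  assume "\<alpha> \<in> exact_forms (Suc k)"
  then obtain b where b: "cochain k b" "\<alpha> = form_of (Suc k) (delta k b)" using exact_forms_Suc[OF k] by blast
  then show "\<forall>js. torus_avg (coords \<alpha> js) = (\<lambda>p. 0)"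
    by (simp add: coords_form[OF cochain_delta] torus_avg_delta smooth_cochain)
next
  assume 0: "\<forall>js. torus_avg (coords \<alpha> js) = (\<lambda>p. 0)"
  have \<Omega>: "\<alpha> \<in> Omega (Suc k)" and d: "delta (Suc k) (coords \<alpha>) = (\<lambda>js p. 0)"
    using \<alpha> closed_forms_iff by blast+
  obtain b where b: "cochain k b" "delta k b = (\<lambda>js p. coords \<alpha> js p - torus_avg (coords \<alpha> js) p)"
    using closed_minus_avg_list[OF cochain_coords[OF \<Omega>] d] unfolding torus_avg_def by blast
  have "delta k b = coords \<alpha>" unfolding b(2) using 0 by simp
  then have "\<alpha> = form_of (Suc k) (delta k b)" using form_coords[OF \<Omega>] by simp
  then show "\<alpha> \<in> exact_forms (Suc k)" using exact_forms_Suc[OF k] b(1) by blast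
qed

section \<open>The direct sum decomposition and the isomorphism\<close>

lemma zero_form_in_Omega: "zero_form \<in> Omega k"
  using form_in_Omega[OF cochain_zero, of k] by (simp add: form_zero)

lemma coords_zero_form: "coords zero_form js = (\<lambda>p. 0)"
  by (simp add: coords_def zero_form_def)

lemma coords_form_add: "coords (form_add \<alpha> \<beta>) js = (\<lambda>p. coords \<alpha> js p + coords \<beta> js p)"
  by (simp add: coords_def form_add_def)

lemma form_add_in_Omega: "\<alpha> \<in> Omega k \<Longrightarrow> \<beta> \<in> Omega k \<Longrightarrow> form_add \<alpha> \<beta> \<in> Omega k"
  using form_in_Omega[OF cochain_add[OF cochain_coords cochain_coords], of \<alpha> k \<beta>]
  by (simp add: form_add_form[symmetric] form_coords)

lemma exact_closed:
  fixes \<alpha> :: "'n::finite form"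
  assumes "\<alpha> \<in> exact_forms (Suc k)" "k < CARD('n)"
  shows "\<alpha> \<in> closed_forms (Suc k)"
proof -
  obtain b where b: "cochain k b" "\<alpha> = form_of (Suc k) (delta k b)" using assms exact_forms_Suc by blast
  note c = cochain_delta[OF b(1)]
  show ?thesis unfolding closed_forms_iff b(2) coords_form[OF c]
    by (intro conjI form_in_Omega c delta_delta b(1))
qed

lemma Wforms_closed: "\<alpha> \<in> Wforms k \<Longrightarrow> \<alpha> \<in> closed_forms k"
  unfolding Wforms_iff closed_forms_iff by (simp add: delta_of_invariant)

lemma closed_forms_decomposition:
  assumes k: "k < CARD('n::finite)"
  shows "closed_forms (Suc k) = {form_add w e | w e. w \<in> (Wforms (Suc k) :: 'n form set) \<and> e \<in> exact_forms (Suc k)}"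
proof (intro equalityI subsetI)
  fix \<alpha> :: "'n form" assume \<alpha>: "\<alpha> \<in> closed_forms (Suc k)"
  have \<Omega>: "\<alpha> \<in> Omega (Suc k)" and d: "delta (Suc k) (coords \<alpha>) = (\<lambda>js p. 0)"
    using \<alpha> closed_forms_iff by blast+
  note c = cochain_coords[OF \<Omega>]
  obtain b where b: "cochain k b" "delta k b = (\<lambda>js p. coords \<alpha> js p - torus_avg (coords \<alpha> js) p)"
    using closed_minus_avg_list[OF c d] unfolding torus_avg_def by blast
  \<comment> \<open>The torus average is the invariant component, and the primitive \<open>b\<close>
    accounts for the difference.\<close>
  let ?w = "form_of (Suc k) (\<lambda>js. torus_avg (coords \<alpha> js))" and ?e = "form_of (Suc k) (delta k b)"
  have "form_add ?w ?e = form_of (Suc k) (coords \<alpha>)" unfolding form_add_form b(2) by simp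
  then have "\<alpha> = form_add ?w ?e" using form_coords[OF \<Omega>] by simp
  moreover have "?w \<in> Wforms (Suc k)"
    unfolding Wforms_iff coords_form[OF cochain_torus_avg[OF c]]
    by (intro conjI form_in_Omega cochain_torus_avg c allI lx_torus_avg smooth_cochain[OF c])
  moreover have "?e \<in> exact_forms (Suc k)" using exact_forms_Suc[OF k] b(1) by blast
  ultimately show "\<alpha> \<in> {form_add w e | w e. w \<in> Wforms (Suc k) \<and> e \<in> exact_forms (Suc k)}" by blast
next
  fix \<alpha> :: "'n form"
  assume "\<alpha> \<in> {form_add w e | w e. w \<in> Wforms (Suc k) \<and> e \<in> exact_forms (Suc k)}"
  then obtain w e where \<alpha>: "\<alpha> = form_add w e" and "w \<in> Wforms (Suc k)" "e \<in> exact_forms (Suc k)" by blast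
  then have "w \<in> closed_forms (Suc k)" "e \<in> closed_forms (Suc k)"
    using Wforms_closed exact_closed[OF _ k] by blast+
  then have w: "w \<in> Omega (Suc k)" "delta (Suc k) (coords w) = (\<lambda>js p. 0)"
    and e: "e \<in> Omega (Suc k)" "delta (Suc k) (coords e) = (\<lambda>js p. 0)"
    using closed_forms_iff by blast+
  have "delta (Suc k) (coords \<alpha>) = (\<lambda>js p. 0)"
    using delta_add[OF smooth_cochain[OF cochain_coords[OF w(1)]] smooth_cochain[OF cochain_coords[OF e(1)]], of "Suc k"] w(2) e(2)
    by (simp add: \<alpha> coords_form_add[abs_def])
  then show "\<alpha> \<in> closed_forms (Suc k)"
    unfolding closed_forms_iff \<alpha> using form_add_in_Omega[OF w(1) e(1)] by simp
qed

text \<open>An invariant form has coefficients equal to their torus averages, and those averages are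
  zero for an exact form.\<close>

lemma Wforms_Int_exact_forms:
  assumes k: "k < CARD('n::finite)"
  shows "Wforms (Suc k) \<inter> exact_forms (Suc k) = {zero_form :: 'n form}"
proof (intro equalityI subsetI)
  fix \<alpha> :: "'n form" assume "\<alpha> \<in> Wforms (Suc k) \<inter> exact_forms (Suc k)"
  then have W: "\<alpha> \<in> Wforms (Suc k)" and e: "\<alpha> \<in> exact_forms (Suc k)" by auto
  have \<Omega>: "\<alpha> \<in> Omega (Suc k)" and inv: "lx i (coords \<alpha> js) = (\<lambda>p. 0)" for i js
    using W by (simp_all add: Wforms_iff)
  have "coords \<alpha> js = (\<lambda>p. 0)" for js
    using exact_iff_torus_avg_zero[OF exact_closed[OF e k] k] e torus_avg_invariant[OF smooth_cochain[OF cochain_coords[OF \<Omega>]] inv]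
    by simp
  then have "\<alpha> = zero_form"
    by (intro Omega_eqI[OF \<Omega> zero_form_in_Omega]) (simp add: coords_zero_form fun_eq_iff)
  then show "\<alpha> \<in> {zero_form}" by simp
next
  fix \<alpha> :: "'n form" assume "\<alpha> \<in> {zero_form}"
  then have \<alpha>: "\<alpha> = zero_form" by simp
  have "(zero_form :: 'n form) \<in> Wforms (Suc k)"
    by (simp add: Wforms_iff zero_form_in_Omega coords_zero_form)
  moreover have "delta k (\<lambda>(js :: nat \<Rightarrow> 'n) p. 0) = (\<lambda>js p. 0)" by (rule delta_of_invariant) simp
  then have "(zero_form :: 'n form) = form_of (Suc k) (delta k (\<lambda>js p. 0))" by (simp add: form_zero)
  then have "(zero_form :: 'n form) \<in> exact_forms (Suc k)"
    using exact_forms_Suc[OF k] cochain_zero by blast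
  ultimately show "\<alpha> \<in> Wforms (Suc k) \<inter> exact_forms (Suc k)" using \<alpha> by simp
qed

text \<open>The isomorphism is phrased without a quotient space: a linear map on closed forms, onto
  the direct sum and with the exact forms as kernel, induces it on cohomology.\<close>

theorem mainTheorem9:
  fixes k :: nat
  assumes "1 \<le> k" and "k \<le> CARD('n::finite)"
  shows "closed_forms k =
           {form_add w e | w e. w \<in> (Wforms k :: 'n form set) \<and> e \<in> exact_forms k}
       \<and> Wforms k \<inter> exact_forms k = {zero_form :: 'n form}
       \<and> (\<exists>\<Phi> :: 'n form \<Rightarrow> ('n set \<Rightarrow> 'n pt \<Rightarrow> real).
            (\<forall>\<alpha>\<in>closed_forms k. \<forall>\<beta>\<in>closed_forms k.
                \<Phi> (form_add \<alpha> \<beta>) = (\<lambda>J p. \<Phi> \<alpha> J p + \<Phi> \<beta> J p)) \<and>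
            (\<forall>\<alpha>\<in>closed_forms k. \<forall>c::real.
                \<Phi> (form_scale c \<alpha>) = (\<lambda>J p. c * \<Phi> \<alpha> J p)) \<and>
            \<Phi> ` closed_forms k = direct_sum k \<and>
            (\<forall>\<alpha>\<in>closed_forms k. \<Phi> \<alpha> = (\<lambda>J p. 0) \<longleftrightarrow> \<alpha> \<in> exact_forms k))
       \<and> card {J :: 'n set. card J = k} = CARD('n) choose k"
proof -
  \<comment> \<open>\<open>exact_forms k\<close> refers to degree k - 1, so writing k =
    \<open>Suc l\<close> removes the truncated subtraction.\<close>
  obtain l where l: "k = Suc l" "l < CARD('n)" using assms by (cases k) auto
  have \<Omega>: "\<alpha> \<in> Omega k" if "\<alpha> \<in> closed_forms k" for \<alpha> :: "'n form"
    using that closed_forms_iff by blast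
  have "cohom_map k (form_add \<alpha> \<beta>) = (\<lambda>J p. cohom_map k \<alpha> J p + cohom_map k \<beta> J p)"
    if "\<alpha> \<in> closed_forms k" "\<beta> \<in> closed_forms k" for \<alpha> \<beta> :: "'n form"
    using smooth_cochain[OF cochain_coords[OF \<Omega>[OF that(1)]]] smooth_cochain[OF cochain_coords[OF \<Omega>[OF that(2)]]]
    by (simp add: cohom_map_def fun_eq_iff coords_form_add torus_avg_add ring_distribs)
  moreover have "cohom_map k (form_scale c \<alpha>) = (\<lambda>J p. c * cohom_map k \<alpha> J p)" for c and \<alpha> :: "'n form"
  proof -
    have s: "coords (form_scale c \<alpha>) js = (\<lambda>p. c * coords \<alpha> js p)" for js
      by (simp add: coords_def form_scale_def)
    show ?thesis by (intro ext) (simp add: cohom_map_def s torus_avg_cmult)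
  qed
  moreover have "cohom_map k ` closed_forms k = (direct_sum k :: ('n set \<Rightarrow> 'n pt \<Rightarrow> real) set)"
    using direct_sum_subset_cohom_map cohom_map_in_direct_sum \<Omega> by blast
  moreover have "cohom_map k \<alpha> = (\<lambda>J p. 0) \<longleftrightarrow> \<alpha> \<in> exact_forms k" if "\<alpha> \<in> closed_forms k" for \<alpha> :: "'n form"
    using cohom_map_eq_0_iff[OF \<Omega>[OF that]] exact_iff_torus_avg_zero[OF that[unfolded l(1)] l(2)] l(1) by simp
  moreover have "card {J :: 'n set. card J = k} = CARD('n) choose k"
    using n_subsets[of "UNIV :: 'n set" k] by simp
  ultimately show ?thesis
    using closed_forms_decomposition[OF l(2)] Wforms_Int_exact_forms[OF l(2)] unfolding l(1)[symmetric]
    by (intro conjI exI[of _ "cohom_map k"] ballI allI)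
qed

end
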